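(* Let $1\le r\le\infty$, $1\le p,q<\infty$, let $\mathcal G=(V,E)$ be a connected simple graph whose counting measure satisfies the doubling property, let $w$ be a Muckenhoupt $A_p$-weight and $w'$ a Muckenhoupt $A_q$-weight on $V$, and let $A\in\mathcal B_{r,\alpha}(\mathcal G)$ for some $\alpha>\tilde d_{\mathcal G}-d_{\mathcal G}/r$. If $A$ has $\ell^p_w$-stability with optimal lower stability bound $\beta_{p,w}(A)$, i.e. $$\beta_{p,w}(A)\|c\|_{p,w}\le\|Ac\|_{p,w}\quad\text{for all } c\in\ell^p_w,$$ then $A$ has $\ell^q_{w'}$-stability, with optimal lower stability bound denoted by $\beta_{q,w'}(A)$, i.e. $$\beta_{q,w'}(A)\|c\|_{q,w'}\le\|Ac\|_{q,w'}\quad\text{for all } c\in\ell^q_{w'}.$$ Moreover, there exists an absolute constant $C$, independent of the matrices $A\in\mathcal B_{r,\alpha}(\mathcal G)$ and of the weights $w,w'$, such that $$\frac{\beta_{p,w}(A)}{\beta_{q,w'}(A)}\le C\,(A_q(w'))^{1/q}(A_p(w))^{1/p}\left(\frac{(A_p(w))^{2/p}\|A\|_{\mathcal B_{r,\alpha}}}{\beta_{p,w}(A)}\right)^{E}\times\begin{cases}1&\text{if }\alpha\ne1+d_{\mathcal G}/r',\\[4pt]\left(\ln\left(1+\frac{(A_p(w))^{2/p}\|A\|_{\mathcal B_{r,\alpha}}}{\beta_{p,w}(A)}\right)\right)^{(2d_{\mathcal G}+1)/r'}&\text{if }\alpha=1+d_{\mathcal G}/r',\end{cases}$$ where $1/r'=1-1/r$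 and $$E=E(\alpha,r,d_{\mathcal G})=\frac{\tilde d_{\mathcal G}+d_{\mathcal G}+1}{\min(1,\alpha-d_{\mathcal G}/r')}.$$
   Context: Graph. $\rho$ is the geodesic distance on the connected simple graph $\mathcal G=(V,E)$ (number of edges in a shortest path), $B(\lambda,r)=\{\lambda'\in V:\rho(\lambda,\lambda')\le r\}$, and $\mu$ is the counting measure on $V$. Doubling property: there is $D>0$ with $\mu(B(\lambda,2r))\le D\mu(B(\lambda,r))$ for all $\lambda\in V$, $r>0$. Beurling dimension. $d_{\mathcal G}$ and $D_{\mathcal G}$ are the minimal constants $d_1,D_1$ such that $\mu(B(\lambda,r))\le D_1(r+1)^{d_1}$ for all $\lambda\in V$, $r\ge0$. Generalized Beurling dimension. For $N\ge0$, a set $V_N\subset V$ is maximal $N$-disjoint if $B(\lambda,N)\cap\bigcup_{\lambda_m\in V_N}B(\lambda_m,N)\ne\emptyset$ for all $\lambda\in V$ and $B(\lambda_m,N)\cap B(\lambda_n,N)=\emptyset$ for all distinct $\lambda_m,\lambda_n\in V_N$. $\tilde d_{\mathcal G}$ and $\tilde D_{\mathcal G}$ are the minimal constants $d,D$ such that $\sup_{\lambda\in V}\mu(\{\lambda_m\in V_N:\rho(\lambda_m,\lambda)\le(N+1)R\})\le D(R+1)^d$ for all $R,N\ge0$ and all maximal $N$-disjoint sets $V_N$. Beurling algebra. For a matrix $A=(a(\lambda,\lambda'))_{\lambda,\lambda'\in V}$ put $h_A(n)=\sup_{\rho(\lambda,\lambda')\ge n}|a(\lambda,\lambda')|$. For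 $1\le r\le\infty$, $\alpha\ge0$, $\mathcal B_{r,\alpha}(\mathcal G)$ is the set of matrices with $\|A\|_{\mathcal B_{r,\alpha}}<\infty$, where $\|A\|_{\mathcal B_{r,\alpha}}=\big(\sum_{n=0}^\infty h_A(n)^r(n+1)^{\alpha r+d_{\mathcal G}-1}\big)^{1/r}$ if $r<\infty$ and $\|A\|_{\mathcal B_{\infty,\alpha}}=\sup_{n\ge0}h_A(n)(n+1)^\alpha$. Weights. For $1<p<\infty$, a positive function $w=(w(\lambda))_{\lambda\in V}$ is a Muckenhoupt $A_p$-weight if there is $C>0$ with $\big(\frac1{\mu(B)}\sum_{\lambda\in B}w(\lambda)\big)\big(\frac1{\mu(B)}\sum_{\lambda\in B}w(\lambda)^{-1/(p-1)}\big)^{p-1}\le C$ for all balls $B\subset V$; it is an $A_1$-weight if $\frac1{\mu(B)}\sum_{\lambda\in B}w(\lambda)\le C\inf_{\lambda\in B}w(\lambda)$ for all balls $B$. The smallest such $C$ is the $A_p$-bound $A_p(w)$. Stability. $\ell^p_w$ is the space of sequences $c=(c(\lambda))_{\lambda\in V}$ with $\|c\|_{p,w}=(\sum_{\lambda\in V}|c(\lambda)|^pw(\lambda))^{1/p}<\infty$. $A$ has $\ell^p_w$-stability if there are positive constants $B_1,B_2$ with $B_1\|c\|_{p,w}\le\|Ac\|_{p,w}\le B_2\|c\|_{p,w}$ for all $c\in\ell^p_w$; the maximal such $B_1$ is the optimal lower $\ell^p_w$-stability bound $\beta_{p,w}(A)$. *)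

theory Defs
  imports "HOL-Analysis.Analysis"
begin

definition simple_graph :: "'v set \<Rightarrow> 'v set set \<Rightarrow> bool" where
  "simple_graph V E \<longleftrightarrow> (\<forall>e\<in>E. e \<subseteq> V \<and> card e = 2)"

definition walk :: "'v set \<Rightarrow> 'v set set \<Rightarrow> 'v \<Rightarrow> 'v list \<Rightarrow> 'v \<Rightarrow> bool" where
  "walk V E x xs y \<longleftrightarrow> xs \<noteq> [] \<and> hd xs = x \<and> last xs = y \<and> set xs \<subseteq> V \<and>
     successively (\<lambda>a b. {a, b} \<in> E) xs"

definition connected_simple_graph :: "'v set \<Rightarrow> 'v set set \<Rightarrow> bool" where
  "connected_simple_graph V E \<longleftrightarrow> simple_graph V E \<and> V \<noteq> {} \<and>
     (\<forall>x\<in>V. \<forall>y\<in>V. \<exists>xs. walk V E x xs y)"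

text \<open>A walk is given by its list of vertices, so its number of edges is one less than the
  length of the list.\<close>
definition gdist :: "'v set \<Rightarrow> 'v set set \<Rightarrow> 'v \<Rightarrow> 'v \<Rightarrow> nat" where
  "gdist V E x y = (LEAST n. \<exists>xs. walk V E x xs y \<and> length xs = Suc n)"

definition gball :: "'v set \<Rightarrow> 'v set set \<Rightarrow> 'v \<Rightarrow> real \<Rightarrow> 'v set" where
  "gball V E x r = {y \<in> V. real (gdist V E x y) \<le> r}"

text \<open>The counting measure may be infinite here. Since balls of radius less than \<open>1\<close> are
  singletons, iterating the doubling inequality shows that all balls are finite, which the sums
  over balls in the weight conditions below rely on.\<close>
definition doubling :: "'v set \<Rightarrow> 'v set set \<Rightarrow> bool" where
  "doubling V E \<longleftrightarrow> (\<exists>D>0. \<forall>x\<in>V. \<forall>r>0.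
     emeasure (count_space V) (gball V E x (2 * r))
       \<le> ennreal D * emeasure (count_space V) (gball V E x r))"

definition is_minimal_real :: "(real \<Rightarrow> bool) \<Rightarrow> real \<Rightarrow> bool" where
  "is_minimal_real P d \<longleftrightarrow> P d \<and> (\<forall>d'. P d' \<longrightarrow> d \<le> d')"

definition beurling_dimension :: "'v set \<Rightarrow> 'v set set \<Rightarrow> real \<Rightarrow> bool" where
  "beurling_dimension V E = is_minimal_real (\<lambda>d. \<exists>D. \<forall>x\<in>V. \<forall>r\<ge>0.
     emeasure (count_space V) (gball V E x r) \<le> ennreal (D * (r + 1) powr d))"

definition maximal_disjoint :: "'v set \<Rightarrow> 'v set set \<Rightarrow> real \<Rightarrow> 'v set \<Rightarrow> bool" where
  "maximal_disjoint V E N S \<longleftrightarrow> S \<subseteq> V \<and>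
     (\<forall>x\<in>V. gball V E x N \<inter> (\<Union>y\<in>S. gball V E y N) \<noteq> {}) \<and>
     (\<forall>y\<in>S. \<forall>z\<in>S. y \<noteq> z \<longrightarrow> gball V E y N \<inter> gball V E z N = {})"

definition gen_beurling_dimension :: "'v set \<Rightarrow> 'v set set \<Rightarrow> real \<Rightarrow> bool" where
  "gen_beurling_dimension V E = is_minimal_real (\<lambda>d. \<exists>D. \<forall>R\<ge>0. \<forall>N\<ge>0. \<forall>S.
     maximal_disjoint V E N S \<longrightarrow>
       (SUP x\<in>V. emeasure (count_space V) {y \<in> S. real (gdist V E y x) \<le> (N + 1) * R})
         \<le> ennreal (D * (R + 1) powr d))"

text \<open>The supremum is taken in \<open>[0, \<infinity>)\<close>, hence is \<open>0\<close> when no pair of vertices is at distance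
  at least \<open>n\<close>; this is why \<open>0\<close> is inserted.\<close>
definition decay :: "'v set \<Rightarrow> 'v set set \<Rightarrow> ('v \<Rightarrow> 'v \<Rightarrow> complex) \<Rightarrow> nat \<Rightarrow> real" where
  "decay V E A n = Sup (insert 0 {cmod (A x y) |x y. x \<in> V \<and> y \<in> V \<and> n \<le> gdist V E x y})"

text \<open>In the next two definitions \<open>d\<close> is meant to be the Beurling dimension of the graph. The
  boundedness of the entries says that all the suprema \<open>decay V E A n\<close> are finite.\<close>
definition beurling_algebra ::
  "'v set \<Rightarrow> 'v set set \<Rightarrow> real \<Rightarrow> ereal \<Rightarrow> real \<Rightarrow> ('v \<Rightarrow> 'v \<Rightarrow> complex) set" where
  "beurling_algebra V E d r \<alpha> = {A.
     bdd_above {cmod (A x y) |x y. x \<in> V \<and> y \<in> V} \<and>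
     (if r = \<infinity> then bdd_above (range (\<lambda>n. decay V E A n * (real n + 1) powr \<alpha>))
      else summable (\<lambda>n. decay V E A n powr real_of_ereal r *
                         (real n + 1) powr (\<alpha> * real_of_ereal r + d - 1)))}"

definition beurling_norm ::
  "'v set \<Rightarrow> 'v set set \<Rightarrow> real \<Rightarrow> ereal \<Rightarrow> real \<Rightarrow> ('v \<Rightarrow> 'v \<Rightarrow> complex) \<Rightarrow> real" where
  "beurling_norm V E d r \<alpha> A =
     (if r = \<infinity> then (SUP n. decay V E A n * (real n + 1) powr \<alpha>)
      else (\<Sum>n. decay V E A n powr real_of_ereal r *
                  (real n + 1) powr (\<alpha> * real_of_ereal r + d - 1)) powr (1 / real_of_ereal r))"

definition ball_avg :: "'v set \<Rightarrow> 'v set set \<Rightarrow> ('v \<Rightarrow> real) \<Rightarrow> 'v \<Rightarrow> real \<Rightarrow> real" where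
  "ball_avg V E f x r = (\<Sum>y\<in>gball V E x r. f y) / measure (count_space V) (gball V E x r)"

definition Ap_condition ::
  "'v set \<Rightarrow> 'v set set \<Rightarrow> real \<Rightarrow> ('v \<Rightarrow> real) \<Rightarrow> real \<Rightarrow> bool" where
  "Ap_condition V E p w C \<longleftrightarrow> C > 0 \<and> (\<forall>x\<in>V. \<forall>r\<ge>0.
     if p = 1 then ball_avg V E w x r \<le> C * (INF y\<in>gball V E x r. w y)
     else ball_avg V E w x r *
            ball_avg V E (\<lambda>y. w y powr (- 1 / (p - 1))) x r powr (p - 1) \<le> C)"

definition Ap_weight :: "'v set \<Rightarrow> 'v set set \<Rightarrow> real \<Rightarrow> ('v \<Rightarrow> real) \<Rightarrow> bool" where
  "Ap_weight V E p w \<longleftrightarrow> (\<forall>x\<in>V. w x > 0) \<and> (\<exists>C. Ap_condition V E p w C)"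

definition Ap_bound :: "'v set \<Rightarrow> 'v set set \<Rightarrow> real \<Rightarrow> ('v \<Rightarrow> real) \<Rightarrow> real" where
  "Ap_bound V E p w = Inf {C. Ap_condition V E p w C}"

definition lpw :: "'v set \<Rightarrow> real \<Rightarrow> ('v \<Rightarrow> real) \<Rightarrow> ('v \<Rightarrow> complex) set" where
  "lpw V p w = {c. (\<lambda>x. cmod (c x) powr p * w x) summable_on V}"

definition lpw_norm :: "'v set \<Rightarrow> real \<Rightarrow> ('v \<Rightarrow> real) \<Rightarrow> ('v \<Rightarrow> complex) \<Rightarrow> real" where
  "lpw_norm V p w c = (\<Sum>\<^sub>\<infinity>x\<in>V. cmod (c x) powr p * w x) powr (1 / p)"

definition mat_apply ::
  "'v set \<Rightarrow> ('v \<Rightarrow> 'v \<Rightarrow> complex) \<Rightarrow> ('v \<Rightarrow> complex) \<Rightarrow> 'v \<Rightarrow> complex" where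
  "mat_apply V A c x = (\<Sum>\<^sub>\<infinity>y\<in>V. A x y * c y)"

text \<open>Since \<open>infsum\<close> is \<open>0\<close> on non-summable families, the convergence of the series defining
  \<open>A c\<close> and the finiteness of its norm (which the upper bound asserts) are stated explicitly.\<close>
definition lpw_stable ::
  "'v set \<Rightarrow> real \<Rightarrow> ('v \<Rightarrow> real) \<Rightarrow> ('v \<Rightarrow> 'v \<Rightarrow> complex) \<Rightarrow> bool" where
  "lpw_stable V p w A \<longleftrightarrow> (\<exists>B1>0. \<exists>B2>0. \<forall>c\<in>lpw V p w.
     (\<forall>x\<in>V. (\<lambda>y. A x y * c y) summable_on V) \<and>
     mat_apply V A c \<in> lpw V p w \<and>
     B1 * lpw_norm V p w c \<le> lpw_norm V p w (mat_apply V A c) \<and>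
     lpw_norm V p w (mat_apply V A c) \<le> B2 * lpw_norm V p w c)"

definition stability_bound ::
  "'v set \<Rightarrow> real \<Rightarrow> ('v \<Rightarrow> real) \<Rightarrow> ('v \<Rightarrow> 'v \<Rightarrow> complex) \<Rightarrow> real" where
  "stability_bound V p w A = Sup {B. B > 0 \<and>
     (\<forall>c\<in>lpw V p w. B * lpw_norm V p w c \<le> lpw_norm V p w (mat_apply V A c))}"

text \<open>\<open>inv_exp r\<close> is \<open>1/r\<close>, which is \<open>0\<close> for \<open>r = \<infinity>\<close>, and \<open>inv_conj_exp r\<close> is \<open>1/r'\<close> for the
  conjugate exponent \<open>r'\<close>.\<close>
definition inv_exp :: "ereal \<Rightarrow> real" where
  "inv_exp r = real_of_ereal (1 / r)"

definition inv_conj_exp :: "ereal \<Rightarrow> real" where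
  "inv_conj_exp r = 1 - inv_exp r"

end

theory Submission
  imports Defs
begin

text \<open>
  Stability is carried from \<open>\<ell>\<^sup>p\<^sub>w\<close> to \<open>\<ell>\<^sup>q\<^bsub>w'\<^esub>\<close> by a pointwise estimate that mentions neither
  \<open>q\<close> nor \<open>w'\<close>: if \<open>A\<close> is \<open>\<ell>\<^sup>p\<^sub>w\<close>-stable with lower bound \<open>\<beta>\<close>, then, for a suitable scale \<open>N\<close>,
  \<open>\<bar>c(y)\<bar> \<le> C N\<^sup>d A\<^sub>p(w)\<^bsup>1/p\<^esup> \<beta>\<^bsup>-1\<^esup> \<Sum>\<^sub>z (1 + \<rho>(y,z)/N)\<^bsup>-\<gamma>\<^esup> \<bar>Ac(z)\<bar>\<close> (\<open>stable_kernel_bound\<close>).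
  Since \<open>\<gamma> > d\<close>, the kernel on the right is bounded on \<open>\<ell>\<^sup>q\<^bsub>w'\<^esub>\<close> with norm at most
  \<open>C N\<^sup>d A\<^sub>q(w')\<^bsup>1/q\<^esup>\<close> (\<open>kernel_weighted_bound\<close>), and the two estimates together give
  \<open>\<beta>\<^sub>p / \<beta>\<^sub>q \<le> C A\<^sub>p(w)\<^bsup>1/p\<^esup> A\<^sub>q(w')\<^bsup>1/q\<^esup> N\<^bsup>2d\<^esup>\<close>.

  Here \<open>\<gamma> = \<alpha> + d/r\<close>. The membership of \<open>A\<close> in the Beurling algebra enters through
  \<open>\<bar>A(x,y)\<bar> \<le> C \<parallel>A\<parallel> (1 + \<rho>(x,y))\<^bsup>-\<gamma>\<^esup>\<close>, which holds because the decay profile is monotone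
  (\<open>beurling_decay_bound\<close>). The hypothesis on \<open>\<alpha>\<close> says \<open>\<gamma> > dt\<close>, and \<open>dt \<ge> d\<close> because the whole vertex
  set is a maximal \<open>0\<close>-disjoint set.

  The pointwise estimate comes from localisation. Let \<open>S\<close> be a maximal \<open>N\<close>-disjoint set, and let
  \<open>a(m)\<close>, for \<open>m\<close> in \<open>S\<close>, be the normalised local \<open>\<ell>\<^sup>p\<^sub>w\<close> norm of \<open>c\<close> near \<open>m\<close>. Applying stability to
  \<open>\<psi>\<^sub>m c\<close>, where \<open>\<psi>\<^sub>m\<close> is a cutoff of width \<open>N\<close> around \<open>m\<close>, and commuting \<open>\<psi>\<^sub>m\<close> with \<open>A\<close> gives
  \<open>\<beta> a(m) \<le> 3 b(m) + C A\<^sub>p(w)\<^bsup>2/p\<^esup> \<parallel>A\<parallel> N\<^bsup>-s\<^esup> H(m)\<close> (\<open>local_stability\<close>), where \<open>b(m)\<close> is the sum of \<open>\<bar>Ac\<bar>\<close>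
  near \<open>m\<close> and \<open>H(m) = \<Sum>\<^sub>n (1 + \<rho>(m,n)/N)\<^bsup>-\<gamma>\<^esup> a(n)\<close>. Because \<open>\<gamma> > dt\<close>, the kernel
  \<open>(1 + \<rho>/N)\<^bsup>-\<gamma>\<^esup>\<close> on \<open>S\<close> reproduces itself under composition up to a constant
  (\<open>separated_kernel_convolution\<close>). Summing the inequality against the kernel therefore turns the last
  term into a small multiple of \<open>H\<close> as soon as \<open>N\<^sup>s\<close> exceeds a multiple of
  \<open>x = A\<^sub>p(w)\<^bsup>2/p\<^esup> \<parallel>A\<parallel> / \<beta>\<close>, and absorbing it leaves \<open>H \<le> C \<beta>\<^bsup>-1\<^esup> \<Sum>\<^sub>n (1 + \<rho>/N)\<^bsup>-\<gamma>\<^esup> b(n)\<close>. This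
  absorption replaces a Neumann series.

  The gain \<open>N\<^bsup>-s\<^esup>\<close> is available for every \<open>s \<le> 1\<close> with \<open>s < \<gamma> - d = \<alpha> - d/r'\<close>, and \<open>N\<close> is of size
  \<open>x\<^bsup>1/s\<^esup>\<close>. Choosing \<open>s\<close> slightly below \<open>min(1, \<alpha> - d/r')\<close> turns \<open>N\<^bsup>2d\<^esup>\<close> into
  \<open>x\<^bsup>2d/s\<^esup>\<close> with \<open>2d/s \<le> (2d + 1)/min(1, \<alpha> - d/r') \<le> E\<close>. Since \<open>x\<close> is bounded below by a
  constant (\<open>A\<close> is bounded on \<open>\<ell>\<^sup>p\<^sub>w\<close>), the larger exponent \<open>E\<close> costs only a constant, and so does the
  logarithm in the critical case, which is bounded below.
\<close>

section \<open>Inequalities for powers and sums\<close>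

text \<open>
  Jensen's inequality. Weights of total mass less than one are allowed, since rescaling them to mass
  one only gains a power of the mass; terms that vanish are discarded beforehand because the convexity
  of the power is used on the positive axis.
\<close>
lemma sum_powr_jensen:
  fixes \<theta> u :: "'i \<Rightarrow> real"
  assumes p: "1 \<le> p" and fin: "finite J"
    and \<theta>: "\<And>j. j \<in> J \<Longrightarrow> 0 \<le> \<theta> j" "(\<Sum>j\<in>J. \<theta> j) \<le> 1"
    and u: "\<And>j. j \<in> J \<Longrightarrow> 0 \<le> u j"
  shows "(\<Sum>j\<in>J. \<theta> j * u j) powr p \<le> (\<Sum>j\<in>J. \<theta> j * u j powr p)"
proof -
  define I where "I = {j \<in> J. 0 < \<theta> j * u j}"
  define T where "T = (\<Sum>j\<in>I. \<theta> j)"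
  have I: "finite I" "I \<subseteq> J" using fin by (auto simp: I_def)
  have pos: "0 < \<theta> j" "0 < u j" if "j \<in> I" for j
    using that \<theta>(1)[of j] u[of j] by (auto simp: I_def zero_less_mult_iff)
  have zero: "\<theta> j * u j = 0" if "j \<in> J - I" for j
  proof -
    have "0 \<le> \<theta> j * u j" using that \<theta>(1) u by auto
    thus ?thesis using that by (auto simp: I_def)
  qed
  have restr: "(\<Sum>j\<in>J. \<theta> j * u j) = (\<Sum>j\<in>I. \<theta> j * u j)"
    by (rule sum.mono_neutral_right) (use fin I zero in auto)
  show ?thesis
  proof (cases "I = {}")
    case True
    thus ?thesis using restr \<theta> u by (auto intro!: sum_nonneg)
  next
    case False
    have T: "0 < T" unfolding T_def using I False pos by (auto intro!: sum_pos)
    have T1: "T \<le> 1"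
      unfolding T_def by (rule order_trans[OF sum_mono2[OF fin I(2)] \<theta>(2)]) (use \<theta>(1) in auto)
    have "(\<Sum>j\<in>I. (\<theta> j / T) *\<^sub>R u j) powr p \<le> (\<Sum>j\<in>I. (\<theta> j / T) * u j powr p)"
      by (rule convex_on_sum[OF I(1) False powr_convex[OF p]])
        (use T pos in \<open>auto simp: T_def sum_divide_distrib[symmetric] less_imp_le\<close>)
    also have "(\<Sum>j\<in>I. (\<theta> j / T) *\<^sub>R u j) = (\<Sum>j\<in>I. \<theta> j * u j) / T"
      by (simp add: sum_divide_distrib)
    also have "\<dots> powr p = (\<Sum>j\<in>I. \<theta> j * u j) powr p / T powr p"
      by (rule powr_divide)
    also have "(\<Sum>j\<in>I. (\<theta> j / T) * u j powr p) = (\<Sum>j\<in>I. \<theta> j * u j powr p) / T"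
      by (simp add: sum_divide_distrib)
    finally have *: "(\<Sum>j\<in>I. \<theta> j * u j) powr p \<le> (\<Sum>j\<in>I. \<theta> j * u j powr p) / T * T powr p"
      using T by (simp add: field_simps)
    have "T powr p \<le> T powr 1" using T T1 p by (intro powr_mono') auto
    hence "(\<Sum>j\<in>I. \<theta> j * u j powr p) / T * T powr p \<le> (\<Sum>j\<in>I. \<theta> j * u j powr p) / T * T"
      using T pos by (intro mult_left_mono divide_nonneg_pos sum_nonneg) (auto simp: less_imp_le)
    also have "\<dots> \<le> (\<Sum>j\<in>J. \<theta> j * u j powr p)"
      using T sum_mono2[OF fin I(2), of "\<lambda>j. \<theta> j * u j powr p"] \<theta>(1) by auto
    finally show ?thesis using * restr by simp
  qed
qed

lemma sum_powr_le_powr_sum: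
  fixes f :: "'i \<Rightarrow> real"
  assumes "finite F" and f: "\<And>i. i \<in> F \<Longrightarrow> 0 \<le> f i" and p: "1 \<le> p"
  shows "(\<Sum>i\<in>F. f i powr p) \<le> (\<Sum>i\<in>F. f i) powr p"
proof -
  define S where "S = (\<Sum>i\<in>F. f i)"
  have S: "f i \<le> S" if "i \<in> F" for i
    unfolding S_def using assms that by (intro member_le_sum) auto
  have S0: "0 \<le> S" unfolding S_def using f by (rule sum_nonneg)
  have split: "a powr p = a * a powr (p - 1)" if "0 \<le> a" for a :: real
    using that by (cases "a = 0") (auto simp: powr_mult_base)
  have "(\<Sum>i\<in>F. f i powr p) = (\<Sum>i\<in>F. f i * f i powr (p - 1))"
    using f split by (intro sum.cong) auto
  also have "\<dots> \<le> (\<Sum>i\<in>F. f i * S powr (p - 1))"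
    using f S p by (intro sum_mono mult_left_mono powr_mono2) auto
  also have "\<dots> = S powr p" using split[OF S0] by (simp add: S_def sum_distrib_right)
  finally show ?thesis by (simp add: S_def)
qed

text \<open>
  This and the next lemma replace Minkowski's inequality for three functions: an estimate of
  \<open>p\<close>-th powers passes to an estimate of norms at the price of a factor \<open>3\<close>, uniformly in \<open>p\<close>.
\<close>
lemma powr_sum3_le:
  fixes a b c p :: real
  assumes "0 \<le> a" "0 \<le> b" "0 \<le> c" "0 \<le> p"
  shows "(a + b + c) powr p \<le> 3 powr p * (a powr p + b powr p + c powr p)"
proof -
  define m where "m = max a (max b c)"
  have "(a + b + c) powr p \<le> (3 * m) powr p"
    using assms by (intro powr_mono2) (auto simp: m_def)
  also have "\<dots> = 3 powr p * m powr p" by (rule powr_mult)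
  also have "m powr p \<le> a powr p + b powr p + c powr p"
    by (auto simp: m_def max_def)
  finally show ?thesis by (simp add: mult_left_mono)
qed

lemma powr_le_cancel_sum3:
  fixes X a b c p :: real
  assumes p: "1 \<le> p" and nn: "0 \<le> X" "0 \<le> a" "0 \<le> b" "0 \<le> c"
    and le: "X powr p \<le> 3 powr p * (a powr p + b powr p + c powr p)"
  shows "X \<le> 3 * (a + b + c)"
proof -
  have "a powr p + b powr p \<le> (a + b) powr p" if "0 \<le> a" "0 \<le> b" for a b :: real
    using sum_powr_le_powr_sum[of "{True, False}" "\<lambda>i. if i then a else b" p] that p by auto
  from this[of a b] this[of "a + b" c]
  have "a powr p + b powr p + c powr p \<le> (a + b + c) powr p" using nn by auto
  hence "X powr p \<le> 3 powr p * (a + b + c) powr p"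
    using le by (meson mult_left_mono order_trans powr_ge_zero)
  also have "\<dots> = (3 * (a + b + c)) powr p" using nn by (subst powr_mult) auto
  finally show ?thesis using p nn powr_less_mono2[of p "3 * (a + b + c)" X] by force
qed

lemma min_le_powr:
  fixes \<tau> t s :: real
  assumes "t \<le> 1" "t \<le> \<tau>" "0 < \<tau>" "0 \<le> s" "s \<le> 1"
  shows "t \<le> \<tau> powr s"
proof (cases "\<tau> \<le> 1")
  case True
  hence "\<tau> powr 1 \<le> \<tau> powr s" using assms by (intro powr_mono') auto
  thus ?thesis using assms by simp
next
  case False
  hence "1 \<le> \<tau> powr s" using assms by (simp add: ge_one_powr_ge_zero)
  thus ?thesis using assms by linarith
qed

lemma two_power_powr: "(2 ^ j :: real) powr a = (2 powr a) ^ j"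
  by (induction j) (simp_all add: powr_mult)

text \<open>
  A polynomially decaying kernel is dominated by a geometric combination of indicators of balls with
  radii \<open>N 2\<^sup>j\<close>. Only the first ball that contains the point is used; its radius is at most twice \<open>N + t\<close>.
\<close>
lemma dyadic_kernel_bound:
  fixes g N t :: real
  assumes g: "0 \<le> g" and N: "0 < N" and t: "0 \<le> t" "t \<le> N * 2 ^ J"
  shows "(1 + t / N) powr (- g)
    \<le> (\<Sum>j\<le>J. 2 powr g * (2 powr (- g)) ^ j * (if t \<le> N * 2 ^ j then 1 else 0))"
proof -
  define j where "j = (LEAST j. t \<le> N * 2 ^ j)"
  have j: "t \<le> N * 2 ^ j" "j \<le> J"
    unfolding j_def using t LeastI[of "\<lambda>j. t \<le> N * 2 ^ j" J] by (auto intro: Least_le)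
  have low: "2 ^ j \<le> 2 * (1 + t / N)"
  proof (cases j)
    case 0 thus ?thesis using t N by simp
  next
    case (Suc i)
    have "\<not> t \<le> N * 2 ^ i" using not_less_Least[of i "\<lambda>j. t \<le> N * 2 ^ j"] Suc
      unfolding j_def by auto
    thus ?thesis using N Suc by (simp add: field_simps)
  qed
  have "(2 * (1 + t / N)) powr (- g) \<le> (2 ^ j) powr (- g)"
    using low g by (intro powr_mono2') auto
  also have "(2 ^ j :: real) powr (- g) = (2 powr (- g)) ^ j"
    by (rule two_power_powr)
  finally have "2 powr (- g) * (1 + t / N) powr (- g) \<le> (2 powr (- g)) ^ j"
    by (simp only: powr_mult)
  hence "2 powr g * (2 powr (- g) * (1 + t / N) powr (- g)) \<le> 2 powr g * (2 powr (- g)) ^ j"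
    by (rule mult_left_mono) simp
  hence "(1 + t / N) powr (- g) \<le> 2 powr g * (2 powr (- g)) ^ j"
    by (simp add: mult.assoc[symmetric] flip: powr_add)
  also have "\<dots> = 2 powr g * (2 powr (- g)) ^ j * (if t \<le> N * 2 ^ j then 1 else 0)" using j by simp
  also have "\<dots> \<le> (\<Sum>j\<le>J. 2 powr g * (2 powr (- g)) ^ j * (if t \<le> N * 2 ^ j then 1 else 0))"
    using j by (intro member_le_sum[of j "{..J}"
        "\<lambda>j. 2 powr g * (2 powr (- g)) ^ j * (if t \<le> N * 2 ^ j then 1 else 0)"]) auto
  finally show ?thesis .
qed

lemma sum_power_le_geometric:
  fixes q :: real
  assumes "0 \<le> q" "q < 1"
  shows "(\<Sum>j\<le>J. q ^ j) \<le> 1 / (1 - q)"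
  using sum_le_suminf[of "\<lambda>j. q ^ j" "{..J}"] suminf_geometric[of q] summable_geometric[of q] assms
  by auto

lemma two_powr_neg_less_1: "0 < a \<Longrightarrow> 2 powr (- a) < (1 :: real)"
  using powr_less_mono[of "- a" 0 2] by simp

lemma sum_if_1_eq_card:
  "finite F \<Longrightarrow> real (card {i \<in> F. P i}) = (\<Sum>i\<in>F. if P i then 1 else 0)"
  by (simp add: sum.inter_filter[symmetric])

lemma infsum_finite_sum:
  fixes f :: "'i \<Rightarrow> 'a \<Rightarrow> real"
  assumes "finite F" "\<And>i. i \<in> F \<Longrightarrow> f i summable_on A"
  shows "(\<lambda>x. \<Sum>i\<in>F. f i x) summable_on A"
    and "(\<Sum>\<^sub>\<infinity>x\<in>A. \<Sum>i\<in>F. f i x) = (\<Sum>i\<in>F. \<Sum>\<^sub>\<infinity>x\<in>A. f i x)"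
proof -
  have "(\<lambda>x. \<Sum>i\<in>F. f i x) summable_on A
      \<and> (\<Sum>\<^sub>\<infinity>x\<in>A. \<Sum>i\<in>F. f i x) = (\<Sum>i\<in>F. \<Sum>\<^sub>\<infinity>x\<in>A. f i x)"
    using assms by (induction F rule: finite_induct) (auto simp: summable_on_add infsum_add)
  thus "(\<lambda>x. \<Sum>i\<in>F. f i x) summable_on A"
    and "(\<Sum>\<^sub>\<infinity>x\<in>A. \<Sum>i\<in>F. f i x) = (\<Sum>i\<in>F. \<Sum>\<^sub>\<infinity>x\<in>A. f i x)" by auto
qed

text \<open>
  A weighted norm inequality for a nonnegative kernel that holds on all finite truncations, with
  one constant, extends to infinite sums and includes the convergence of the row sums.
\<close>
lemma weighted_kernel_transfer:
  fixes k :: "'a \<Rightarrow> 'a \<Rightarrow> real" and f w :: "'a \<Rightarrow> real"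
  assumes p: "1 \<le> p" and L: "0 \<le> L" and w: "\<And>x. x \<in> V \<Longrightarrow> 0 < w x"
    and k: "\<And>x y. x \<in> V \<Longrightarrow> y \<in> V \<Longrightarrow> 0 \<le> k x y" and f: "\<And>y. y \<in> V \<Longrightarrow> 0 \<le> f y"
    and bound: "\<And>F G. finite F \<Longrightarrow> F \<subseteq> V \<Longrightarrow> finite G \<Longrightarrow> G \<subseteq> V \<Longrightarrow>
      (\<Sum>x\<in>F. w x * (\<Sum>y\<in>G. k x y * f y) powr p) \<le> L * (\<Sum>y\<in>G. f y powr p * w y)"
    and sf: "(\<lambda>y. f y powr p * w y) summable_on V"
  shows "x \<in> V \<Longrightarrow> (\<lambda>y. k x y * f y) summable_on V"
    and "(\<lambda>x. (\<Sum>\<^sub>\<infinity>y\<in>V. k x y * f y) powr p * w x) summable_on V"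
    and "(\<Sum>\<^sub>\<infinity>x\<in>V. (\<Sum>\<^sub>\<infinity>y\<in>V. k x y * f y) powr p * w x) \<le> L * (\<Sum>\<^sub>\<infinity>y\<in>V. f y powr p * w y)"
proof -
  define S where "S = L * (\<Sum>\<^sub>\<infinity>y\<in>V. f y powr p * w y)"
  have S: "(\<Sum>x\<in>F. w x * (\<Sum>y\<in>G. k x y * f y) powr p) \<le> S"
    if "finite F" "F \<subseteq> V" "finite G" "G \<subseteq> V" for F G
  proof -
    have "(\<Sum>y\<in>G. f y powr p * w y) \<le> (\<Sum>\<^sub>\<infinity>y\<in>V. f y powr p * w y)"
      using sf that w by (intro finite_sum_le_infsum) (auto simp: less_imp_le)
    thus ?thesis unfolding S_def using bound[OF that] L by (meson mult_left_mono order_trans)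
  qed
  have nn: "0 \<le> (\<Sum>y\<in>G. k x y * f y)" if "x \<in> V" "G \<subseteq> V" for x G
    using that k f by (intro sum_nonneg mult_nonneg_nonneg) auto
  show sk: "(\<lambda>y. k x y * f y) summable_on V" if x: "x \<in> V" for x
  proof (rule nonneg_bdd_above_summable_on)
    show "bdd_above (sum (\<lambda>y. k x y * f y) ` {G. G \<subseteq> V \<and> finite G})"
    proof (rule bdd_aboveI2)
      fix G assume "G \<in> {G. G \<subseteq> V \<and> finite G}"
      hence G: "G \<subseteq> V" "finite G" by auto
      have "w x * (\<Sum>y\<in>G. k x y * f y) powr p \<le> S" using S[of "{x}" G] x G by auto
      hence "(\<Sum>y\<in>G. k x y * f y) powr p \<le> S / w x" using w[OF x] by (simp add: field_simps)
      hence "((\<Sum>y\<in>G. k x y * f y) powr p) powr (1 / p) \<le> (S / w x) powr (1 / p)"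
        using p by (intro powr_mono2) auto
      thus "(\<Sum>y\<in>G. k x y * f y) \<le> (S / w x) powr (1 / p)"
        using p nn[OF x G(1)] by (simp add: powr_powr)
    qed
  qed (use x k f in auto)
  have fin: "(\<Sum>x\<in>F. (\<Sum>\<^sub>\<infinity>y\<in>V. k x y * f y) powr p * w x) \<le> S" if F: "finite F" "F \<subseteq> V" for F
  proof (rule tendsto_upperbound)
    show "((\<lambda>G. \<Sum>x\<in>F. (\<Sum>y\<in>G. k x y * f y) powr p * w x)
      \<longlongrightarrow> (\<Sum>x\<in>F. (\<Sum>\<^sub>\<infinity>y\<in>V. k x y * f y) powr p * w x)) (finite_subsets_at_top V)"
    proof (intro tendsto_sum tendsto_mult tendsto_const)
      fix x assume "x \<in> F"
      hence x: "x \<in> V" using F by auto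
      have "((\<lambda>G. \<Sum>y\<in>G. k x y * f y) \<longlongrightarrow> (\<Sum>\<^sub>\<infinity>y\<in>V. k x y * f y)) (finite_subsets_at_top V)"
        using has_sum_infsum[OF sk[OF x]] by (simp add: has_sum_def)
      thus "((\<lambda>G. (\<Sum>y\<in>G. k x y * f y) powr p) \<longlongrightarrow> (\<Sum>\<^sub>\<infinity>y\<in>V. k x y * f y) powr p)
        (finite_subsets_at_top V)"
        using p nn[OF x] by (intro tendsto_powr2 tendsto_const eventually_finite_subsets_at_top_weakI) auto
    qed
    show "\<forall>\<^sub>F G in finite_subsets_at_top V. (\<Sum>x\<in>F. (\<Sum>y\<in>G. k x y * f y) powr p * w x) \<le> S"
      using S[OF F] by (intro eventually_finite_subsets_at_top_weakI) (auto simp: mult.commute)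
  qed auto
  show sum: "(\<lambda>x. (\<Sum>\<^sub>\<infinity>y\<in>V. k x y * f y) powr p * w x) summable_on V"
    using fin w by (intro nonneg_bdd_above_summable_on bdd_aboveI2[where M = S]) (auto simp: less_imp_le)
  show "(\<Sum>\<^sub>\<infinity>x\<in>V. (\<Sum>\<^sub>\<infinity>y\<in>V. k x y * f y) powr p * w x) \<le> L * (\<Sum>\<^sub>\<infinity>y\<in>V. f y powr p * w y)"
    using infsum_le_finite_sums[OF sum fin] unfolding S_def by simp
qed

section \<open>The geodesic metric\<close>

lemma gdist_le_walk: "walk V E x xs y \<Longrightarrow> length xs = Suc n \<Longrightarrow> gdist V E x y \<le> n"
  unfolding gdist_def by (rule Least_le) auto

lemma gdist_walk:
  assumes "connected_simple_graph V E" "x \<in> V" "y \<in> V"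
  obtains xs where "walk V E x xs y" "length xs = Suc (gdist V E x y)"
proof -
  obtain xs where "walk V E x xs y" using assms by (auto simp: connected_simple_graph_def)
  moreover from this have "length xs = Suc (length xs - 1)" by (cases xs) (auto simp: walk_def)
  ultimately have "\<exists>n xs. walk V E x xs y \<and> length xs = Suc n" by blast
  from LeastI_ex[OF this] show ?thesis using that unfolding gdist_def by blast
qed

lemma gdist_self [simp]: "x \<in> V \<Longrightarrow> gdist V E x x = 0"
  using gdist_le_walk[of V E x "[x]" x 0] by (auto simp: walk_def)

lemma gdist_eq_0D:
  assumes "connected_simple_graph V E" "x \<in> V" "y \<in> V" "gdist V E x y = 0"
  shows "x = y"
proof -
  obtain xs where xs: "walk V E x xs y" "length xs = Suc 0" using gdist_walk assms by metis
  then obtain a where "xs = [a]" by (auto simp: length_Suc_conv)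
  thus ?thesis using xs by (auto simp: walk_def)
qed

lemma gdist_commute:
  assumes "connected_simple_graph V E" "x \<in> V" "y \<in> V"
  shows "gdist V E x y = gdist V E y x"
proof -
  have "gdist V E y x \<le> gdist V E x y" if xy: "x \<in> V" "y \<in> V" for x y
  proof -
    obtain xs where xs: "walk V E x xs y" "length xs = Suc (gdist V E x y)"
      using gdist_walk assms(1) xy by metis
    hence "walk V E y (rev xs) x"
      by (auto simp: walk_def hd_rev last_rev insert_commute)
    thus ?thesis using gdist_le_walk xs(2) by fastforce
  qed
  thus ?thesis using assms by (meson order_antisym)
qed

lemma gdist_triangle:
  assumes "connected_simple_graph V E" "x \<in> V" "y \<in> V" "z \<in> V"
  shows "gdist V E x z \<le> gdist V E x y + gdist V E y z"
proof -
  obtain xs where xs: "walk V E x xs y" "length xs = Suc (gdist V E x y)"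
    using gdist_walk assms by metis
  obtain ys where ys: "walk V E y ys z" "length ys = Suc (gdist V E y z)"
    using gdist_walk assms by metis
  obtain ys' where ys': "ys = y # ys'" using ys by (cases ys) (auto simp: walk_def)
  have "walk V E x (xs @ ys') z"
    using xs(1) ys(1) unfolding ys' walk_def
    by (auto simp: successively_append_iff successively_Cons last_append)
  thus ?thesis using gdist_le_walk[of V E x "xs @ ys'" z] xs(2) ys(2) ys' by auto
qed

section \<open>Graphs with doubling balls and bounded packing\<close>

text \<open>
  The properties of the graph that the estimates use, with real cardinalities in place of
  extended measures. Constants obtained in this locale depend on the graph and on exponents of decay,
  and not on the matrix, on the weights or on the exponents \<open>p\<close> and \<open>q\<close>; this uniformity is why
  the main estimates are phrased with \<open>obtains\<close>.
\<close>
locale doubling_graph =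
  fixes V :: "'v set" and E :: "'v set set" and d dt D1 D2 D3 :: real
  assumes conn: "connected_simple_graph V E"
    and finite_ball: "x \<in> V \<Longrightarrow> finite (gball V E x R)"
    and growth: "x \<in> V \<Longrightarrow> 0 \<le> R \<Longrightarrow> real (card (gball V E x R)) \<le> D1 * (R + 1) powr d"
    and packing: "maximal_disjoint V E N S \<Longrightarrow> 0 \<le> N \<Longrightarrow> 0 \<le> R \<Longrightarrow> x \<in> V \<Longrightarrow>
      real (card {y \<in> S. real (gdist V E y x) \<le> (N + 1) * R}) \<le> D2 * (R + 1) powr dt"
    and ball_double: "x \<in> V \<Longrightarrow> 0 < R \<Longrightarrow>
      real (card (gball V E x (2 * R))) \<le> D3 * real (card (gball V E x R))"
    and const_bounds: "1 \<le> D1" "1 \<le> D2" "1 \<le> D3" "0 \<le> d" "d \<le> dt"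
begin

abbreviation \<rho> :: "'v \<Rightarrow> 'v \<Rightarrow> real" where "\<rho> x y \<equiv> real (gdist V E x y)"
abbreviation B :: "'v \<Rightarrow> real \<Rightarrow> 'v set" where "B x R \<equiv> gball V E x R"

text \<open>
  The decaying kernel at scale \<open>N\<close>: it is of order one inside balls of radius \<open>N\<close> and decays
  like a power \<open>- g\<close> of the distance beyond. Scale \<open>1\<close> measures matrix entries.
\<close>
definition K :: "real \<Rightarrow> real \<Rightarrow> 'v \<Rightarrow> 'v \<Rightarrow> real" where
  "K N g x y = (1 + \<rho> x y / N) powr (- g)"

text \<open>
  The form in which the \<open>A\<^sub>p\<close> condition is used: averages of nonnegative functions over balls are
  bounded on \<open>\<ell>\<^sup>p\<^sub>w\<close>, ball by ball. It treats \<open>p = 1\<close> and \<open>p > 1\<close> alike, and a test function that is the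
  indicator of a smaller ball yields the doubling of the weight.
\<close>
definition muckenhoupt :: "real \<Rightarrow> ('v \<Rightarrow> real) \<Rightarrow> real \<Rightarrow> bool" where
  "muckenhoupt p w P \<longleftrightarrow> 1 \<le> p \<and> 1 \<le> P \<and> (\<forall>x\<in>V. 0 < w x) \<and>
    (\<forall>x\<in>V. \<forall>R\<ge>0. \<forall>f. (\<forall>y\<in>V. 0 \<le> f y) \<longrightarrow>
      (\<Sum>y\<in>B x R. w y) * (\<Sum>y\<in>B x R. f y) powr p
        \<le> P * real (card (B x R)) powr p * (\<Sum>y\<in>B x R. f y powr p * w y))"

lemma rho_commute: "x \<in> V \<Longrightarrow> y \<in> V \<Longrightarrow> \<rho> x y = \<rho> y x"
  using gdist_commute[OF conn] by auto

lemma rho_triangle: "x \<in> V \<Longrightarrow> y \<in> V \<Longrightarrow> z \<in> V \<Longrightarrow> \<rho> x z \<le> \<rho> x y + \<rho> y z"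
  using gdist_triangle[OF conn] by (metis of_nat_add of_nat_le_iff)

lemma mem_ball: "y \<in> B x R \<longleftrightarrow> y \<in> V \<and> \<rho> x y \<le> R"
  by (simp add: gball_def)

lemma ball_subset_V: "B x R \<subseteq> V"
  by (auto simp: gball_def)

lemma center_in_ball: "x \<in> V \<Longrightarrow> 0 \<le> R \<Longrightarrow> x \<in> B x R"
  by (simp add: mem_ball)

lemma K_nonneg [simp]: "0 \<le> K N g x y"
  by (simp add: K_def)

lemma K_commute: "x \<in> V \<Longrightarrow> y \<in> V \<Longrightarrow> K N g x y = K N g y x"
  by (simp add: K_def rho_commute)

lemma K_self [simp]: "x \<in> V \<Longrightarrow> K N g x x = 1"
  by (simp add: K_def)

lemma K_compare:
  assumes "0 < N" "0 \<le> g" "0 < C" "N + \<rho> a b \<le> C * (N + \<rho> x y)"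
  shows "K N g x y \<le> C powr g * K N g a b"
proof -
  have "(N + \<rho> a b) / N \<le> C * (N + \<rho> x y) / N" using assms by (intro divide_right_mono) auto
  hence "1 + \<rho> a b / N \<le> C * (1 + \<rho> x y / N)" using assms by (simp add: add_divide_distrib distrib_left)
  note le = this
  have "(C * (1 + \<rho> x y / N)) powr (- g) \<le> (1 + \<rho> a b / N) powr (- g)"
    using assms le by (intro powr_mono2') (auto intro: add_pos_nonneg)
  hence "C powr (- g) * K N g x y \<le> K N g a b"
    by (simp add: K_def powr_mult)
  thus ?thesis using assms by (simp add: powr_minus field_simps)
qed

lemma muckenhouptD:
  assumes "muckenhoupt p w P" "x \<in> V" "0 \<le> R" "\<And>y. y \<in> V \<Longrightarrow> 0 \<le> f y"
  shows "(\<Sum>y\<in>B x R. w y) * (\<Sum>y\<in>B x R. f y) powr p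
    \<le> P * real (card (B x R)) powr p * (\<Sum>y\<in>B x R. f y powr p * w y)"
  using assms unfolding muckenhoupt_def by blast

lemma muckenhoupt_basic:
  assumes "muckenhoupt p w P"
  shows "1 \<le> p" "1 \<le> P" "\<And>x. x \<in> V \<Longrightarrow> 0 < w x"
  using assms unfolding muckenhoupt_def by auto

lemma weight_ball_pos:
  assumes "muckenhoupt p w P" "x \<in> V" "0 \<le> R"
  shows "0 < (\<Sum>y\<in>B x R. w y)"
proof (rule sum_pos)
  show "finite (B x R)" using finite_ball[OF assms(2)] .
  show "B x R \<noteq> {}" using center_in_ball[OF assms(2,3)] by blast
  show "0 < w y" if "y \<in> B x R" for y using that muckenhoupt_basic(3)[OF assms(1)] by (simp add: mem_ball)
qed

lemma maximal_disjoint_exists: "\<exists>S. maximal_disjoint V E N S" if "0 \<le> N"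
proof -
  define \<A> where "\<A> = {S. S \<subseteq> V \<and> (\<forall>y\<in>S. \<forall>z\<in>S. y \<noteq> z \<longrightarrow> B y N \<inter> B z N = {})}"
  have "\<exists>M\<in>\<A>. \<forall>X\<in>\<A>. M \<subseteq> X \<longrightarrow> X = M"
  proof (rule subset_Zorn_nonempty)
    show "\<A> \<noteq> {}" by (auto simp: \<A>_def intro!: exI[of _ "{}"])
  next
    fix \<C> assume C: "subset.chain \<A> \<C>"
    show "\<Union>\<C> \<in> \<A>"
      unfolding \<A>_def mem_Collect_eq
    proof (intro conjI ballI impI)
      show "\<Union>\<C> \<subseteq> V" using C by (auto simp: subset_chain_def \<A>_def)
      fix y z assume yz: "y \<in> \<Union>\<C>" "z \<in> \<Union>\<C>" "y \<noteq> z"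
      then obtain Y Z where YZ: "y \<in> Y" "z \<in> Z" "Y \<in> \<C>" "Z \<in> \<C>" by auto
      moreover have "Y \<subseteq> Z \<or> Z \<subseteq> Y" using C YZ(3,4) by (simp add: subset_chain_def)
      ultimately obtain X where X: "X \<in> \<C>" "y \<in> X" "z \<in> X" by (elim disjE) blast+
      hence "X \<in> \<A>" using C by (auto simp: subset_chain_def)
      thus "B y N \<inter> B z N = {}" using X(2,3) yz(3) by (simp add: \<A>_def)
    qed
  qed
  then obtain S where S: "S \<in> \<A>" and max: "\<And>X. X \<in> \<A> \<Longrightarrow> S \<subseteq> X \<Longrightarrow> X = S" by blast
  have SV: "S \<subseteq> V" and Sd: "\<And>y z. y \<in> S \<Longrightarrow> z \<in> S \<Longrightarrow> y \<noteq> z \<Longrightarrow> B y N \<inter> B z N = {}"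
    using S by (auto simp only: \<A>_def mem_Collect_eq)
  have meet: "B x N \<inter> (\<Union>y\<in>S. B y N) \<noteq> {}" if "x \<in> V" for x
  proof
    assume disj: "B x N \<inter> (\<Union>y\<in>S. B y N) = {}"
    hence "B x N \<inter> B y N = {}" "B y N \<inter> B x N = {}" if "y \<in> S" for y using that by blast+
    hence "insert x S \<in> \<A>" using SV Sd \<open>x \<in> V\<close> by (simp add: \<A>_def)
    hence "x \<in> S" using max[of "insert x S"] by blast
    thus False using disj center_in_ball[OF \<open>x \<in> V\<close> \<open>0 \<le> N\<close>] by blast
  qed
  show ?thesis unfolding maximal_disjoint_def using SV Sd meet by (intro exI[of _ S]) simp
qed

text \<open>
  By maximality the ball of radius \<open>N\<close> around \<open>x\<close> meets one around a point of \<open>S\<close>.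
\<close>
lemma maximal_disjoint_cover:
  assumes "maximal_disjoint V E N S" "x \<in> V"
  obtains m where "m \<in> S" "m \<in> V" "\<rho> m x \<le> 2 * N"
proof -
  from assms obtain m y where m: "m \<in> S" "m \<in> V" "y \<in> B x N" "y \<in> B m N"
    unfolding maximal_disjoint_def by blast
  hence "\<rho> m x \<le> \<rho> m y + \<rho> y x" using assms by (intro rho_triangle) (auto simp: mem_ball)
  thus ?thesis using that m assms rho_commute[of x y] by (auto simp: mem_ball)
qed

lemma card_packing_le:
  assumes "maximal_disjoint V E N S" "0 \<le> N" "0 \<le> R" "x \<in> V" "F \<subseteq> S" "finite F"
    "\<And>m. m \<in> F \<Longrightarrow> \<rho> m x \<le> N * R"
  shows "real (card F) \<le> D2 * (R + 1) powr dt"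
proof -
  have fin: "finite {y \<in> S. \<rho> y x \<le> (N + 1) * R}"
    by (rule finite_subset[OF _ finite_ball[OF assms(4), of "(N+1)*R"]])
      (use assms rho_commute in \<open>auto simp: mem_ball maximal_disjoint_def\<close>)
  have "F \<subseteq> {y \<in> S. \<rho> y x \<le> (N + 1) * R}"
    using assms by (fastforce simp: algebra_simps)
  hence "card F \<le> card {y \<in> S. \<rho> y x \<le> (N + 1) * R}" using fin by (intro card_mono)
  thus ?thesis using packing[OF assms(1-4)] by linarith
qed

section \<open>Weighted bounds for ball sums and decaying kernels\<close>

text \<open>
  Each ball \<open>B x R\<close> is replaced by the ball of radius \<open>3 R\<close> around a nearby point of a maximal
  \<open>R\<close>-disjoint set. On each of these balls the \<open>A\<^sub>p\<close> condition applies, and the balls overlap boundedly.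
  The power \<open>A\<^sub>p(w)\<^bsup>1/p\<^esup>\<close> of the weight constant is the one in the main theorem.
\<close>
lemma ball_sum_weighted_bound:
  assumes mu: "muckenhoupt p w P" and R: "0 \<le> R" and fin: "finite F" "F \<subseteq> V" "finite G" "G \<subseteq> V"
    and f: "\<And>y. y \<in> V \<Longrightarrow> 0 \<le> f y" "\<And>y. y \<in> V \<Longrightarrow> y \<notin> G \<Longrightarrow> f y = 0"
  shows "(\<Sum>x\<in>F. w x * (\<Sum>y\<in>B x R. f y) powr p)
    \<le> P * (3 powr d * D1 * D2 * 4 powr dt * (R + 1) powr d) powr p * (\<Sum>y\<in>G. f y powr p * w y)"
proof -
  note p = muckenhoupt_basic(1)[OF mu] and P = muckenhoupt_basic(2)[OF mu]
    and w = muckenhoupt_basic(3)[OF mu]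
  obtain S where S: "maximal_disjoint V E R S" using maximal_disjoint_exists R by blast
  have "\<forall>x\<in>V. \<exists>m. m \<in> S \<and> m \<in> V \<and> \<rho> m x \<le> 2 * R"
    using maximal_disjoint_cover[OF S] by metis
  \<comment> \<open>Every vertex is attached to one point of the separated set; grouping by that point keeps
    the total weight of a group below the weight of one ball.\<close>
  then obtain m where m: "\<And>x. x \<in> V \<Longrightarrow> m x \<in> S \<and> m x \<in> V \<and> \<rho> (m x) x \<le> 2 * R"
    by metis
  define T where "T = m ` F"
  have T: "finite T" "T \<subseteq> S" "T \<subseteq> V" using fin m by (auto simp: T_def)
  have sub: "B x R \<subseteq> B (m x) (3 * R)" if "x \<in> V" for x
  proof
    fix y assume y: "y \<in> B x R"
    hence "\<rho> (m x) y \<le> \<rho> (m x) x + \<rho> x y" using m that by (intro rho_triangle) (auto simp: mem_ball)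
    thus "y \<in> B (m x) (3 * R)" using y m[OF that] by (auto simp: mem_ball)
  qed
  let ?U = "\<lambda>n. \<Sum>y\<in>B n (3 * R). f y"
  let ?L = "D1 * (3 * R + 1) powr d"
  have U: "0 \<le> ?U n" for n using f(1) ball_subset_V by (intro sum_nonneg) auto
  have "(\<Sum>x\<in>F. w x * (\<Sum>y\<in>B x R. f y) powr p) \<le> (\<Sum>x\<in>F. w x * ?U (m x) powr p)"
  proof (intro sum_mono mult_left_mono powr_mono2)
    fix x assume "x \<in> F"
    hence x: "x \<in> V" using fin by auto
    show "(\<Sum>y\<in>B x R. f y) \<le> ?U (m x)"
    proof (rule sum_mono2[OF _ sub[OF x]])
      show "finite (B (m x) (3 * R))" using finite_ball m[OF x] by blast
      show "0 \<le> f y" if "y \<in> B (m x) (3 * R) - B x R" for y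
        using that f(1) by (simp add: mem_ball)
    qed
    show "0 \<le> (\<Sum>y\<in>B x R. f y)" using f(1) ball_subset_V[of x R] by (intro sum_nonneg) auto
    show "0 \<le> w x" using w[OF x] by simp
  qed (use p in auto)
  also have "\<dots> = (\<Sum>n\<in>T. \<Sum>x\<in>{x \<in> F. m x = n}. w x * ?U (m x) powr p)"
    unfolding T_def by (rule sum.image_gen[OF fin(1)])
  also have "\<dots> \<le> (\<Sum>n\<in>T. P * ?L powr p * (\<Sum>y\<in>B n (3 * R). f y powr p * w y))"
  proof (rule sum_mono)
    fix n assume "n \<in> T"
    hence n: "n \<in> V" using T by auto
    have "(\<Sum>x\<in>{x \<in> F. m x = n}. w x * ?U (m x) powr p)
        = (\<Sum>x\<in>{x \<in> F. m x = n}. w x) * ?U n powr p"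
      by (simp add: sum_distrib_right)
    also have "\<dots> \<le> (\<Sum>x\<in>B n (3 * R). w x) * ?U n powr p"
    proof (intro mult_right_mono sum_mono2)
      show "{x \<in> F. m x = n} \<subseteq> B n (3 * R)"
        using m fin R by (fastforce simp: mem_ball)
      show "0 \<le> w b" if "b \<in> B n (3 * R) - {x \<in> F. m x = n}" for b
        using that w[of b] by (auto simp: mem_ball)
    qed (use n finite_ball in auto)
    also have "\<dots> \<le> P * real (card (B n (3 * R))) powr p * (\<Sum>y\<in>B n (3 * R). f y powr p * w y)"
      using n R f by (intro muckenhouptD[OF mu]) auto
    also have "\<dots> \<le> P * ?L powr p * (\<Sum>y\<in>B n (3 * R). f y powr p * w y)"
      using P p growth[OF n, of "3 * R"] R w ball_subset_V[of n "3 * R"]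
      by (intro mult_right_mono mult_left_mono powr_mono2 sum_nonneg mult_nonneg_nonneg)
        (auto simp: less_imp_le subset_iff)
    finally show "(\<Sum>x\<in>{x \<in> F. m x = n}. w x * ?U (m x) powr p)
      \<le> P * ?L powr p * (\<Sum>y\<in>B n (3 * R). f y powr p * w y)" .
  qed
  also have "\<dots> = P * ?L powr p * (\<Sum>n\<in>T. \<Sum>y\<in>B n (3 * R). f y powr p * w y)"
    by (simp add: sum_distrib_left)
  also have "(\<Sum>n\<in>T. \<Sum>y\<in>B n (3 * R). f y powr p * w y)
      = (\<Sum>n\<in>T. \<Sum>y\<in>G. if \<rho> n y \<le> 3 * R then f y powr p * w y else 0)"
  proof (rule sum.cong)
    fix n assume "n \<in> T"
    hence n: "n \<in> V" using T by auto
    have "(\<Sum>y\<in>B n (3 * R). f y powr p * w y) = (\<Sum>y\<in>B n (3 * R) \<inter> G. f y powr p * w y)"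
      by (rule sum.mono_neutral_right) (use n finite_ball f(2) in \<open>auto simp: mem_ball\<close>)
    also have "B n (3 * R) \<inter> G = {y \<in> G. \<rho> n y \<le> 3 * R}" using fin by (auto simp: mem_ball)
    also have "(\<Sum>y\<in>{y \<in> G. \<rho> n y \<le> 3 * R}. f y powr p * w y)
        = (\<Sum>y\<in>G. if \<rho> n y \<le> 3 * R then f y powr p * w y else 0)"
      using fin by (simp add: sum.inter_filter)
    finally show "(\<Sum>y\<in>B n (3 * R). f y powr p * w y)
        = (\<Sum>y\<in>G. if \<rho> n y \<le> 3 * R then f y powr p * w y else 0)" .
  qed auto
  also have "\<dots> = (\<Sum>y\<in>G. real (card {n \<in> T. \<rho> n y \<le> 3 * R}) * (f y powr p * w y))"
    by (subst sum.swap) (simp add: sum.inter_filter[symmetric] T)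
  also have "\<dots> \<le> (\<Sum>y\<in>G. D2 * 4 powr dt * (f y powr p * w y))"
  proof (intro sum_mono mult_right_mono)
    fix y assume "y \<in> G"
    hence y: "y \<in> V" using fin by auto
    show "real (card {n \<in> T. \<rho> n y \<le> 3 * R}) \<le> D2 * 4 powr dt"
    proof -
      have "real (card {n \<in> T. \<rho> n y \<le> 3 * R}) \<le> D2 * (3 + 1) powr dt"
        using T by (intro card_packing_le[OF S R _ y]) (auto simp: mult.commute[of R])
      thus ?thesis by simp
    qed
    show "0 \<le> f y powr p * w y" using w[OF y] by simp
  qed
  finally have "(\<Sum>x\<in>F. w x * (\<Sum>y\<in>B x R. f y) powr p)
      \<le> P * ?L powr p * (\<Sum>y\<in>G. D2 * 4 powr dt * (f y powr p * w y))"
    using P by (simp add: mult_left_mono)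
  also have "\<dots> = P * (?L powr p * (D2 * 4 powr dt)) * (\<Sum>y\<in>G. f y powr p * w y)"
    by (simp add: sum_distrib_left mult.assoc)
  also have "\<dots> \<le> P * (3 powr d * D1 * D2 * 4 powr dt * (R + 1) powr d) powr p
      * (\<Sum>y\<in>G. f y powr p * w y)"
  proof (intro mult_right_mono mult_left_mono sum_nonneg)
    have "1 \<le> D2 * 4 powr dt"
      using mult_mono[of 1 D2 1 "4 powr dt"] const_bounds by (simp add: ge_one_powr_ge_zero)
    hence "D2 * 4 powr dt \<le> (D2 * 4 powr dt) powr p"
      using p powr_mono[of 1 p "D2 * 4 powr dt"] by auto
    moreover have "?L powr p \<le> (D1 * (3 * (R + 1)) powr d) powr p"
      using R const_bounds p by (intro powr_mono2 mult_left_mono) auto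
    ultimately have "?L powr p * (D2 * 4 powr dt)
        \<le> (D1 * (3 * (R + 1)) powr d) powr p * (D2 * 4 powr dt) powr p"
      using const_bounds by (intro mult_mono) auto
    thus "?L powr p * (D2 * 4 powr dt) \<le> (3 powr d * D1 * D2 * 4 powr dt * (R + 1) powr d) powr p"
      by (simp only: powr_mult mult_ac)
  qed (use P w fin in \<open>auto simp: subset_iff less_imp_le\<close>)
  finally show ?thesis .
qed

text \<open>
  Splitting the kernel into dyadic balls and applying \<open>ball_sum_weighted_bound\<close> to each gives a series
  \<open>\<Sum>\<^sub>j 2\<^bsup>-jg\<^esup> 2\<^bsup>jd\<^esup>\<close>, which converges for \<open>g > d\<close>.
\<close>
lemma kernel_weighted_bound:
  assumes g: "d < g"
  obtains C where "1 \<le> C" and "\<And>p w P N F G f. \<lbrakk>muckenhoupt p w P; 1 \<le> N; finite F; F \<subseteq> V;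
      finite G; G \<subseteq> V; \<And>y. y \<in> V \<Longrightarrow> 0 \<le> f y\<rbrakk> \<Longrightarrow>
    (\<Sum>x\<in>F. w x * (\<Sum>y\<in>G. K N g x y * f y) powr p)
      \<le> P * (C * N powr d) powr p * (\<Sum>y\<in>G. f y powr p * w y)"
proof -
  define q where "q = 2 powr (- (g - d))"
  have q: "0 < q" "q < 1" unfolding q_def using two_powr_neg_less_1[of "g - d"] g by auto
  define a where "a = 2 powr (- g)"
  define e where "e = 2 powr (- d)"
  have aqe: "a = q * e" by (simp add: a_def q_def e_def flip: powr_add)
  have e: "0 < e" by (simp add: e_def)
  define C0 where "C0 = 3 powr d * D1 * D2 * 4 powr dt"
  define L where "L = 2 powr g / (1 - q)"
  define C where "C = max 1 (L * C0 * 2 powr d)"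
  have L0: "0 \<le> L" using q by (simp add: L_def)
  have C0: "0 \<le> C0" using const_bounds by (simp add: C0_def)
  show thesis
  proof (rule that)
    show "1 \<le> C" by (simp add: C_def)
    fix p P N :: real and w f :: "'v \<Rightarrow> real" and F G
    assume mu: "muckenhoupt p w P" and N: "1 \<le> N" and fin: "finite F" "F \<subseteq> V" "finite G" "G \<subseteq> V"
      and f: "\<And>y. y \<in> V \<Longrightarrow> 0 \<le> f y"
    note p = muckenhoupt_basic(1)[OF mu] and P = muckenhoupt_basic(2)[OF mu]
      and w = muckenhoupt_basic(3)[OF mu]
    define h where "h y = (if y \<in> G then f y else 0)" for y
    define U where "U j x = (\<Sum>y\<in>B x (N * 2 ^ j). h y)" for j x
    have h: "0 \<le> h y" if "y \<in> V" for y using f that by (simp add: h_def)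
    have U0: "0 \<le> U j x" for j x
      unfolding U_def using h ball_subset_V by (intro sum_nonneg) auto
    obtain J where J: "\<And>x y. x \<in> F \<Longrightarrow> y \<in> G \<Longrightarrow> \<rho> x y \<le> N * 2 ^ J"
    proof -
      have "finite ((\<lambda>(x, y). gdist V E x y) ` (F \<times> G))" using fin by auto
      then obtain J where J: "\<And>x y. x \<in> F \<Longrightarrow> y \<in> G \<Longrightarrow> gdist V E x y \<le> J"
        unfolding finite_nat_set_iff_bounded_le by auto
      have "real J \<le> N * 2 ^ J"
      proof -
        have "real J \<le> 2 ^ J" by (simp add: of_nat_less_two_power less_imp_le)
        also have "\<dots> \<le> N * 2 ^ J" using N by simp
        finally show ?thesis .
      qed
      thus ?thesis using J that by (meson of_nat_le_iff order_trans)
    qed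
    have pointwise: "(\<Sum>y\<in>G. K N g x y * f y) \<le> (\<Sum>j\<le>J. 2 powr g * a ^ j * U j x)" if x: "x \<in> F" for x
    proof -
      have xV: "x \<in> V" using x fin by auto
      have "(\<Sum>y\<in>G. K N g x y * f y)
          \<le> (\<Sum>y\<in>G. (\<Sum>j\<le>J. 2 powr g * a ^ j * (if \<rho> x y \<le> N * 2 ^ j then 1 else 0)) * f y)"
        unfolding K_def a_def using g const_bounds N J[OF x] f fin
        by (intro sum_mono mult_right_mono dyadic_kernel_bound) auto
      also have "\<dots> = (\<Sum>j\<le>J. 2 powr g * a ^ j * (\<Sum>y\<in>G. if \<rho> x y \<le> N * 2 ^ j then f y else 0))"
        unfolding sum_distrib_right sum_distrib_left
        by (subst sum.swap, intro sum.cong refl) auto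
      also have "\<dots> = (\<Sum>j\<le>J. 2 powr g * a ^ j * U j x)"
      proof (intro sum.cong refl arg_cong2[where f = "(*)"])
        fix j
        have "U j x = (\<Sum>y\<in>B x (N * 2 ^ j) \<inter> G. f y)"
          unfolding U_def h_def using finite_ball[OF xV] by (simp add: sum.inter_restrict)
        also have "B x (N * 2 ^ j) \<inter> G = {y \<in> G. \<rho> x y \<le> N * 2 ^ j}" using fin by (auto simp: mem_ball)
        finally show "(\<Sum>y\<in>G. if \<rho> x y \<le> N * 2 ^ j then f y else 0) = U j x"
          using fin by (simp add: sum.inter_filter)
      qed
      finally show ?thesis .
    qed
    \<comment> \<open>Jensen weights chosen proportional to the norms of the dyadic pieces, so that every piece
      contributes the same bound.\<close>
    define \<theta> where "\<theta> j = (1 - q) * q ^ j" for j :: nat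
    have \<theta>: "0 \<le> \<theta> j" for j using q by (simp add: \<theta>_def)
    have \<theta>1: "(\<Sum>j\<le>J. \<theta> j) \<le> 1"
    proof -
      have "(\<Sum>j\<le>J. \<theta> j) = (1 - q) * (\<Sum>j\<le>J. q ^ j)"
        by (simp only: \<theta>_def sum_distrib_left)
      also have "\<dots> \<le> (1 - q) * (1 / (1 - q))"
        using sum_power_le_geometric[of q J] q by (intro mult_left_mono) auto
      finally show ?thesis using q by simp
    qed
    have split: "2 powr g * a ^ j * U j x = \<theta> j * (L * e ^ j * U j x)" for j x
      using q by (simp add: \<theta>_def L_def aqe power_mult_distrib)
    define X where "X = (\<Sum>y\<in>G. f y powr p * w y)"
    have X: "0 \<le> X" unfolding X_def using fin w by (intro sum_nonneg) (auto simp: less_imp_le)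
    have "(\<Sum>x\<in>F. w x * (\<Sum>y\<in>G. K N g x y * f y) powr p)
        \<le> (\<Sum>x\<in>F. w x * (\<Sum>j\<le>J. \<theta> j * (L * e ^ j * U j x) powr p))"
    proof (intro sum_mono mult_left_mono)
      fix x assume x: "x \<in> F"
      have "(\<Sum>y\<in>G. K N g x y * f y) powr p \<le> (\<Sum>j\<le>J. \<theta> j * (L * e ^ j * U j x)) powr p"
        using pointwise[OF x] p fin f by (intro powr_mono2) (auto simp: split intro!: sum_nonneg)
      also have "\<dots> \<le> (\<Sum>j\<le>J. \<theta> j * (L * e ^ j * U j x) powr p)"
        using p \<theta> \<theta>1 L0 e U0 by (intro sum_powr_jensen) auto
      finally show "(\<Sum>y\<in>G. K N g x y * f y) powr p \<le> (\<Sum>j\<le>J. \<theta> j * (L * e ^ j * U j x) powr p)" .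
      show "0 \<le> w x" using w x fin by (auto simp: less_imp_le)
    qed
    also have "\<dots> = (\<Sum>j\<le>J. \<theta> j * ((L * e ^ j) powr p * (\<Sum>x\<in>F. w x * U j x powr p)))"
      unfolding sum_distrib_left by (subst sum.swap) (simp add: powr_mult mult_ac)
    also have "\<dots> \<le> (\<Sum>j\<le>J. \<theta> j * (P * (C * N powr d) powr p * X))"
    proof (intro sum_mono mult_left_mono)
      fix j :: nat
      have "(\<Sum>x\<in>F. w x * U j x powr p) \<le> P * (C0 * (N * 2 ^ j + 1) powr d) powr p * (\<Sum>y\<in>G. h y powr p * w y)"
        unfolding U_def C0_def using N h by (intro ball_sum_weighted_bound mu fin) (auto simp: h_def)
      also have "(\<Sum>y\<in>G. h y powr p * w y) = X" by (simp add: X_def h_def)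
      finally have "(L * e ^ j) powr p * (\<Sum>x\<in>F. w x * U j x powr p)
          \<le> (L * e ^ j) powr p * (P * (C0 * (N * 2 ^ j + 1) powr d) powr p * X)"
        by (intro mult_left_mono) auto
      also have "\<dots> = P * (L * e ^ j * (C0 * (N * 2 ^ j + 1) powr d)) powr p * X"
        by (simp add: powr_mult)
      also have "\<dots> \<le> P * (C * N powr d) powr p * X"
      proof (intro mult_right_mono mult_left_mono powr_mono2)
        have "1 \<le> N * 2 ^ j" using N mult_mono[of 1 N 1 "2 ^ j"] by simp
        hence "(N * 2 ^ j + 1) powr d \<le> (2 * N * 2 ^ j) powr d"
          using const_bounds by (intro powr_mono2) auto
        also have "\<dots> = 2 powr d * N powr d * (2 powr d) ^ j"
          by (simp add: powr_mult two_power_powr)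
        finally have "L * e ^ j * (C0 * (N * 2 ^ j + 1) powr d)
            \<le> L * e ^ j * (C0 * (2 powr d * N powr d * (2 powr d) ^ j))"
          using L0 C0 e by (intro mult_left_mono) auto
        also have "\<dots> = (e * 2 powr d) ^ j * (L * C0 * 2 powr d * N powr d)"
          by (simp add: power_mult_distrib)
        also have "e * 2 powr d = 1" by (simp add: e_def flip: powr_add)
        also have "1 ^ j * (L * C0 * 2 powr d * N powr d) \<le> C * N powr d"
          by (auto simp: C_def intro!: mult_right_mono)
        finally show "L * e ^ j * (C0 * (N * 2 ^ j + 1) powr d) \<le> C * N powr d" .
      qed (use p P X L0 C0 e in auto)
      finally show "(L * e ^ j) powr p * (\<Sum>x\<in>F. w x * U j x powr p) \<le> P * (C * N powr d) powr p * X" .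
    qed (use \<theta> in auto)
    also have "\<dots> = (\<Sum>j\<le>J. \<theta> j) * (P * (C * N powr d) powr p * X)"
      by (simp add: sum_distrib_right)
    also have "\<dots> \<le> 1 * (P * (C * N powr d) powr p * X)"
      using \<theta>1 P X by (intro mult_right_mono) auto
    finally show "(\<Sum>x\<in>F. w x * (\<Sum>y\<in>G. K N g x y * f y) powr p)
      \<le> P * (C * N powr d) powr p * (\<Sum>y\<in>G. f y powr p * w y)"
      by (simp add: X_def)
  qed
qed

section \<open>Kernels on separated sets\<close>

text \<open>
  The ball around \<open>x\<close> of radius \<open>N 2\<^sup>j\<close> contains at most a multiple of \<open>2\<^bsup>j dt\<^esup>\<close> points of \<open>S\<close>.
  This is where the generalised Beurling dimension enters.
\<close>
lemma separated_kernel_sum_bound: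
  assumes g: "dt < g"
  obtains C where "1 \<le> C" and "\<And>N S F x. \<lbrakk>maximal_disjoint V E N S; 0 < N; finite F; F \<subseteq> S; x \<in> V\<rbrakk>
    \<Longrightarrow> (\<Sum>m\<in>F. K N g x m) \<le> C"
proof -
  define q where "q = 2 powr (- (g - dt))"
  have q: "0 < q" "q < 1" unfolding q_def using two_powr_neg_less_1[of "g - dt"] g by auto
  define a where "a = 2 powr (- g)"
  have aq: "a * 2 powr dt = q" by (simp add: a_def q_def flip: powr_add)
  define C where "C = max 1 (2 powr g * D2 * 2 powr dt / (1 - q))"
  show thesis
  proof (rule that)
    show "1 \<le> C" by (simp add: C_def)
    fix N S F x
    assume S: "maximal_disjoint V E N S" and N: "0 < N" and F: "finite F" "F \<subseteq> S" and x: "x \<in> V"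
    have FV: "F \<subseteq> V" using S F by (auto simp: maximal_disjoint_def)
    obtain J where J: "\<And>m. m \<in> F \<Longrightarrow> \<rho> x m \<le> N * 2 ^ J"
    proof -
      define M where "M = Max (insert 0 (\<rho> x ` F))"
      obtain J where "M / N < 2 ^ J" using real_arch_pow[of 2 "M / N"] by auto
      moreover have "\<rho> x m \<le> M" if "m \<in> F" for m unfolding M_def using F that by auto
      ultimately have "\<rho> x m \<le> N * 2 ^ J" if "m \<in> F" for m
        using that N by (auto simp: pos_divide_less_eq mult.commute intro: order_trans less_imp_le)
      thus ?thesis by (rule that)
    qed
    have "(\<Sum>m\<in>F. K N g x m)
        \<le> (\<Sum>m\<in>F. \<Sum>j\<le>J. 2 powr g * a ^ j * (if \<rho> x m \<le> N * 2 ^ j then 1 else 0))"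
      unfolding K_def a_def using g const_bounds N J
      by (intro sum_mono dyadic_kernel_bound) auto
    also have "\<dots> = (\<Sum>j\<le>J. 2 powr g * a ^ j * real (card {m \<in> F. \<rho> x m \<le> N * 2 ^ j}))"
      unfolding sum_if_1_eq_card[OF F(1)] sum_distrib_left by (rule sum.swap)
    also have "\<dots> \<le> (\<Sum>j\<le>J. 2 powr g * D2 * 2 powr dt * q ^ j)"
    proof (rule sum_mono)
      fix j :: nat
      have "real (card {m \<in> F. \<rho> x m \<le> N * 2 ^ j}) \<le> D2 * (2 ^ j + 1) powr dt"
        using F FV N x rho_commute[of x] by (intro card_packing_le[OF S]) auto
      also have "\<dots> \<le> D2 * (2 * 2 ^ j) powr dt"
        using const_bounds by (intro mult_left_mono powr_mono2) auto
      also have "\<dots> = D2 * 2 powr dt * (2 powr dt) ^ j"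
        by (simp add: powr_mult two_power_powr)
      finally have "2 powr g * a ^ j * real (card {m \<in> F. \<rho> x m \<le> N * 2 ^ j})
          \<le> 2 powr g * a ^ j * (D2 * 2 powr dt * (2 powr dt) ^ j)"
        by (intro mult_left_mono) (auto simp: a_def)
      also have "\<dots> = 2 powr g * D2 * 2 powr dt * q ^ j"
        by (simp add: power_mult_distrib flip: aq)
      finally show "2 powr g * a ^ j * real (card {m \<in> F. \<rho> x m \<le> N * 2 ^ j})
          \<le> 2 powr g * D2 * 2 powr dt * q ^ j" .
    qed
    also have "\<dots> = 2 powr g * D2 * 2 powr dt * (\<Sum>j\<le>J. q ^ j)" by (simp add: sum_distrib_left)
    also have "\<dots> \<le> 2 powr g * D2 * 2 powr dt * (1 / (1 - q))"
      using sum_power_le_geometric[of q J] q const_bounds by (intro mult_left_mono) auto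
    also have "\<dots> \<le> C" by (simp add: C_def)
    finally show "(\<Sum>m\<in>F. K N g x m) \<le> C" .
  qed
qed

text \<open>
  One of the points \<open>x\<close> and \<open>z\<close> is at least half as far from \<open>m\<close> as they are from each other; the
  corresponding factor is bounded by the kernel at \<open>(x, z)\<close>, and the other factor is summable.
\<close>
lemma separated_kernel_convolution:
  assumes g: "dt < g"
  obtains C where "1 \<le> C" and "\<And>N S F x z. \<lbrakk>maximal_disjoint V E N S; 0 < N; finite F; F \<subseteq> S;
      x \<in> V; z \<in> V\<rbrakk> \<Longrightarrow> (\<Sum>m\<in>F. K N g x m * K N g m z) \<le> C * K N g x z"
proof -
  obtain C where C: "1 \<le> C" "\<And>N S F x. \<lbrakk>maximal_disjoint V E N S; 0 < N; finite F; F \<subseteq> S; x \<in> V\<rbrakk>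
    \<Longrightarrow> (\<Sum>m\<in>F. K N g x m) \<le> C" using separated_kernel_sum_bound[OF g] by blast
  have g0: "0 \<le> g" using g const_bounds by simp
  show thesis
  proof (rule that)
    have "1 \<le> (2 :: real) powr g" using g0 by (simp add: ge_one_powr_ge_zero)
    thus "1 \<le> 2 powr g * (2 * C)" using C(1) mult_mono[of 1 "2 powr g" 1 "2 * C"] by simp
    fix N S F x z
    assume S: "maximal_disjoint V E N S" and N: "0 < N" and F: "finite F" "F \<subseteq> S" and xz: "x \<in> V" "z \<in> V"
    have FV: "F \<subseteq> V" using S F by (auto simp: maximal_disjoint_def)
    have "(\<Sum>m\<in>F. K N g x m * K N g m z) \<le> (\<Sum>m\<in>F. 2 powr g * K N g x z * (K N g x m + K N g z m))"
    proof (rule sum_mono)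
      fix m assume "m \<in> F"
      hence m: "m \<in> V" using FV by auto
      have t: "\<rho> x z \<le> \<rho> x m + \<rho> m z" using rho_triangle xz m by auto
      show "K N g x m * K N g m z \<le> 2 powr g * K N g x z * (K N g x m + K N g z m)"
      proof (cases "\<rho> x m \<le> \<rho> m z")
        case True
        hence "K N g m z \<le> 2 powr g * K N g x z"
          using t N g0 by (intro K_compare) auto
        hence "K N g x m * K N g m z \<le> K N g x m * (2 powr g * K N g x z)"
          by (intro mult_left_mono) auto
        also have "\<dots> \<le> 2 powr g * K N g x z * (K N g x m + K N g z m)" by (simp add: algebra_simps)
        finally show ?thesis .
      next
        case False
        hence "K N g x m \<le> 2 powr g * K N g x z"
          using t N g0 by (intro K_compare) auto
        hence "K N g x m * K N g m z \<le> (2 powr g * K N g x z) * K N g m z"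
          by (intro mult_right_mono) auto
        also have "\<dots> \<le> 2 powr g * K N g x z * (K N g x m + K N g z m)"
          using K_commute[OF m xz(2)] by (simp add: algebra_simps)
        finally show ?thesis .
      qed
    qed
    also have "\<dots> = 2 powr g * K N g x z * ((\<Sum>m\<in>F. K N g x m) + (\<Sum>m\<in>F. K N g z m))"
      by (simp only: sum_distrib_left[symmetric] sum.distrib)
    also have "\<dots> \<le> 2 powr g * K N g x z * (C + C)"
      using C(2)[OF S N F] xz by (intro mult_left_mono add_mono) auto
    finally show "(\<Sum>m\<in>F. K N g x m * K N g m z) \<le> 2 powr g * (2 * C) * K N g x z"
      by (simp add: algebra_simps)
  qed
qed

text \<open>
  Sums over balls centred in \<open>S\<close> are controlled by sums over \<open>V\<close> because these balls overlap boundedly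
  and the kernel hardly varies on them.
\<close>
lemma separated_kernel_ball_sums:
  assumes S: "maximal_disjoint V E N S" and N: "0 < N" and g: "0 \<le> g" and x: "x \<in> V"
    and h: "\<And>y. y \<in> V \<Longrightarrow> 0 \<le> h y" and sh: "(\<lambda>y. K N g x y * h y) summable_on V"
    and F: "finite F" "F \<subseteq> S"
  shows "(\<Sum>m\<in>F. K N g x m * (\<Sum>y\<in>B m (4 * N). h y))
    \<le> 5 powr g * (D2 * 5 powr dt) * (\<Sum>\<^sub>\<infinity>y\<in>V. K N g x y * h y)"
proof -
  have FV: "F \<subseteq> V" using S F by (auto simp: maximal_disjoint_def)
  define Y where "Y = (\<Union>m\<in>F. B m (4 * N))"
  have Y: "finite Y" "Y \<subseteq> V" using F FV finite_ball by (auto simp: Y_def mem_ball)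
  have "(\<Sum>m\<in>F. K N g x m * (\<Sum>y\<in>B m (4 * N). h y))
      \<le> (\<Sum>m\<in>F. \<Sum>y\<in>B m (4 * N). 5 powr g * (K N g x y * h y))"
    unfolding sum_distrib_left
  proof (intro sum_mono)
    fix m y assume m: "m \<in> F" and y: "y \<in> B m (4 * N)"
    have mV: "m \<in> V" using m FV by auto
    have yV: "y \<in> V" using y by (auto simp: mem_ball)
    have "\<rho> x y \<le> \<rho> x m + \<rho> m y" using rho_triangle x mV yV by auto
    hence "\<rho> x y \<le> \<rho> x m + 4 * N" using y by (auto simp: mem_ball)
    hence "K N g x m \<le> 5 powr g * K N g x y"
      using N g by (intro K_compare) auto
    hence "K N g x m * h y \<le> 5 powr g * K N g x y * h y" using h[OF yV] by (intro mult_right_mono)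
    thus "K N g x m * h y \<le> 5 powr g * (K N g x y * h y)" by (simp add: mult.assoc)
  qed
  also have "\<dots> = 5 powr g * (\<Sum>m\<in>F. \<Sum>y\<in>Y. if \<rho> m y \<le> 4 * N then K N g x y * h y else 0)"
    unfolding sum_distrib_left
  proof (rule sum.cong[OF refl])
    fix m assume m: "m \<in> F"
    have "B m (4 * N) = {y \<in> Y. \<rho> m y \<le> 4 * N}" using m Y by (auto simp: Y_def mem_ball)
    thus "(\<Sum>y\<in>B m (4 * N). 5 powr g * (K N g x y * h y))
      = (\<Sum>y\<in>Y. 5 powr g * (if \<rho> m y \<le> 4 * N then K N g x y * h y else 0))"
      using Y by (simp add: sum.inter_filter if_distrib[of "(*) _"] cong: if_cong)
  qed
  also have "\<dots> = 5 powr g * (\<Sum>y\<in>Y. real (card {m \<in> F. \<rho> m y \<le> 4 * N}) * (K N g x y * h y))"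
    by (subst sum.swap) (simp add: sum.inter_filter[symmetric] F)
  also have "\<dots> \<le> 5 powr g * (\<Sum>y\<in>Y. D2 * 5 powr dt * (K N g x y * h y))"
  proof (intro mult_left_mono sum_mono mult_right_mono)
    fix y assume "y \<in> Y"
    hence y: "y \<in> V" using Y by auto
    show "real (card {m \<in> F. \<rho> m y \<le> 4 * N}) \<le> D2 * 5 powr dt"
    proof -
      have "real (card {m \<in> F. \<rho> m y \<le> 4 * N}) \<le> D2 * (4 + 1) powr dt"
        using N F by (intro card_packing_le[OF S _ _ y]) (auto simp: mult.commute[of N])
      thus ?thesis by simp
    qed
    show "0 \<le> K N g x y * h y" using h[OF y] by simp
  qed auto
  also have "\<dots> = 5 powr g * (D2 * 5 powr dt) * (\<Sum>y\<in>Y. K N g x y * h y)"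
    by (simp add: sum_distrib_left mult.assoc)
  also have "\<dots> \<le> 5 powr g * (D2 * 5 powr dt) * (\<Sum>\<^sub>\<infinity>y\<in>V. K N g x y * h y)"
    using const_bounds Y h by (intro mult_left_mono finite_sum_le_infsum sh) auto
  finally show ?thesis .
qed

text \<open>
  The operator bound in terms of sequence spaces. It serves twice: with \<open>N = 1\<close> for the boundedness
  of the matrix, and with large \<open>N\<close> for the pointwise estimate of \<open>c\<close> by \<open>Ac\<close>.
\<close>
lemma kernel_dominated_lpw:
  assumes g: "d < g"
  obtains C where "1 \<le> C"
    and "\<And>p w P N v x. \<lbrakk>muckenhoupt p w P; 1 \<le> N; v \<in> lpw V p w; x \<in> V\<rbrakk>
      \<Longrightarrow> (\<lambda>y. K N g x y * cmod (v y)) summable_on V"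
    and "\<And>p w P N v u L. \<lbrakk>muckenhoupt p w P; 1 \<le> N; v \<in> lpw V p w; 0 \<le> L;
        \<And>x. x \<in> V \<Longrightarrow> cmod (u x) \<le> L * (\<Sum>\<^sub>\<infinity>y\<in>V. K N g x y * cmod (v y))\<rbrakk>
      \<Longrightarrow> u \<in> lpw V p w \<and> lpw_norm V p w u \<le> L * (P powr (1 / p) * (C * N powr d)) * lpw_norm V p w v"
proof -
  obtain C where C: "1 \<le> C" and bound: "\<And>p w P N F G f. \<lbrakk>muckenhoupt p w P; 1 \<le> N; finite F; F \<subseteq> V;
      finite G; G \<subseteq> V; \<And>y. y \<in> V \<Longrightarrow> 0 \<le> f y\<rbrakk> \<Longrightarrow>
    (\<Sum>x\<in>F. w x * (\<Sum>y\<in>G. K N g x y * f y) powr p)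
      \<le> P * (C * N powr d) powr p * (\<Sum>y\<in>G. f y powr p * w y)"
    using kernel_weighted_bound[OF g] by blast
  show thesis
  proof (rule that[OF C])
    fix p P N :: real and w :: "'v \<Rightarrow> real" and v :: "'v \<Rightarrow> complex"
    assume mu: "muckenhoupt p w P" and N: "1 \<le> N" and v: "v \<in> lpw V p w"
    note p = muckenhoupt_basic(1)[OF mu] and P = muckenhoupt_basic(2)[OF mu]
      and w = muckenhoupt_basic(3)[OF mu]
    let ?L = "P * (C * N powr d) powr p"
    have L: "0 \<le> ?L" using P by simp
    have sv: "(\<lambda>y. cmod (v y) powr p * w y) summable_on V" using v by (simp add: lpw_def)
    note transfer = weighted_kernel_transfer[of p ?L V w "K N g" "\<lambda>y. cmod (v y)",
        OF p L w _ _ bound[OF mu N] sv, simplified]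
    show "(\<lambda>y. K N g x y * cmod (v y)) summable_on V" if "x \<in> V" for x
      using transfer(1) that by simp
    fix u :: "'v \<Rightarrow> complex" and L :: real
    assume L0: "0 \<le> L" and u: "\<And>x. x \<in> V \<Longrightarrow> cmod (u x) \<le> L * (\<Sum>\<^sub>\<infinity>y\<in>V. K N g x y * cmod (v y))"
    define T where "T x = (\<Sum>\<^sub>\<infinity>y\<in>V. K N g x y * cmod (v y))" for x
    have T: "0 \<le> T x" for x unfolding T_def by (intro infsum_nonneg) auto
    have sT: "(\<lambda>x. T x powr p * w x) summable_on V"
      and T_le: "(\<Sum>\<^sub>\<infinity>x\<in>V. T x powr p * w x) \<le> ?L * (\<Sum>\<^sub>\<infinity>y\<in>V. cmod (v y) powr p * w y)"
      using transfer(2,3) by (simp_all add: T_def)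
    have u': "cmod (u x) powr p * w x \<le> L powr p * (T x powr p * w x)" if "x \<in> V" for x
    proof -
      have "cmod (u x) powr p \<le> (L * T x) powr p"
        using u[OF that] p by (intro powr_mono2) (auto simp: T_def)
      thus ?thesis using w[OF that] by (simp add: powr_mult mult_right_mono mult.assoc[symmetric])
    qed
    have sLT: "(\<lambda>x. L powr p * (T x powr p * w x)) summable_on V"
      using sT by (rule summable_on_cmult_right)
    have su: "(\<lambda>x. cmod (u x) powr p * w x) summable_on V"
      by (rule summable_on_comparison_test[OF sLT u']) (use w in \<open>auto simp: less_imp_le\<close>)
    have "(\<Sum>\<^sub>\<infinity>x\<in>V. cmod (u x) powr p * w x) \<le> L powr p * (\<Sum>\<^sub>\<infinity>x\<in>V. T x powr p * w x)"
      using infsum_mono[OF su sLT u'] by (simp add: infsum_cmult_right')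
    also have "\<dots> \<le> L powr p * (?L * (\<Sum>\<^sub>\<infinity>y\<in>V. cmod (v y) powr p * w y))"
      using T_le by (intro mult_left_mono) auto
    finally have le: "(\<Sum>\<^sub>\<infinity>x\<in>V. cmod (u x) powr p * w x)
      \<le> L powr p * (?L * (\<Sum>\<^sub>\<infinity>y\<in>V. cmod (v y) powr p * w y))" .
    have nn: "0 \<le> (\<Sum>\<^sub>\<infinity>x\<in>V. cmod (u x) powr p * w x)"
      using w by (intro infsum_nonneg) (auto simp: less_imp_le)
    have "lpw_norm V p w u
        \<le> (L powr p * (?L * (\<Sum>\<^sub>\<infinity>y\<in>V. cmod (v y) powr p * w y))) powr (1 / p)"
      unfolding lpw_norm_def using nn le p by (intro powr_mono2) auto
    also have "\<dots> = L * (P powr (1 / p) * (C * N powr d)) * lpw_norm V p w v"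
      using p L0 C by (simp add: lpw_norm_def powr_mult powr_powr)
    finally show "u \<in> lpw V p w \<and> lpw_norm V p w u \<le> L * (P powr (1 / p) * (C * N powr d)) * lpw_norm V p w v"
      using su by (simp add: lpw_def)
  qed
qed

lemma matrix_row_summable:
  assumes A: "\<And>x y. x \<in> V \<Longrightarrow> y \<in> V \<Longrightarrow> cmod (A x y) \<le> M * K 1 g x y" and x: "x \<in> V"
    and sc: "(\<lambda>y. K 1 g x y * cmod (c y)) summable_on V"
  shows "(\<lambda>y. cmod (A x y * c y)) summable_on V"
    and "cmod (mat_apply V A c x) \<le> M * (\<Sum>\<^sub>\<infinity>y\<in>V. K 1 g x y * cmod (c y))"
proof -
  have le: "cmod (A x y * c y) \<le> M * (K 1 g x y * cmod (c y))" if "y \<in> V" for y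
    using A[OF x that] mult_right_mono[of "cmod (A x y)" "M * K 1 g x y" "cmod (c y)"]
    by (simp add: norm_mult mult.assoc)
  have sM: "(\<lambda>y. M * (K 1 g x y * cmod (c y))) summable_on V"
    using sc by (rule summable_on_cmult_right)
  show abs: "(\<lambda>y. cmod (A x y * c y)) summable_on V"
    by (rule summable_on_comparison_test[OF sM le]) auto
  have "cmod (mat_apply V A c x) \<le> (\<Sum>\<^sub>\<infinity>y\<in>V. cmod (A x y * c y))"
    unfolding mat_apply_def by (rule norm_infsum_bound[OF abs])
  also have "\<dots> \<le> (\<Sum>\<^sub>\<infinity>y\<in>V. M * (K 1 g x y * cmod (c y)))"
    by (rule infsum_mono[OF abs sM le])
  finally show "cmod (mat_apply V A c x) \<le> M * (\<Sum>\<^sub>\<infinity>y\<in>V. K 1 g x y * cmod (c y))"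
    by (simp add: infsum_cmult_right')
qed

section \<open>Local averages\<close>

text \<open>
  The energy of \<open>c\<close> on the ball of radius \<open>2 N\<close> is normalised by the weight of the ball of radius
  \<open>4 N\<close>, the support of the cutoff. With this mismatch the localised stability inequality compares two
  quantities normalised by the same weight, and no power of the \<open>A\<^sub>p\<close>-bound is lost on \<open>Ac\<close>.
\<close>
definition local_avg :: "real \<Rightarrow> ('v \<Rightarrow> real) \<Rightarrow> real \<Rightarrow> ('v \<Rightarrow> complex) \<Rightarrow> 'v \<Rightarrow> real" where
  "local_avg p w N c m =
    ((\<Sum>y\<in>B m (2 * N). cmod (c y) powr p * w y) / (\<Sum>y\<in>B m (4 * N). w y)) powr (1 / p)"

lemma local_avg_nonneg [simp]: "0 \<le> local_avg p w N c m"
  by (simp add: local_avg_def)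

lemma local_avg_powr:
  assumes mu: "muckenhoupt p w P" and N: "1 \<le> N" and m: "m \<in> V"
  shows "(\<Sum>y\<in>B m (4 * N). w y) * local_avg p w N c m powr p
    = (\<Sum>y\<in>B m (2 * N). cmod (c y) powr p * w y)"
proof -
  have W: "0 < (\<Sum>y\<in>B m (4 * N). w y)" using weight_ball_pos[OF mu m] N by simp
  have "0 \<le> (\<Sum>y\<in>B m (2 * N). cmod (c y) powr p * w y)"
    using muckenhoupt_basic(3)[OF mu] by (intro sum_nonneg) (auto simp: mem_ball less_imp_le)
  thus ?thesis using W muckenhoupt_basic(1)[OF mu] by (simp add: local_avg_def powr_powr)
qed

text \<open>
  The passage from \<open>\<ell>\<^sup>p\<^sub>w\<close> to \<open>\<ell>\<^sup>1\<close> on a ball. It costs \<open>N\<^sup>d\<close> and one power \<open>A\<^sub>p(w)\<^bsup>1/p\<^esup>\<close>, whereas the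
  converse passage in \<open>local_avg_le_sum\<close> costs nothing.
\<close>
lemma local_sum_le_avg:
  assumes mu: "muckenhoupt p w P" and N: "1 \<le> N" and m: "m \<in> V"
  shows "(\<Sum>y\<in>B m (2 * N). cmod (c y)) \<le> D1 * 5 powr d * N powr d * P powr (1 / p) * local_avg p w N c m"
proof -
  note p = muckenhoupt_basic(1)[OF mu] and P = muckenhoupt_basic(2)[OF mu]
    and w = muckenhoupt_basic(3)[OF mu]
  let ?W = "\<Sum>y\<in>B m (4 * N). w y"
  have W: "0 < ?W" using weight_ball_pos[OF mu m] N by simp
  have sub: "B m (4 * N) \<inter> {y. \<rho> m y \<le> 2 * N} = B m (2 * N)" using N by (auto simp: mem_ball)
  define f where "f y = (if \<rho> m y \<le> 2 * N then cmod (c y) else 0)" for y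
  have f0: "0 \<le> f y" for y by (simp add: f_def)
  have f1: "(\<Sum>y\<in>B m (4 * N). f y) = (\<Sum>y\<in>B m (2 * N). cmod (c y))"
    unfolding f_def using finite_ball[OF m] sub by (simp add: sum.If_cases)
  have "(\<Sum>y\<in>B m (4 * N). f y powr p * w y) = (\<Sum>y\<in>B m (4 * N). if \<rho> m y \<le> 2 * N then cmod (c y) powr p * w
      y else 0)"
    by (rule sum.cong) (auto simp: f_def)
  hence f2: "(\<Sum>y\<in>B m (4 * N). f y powr p * w y) = (\<Sum>y\<in>B m (2 * N). cmod (c y) powr p * w y)"
    using finite_ball[OF m] sub by (simp add: sum.If_cases)
  have card: "real (card (B m (4 * N))) \<le> D1 * (5 * N) powr d"
  proof (rule order_trans[OF growth[OF m]])
    show "D1 * (4 * N + 1) powr d \<le> D1 * (5 * N) powr d"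
      using N const_bounds by (intro mult_left_mono powr_mono2) auto
  qed (use N in auto)
  let ?s = "\<Sum>y\<in>B m (2 * N). cmod (c y)"
  let ?r = "D1 * (5 * N) powr d"
  let ?a = "local_avg p w N c m"
  have "?W * ?s powr p \<le> P * real (card (B m (4 * N))) powr p * (?W * ?a powr p)"
    using muckenhouptD[OF mu m, of "4 * N" f] f0 N by (simp add: f1 f2 local_avg_powr[OF mu N m])
  also have "\<dots> \<le> P * ?r powr p * (?W * ?a powr p)"
    using card p P W by (intro mult_right_mono mult_left_mono powr_mono2) auto
  finally have "?W * ?s powr p \<le> ?W * (P * ?r powr p * ?a powr p)" by (simp only: mult_ac)
  hence "?s powr p \<le> P * ?r powr p * ?a powr p" using W by simp
  hence "(?s powr p) powr (1 / p) \<le> (P * ?r powr p * ?a powr p) powr (1 / p)"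
    using p by (intro powr_mono2) auto
  hence "?s \<le> P powr (1 / p) * ?r * ?a"
    using p const_bounds by (simp add: powr_mult powr_powr sum_nonneg)
  thus ?thesis by (simp only: powr_mult mult_ac)
qed

lemma local_avg_le_sum:
  assumes mu: "muckenhoupt p w P" and N: "1 \<le> N" and m: "m \<in> V"
  shows "local_avg p w N c m \<le> (\<Sum>y\<in>B m (2 * N). cmod (c y))"
proof -
  note p = muckenhoupt_basic(1)[OF mu] and w = muckenhoupt_basic(3)[OF mu]
  let ?W = "\<Sum>y\<in>B m (4 * N). w y"
  let ?s = "\<Sum>y\<in>B m (2 * N). cmod (c y)"
  have W: "0 < ?W" using weight_ball_pos[OF mu m] N by simp
  have sub: "B m (2 * N) \<subseteq> B m (4 * N)" using N by (auto simp: mem_ball)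
  have "(\<Sum>y\<in>B m (2 * N). cmod (c y) powr p * w y) \<le> (\<Sum>y\<in>B m (2 * N). ?s powr p * w y)"
  proof (intro sum_mono mult_right_mono powr_mono2)
    fix y assume y: "y \<in> B m (2 * N)"
    show "cmod (c y) \<le> ?s" using finite_ball[OF m] y by (intro member_le_sum) auto
    show "0 \<le> w y" using w y by (auto simp: mem_ball less_imp_le)
  qed (use p in auto)
  also have "\<dots> = ?s powr p * (\<Sum>y\<in>B m (2 * N). w y)" by (simp add: sum_distrib_left)
  also have "\<dots> \<le> ?s powr p * ?W"
  proof (intro mult_left_mono sum_mono2 finite_ball m sub)
    show "0 \<le> w y" if "y \<in> B m (4 * N) - B m (2 * N)" for y
      using that w[of y] by (simp add: mem_ball less_imp_le)
  qed auto
  finally have "(\<Sum>y\<in>B m (2 * N). cmod (c y) powr p * w y) / ?W \<le> ?s powr p"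
    using W by (simp add: pos_divide_le_eq)
  moreover have "0 \<le> (\<Sum>y\<in>B m (2 * N). cmod (c y) powr p * w y) / ?W"
    using w W by (intro divide_nonneg_pos sum_nonneg) (auto simp: mem_ball less_imp_le)
  ultimately have "local_avg p w N c m \<le> (?s powr p) powr (1 / p)"
    unfolding local_avg_def using p by (intro powr_mono2) auto
  also have "\<dots> = ?s" using p by (simp add: powr_powr sum_nonneg)
  finally show ?thesis .
qed

text \<open>
  The weights of balls of radius \<open>4 N\<close> with centres at distance at most \<open>10 N\<close> are comparable: test the \<open>A\<^sub>p\<close>
  condition on the ball of radius \<open>16 N\<close>, which contains both, with the indicator of one of them.
\<close>
lemma near_ball_weight_le:
  assumes mu: "muckenhoupt p w P" and N: "1 \<le> N" and m: "m \<in> V" "n \<in> V" "\<rho> m n \<le> 10 * N"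
  shows "(\<Sum>y\<in>B n (4 * N). w y) \<le> P * (D3\<^sup>2) powr p * (\<Sum>y\<in>B m (4 * N). w y)"
proof -
  note p = muckenhoupt_basic(1)[OF mu] and P = muckenhoupt_basic(2)[OF mu]
    and w = muckenhoupt_basic(3)[OF mu]
  let ?W = "\<Sum>y\<in>B m (4 * N). w y" and ?V = "\<Sum>y\<in>B m (16 * N). w y"
  let ?k = "real (card (B m (4 * N)))"
  have k: "0 < ?k" using finite_ball[OF m(1)] center_in_ball[OF m(1), of "4 * N"] N
    by (auto simp: card_gt_0_iff)
  have W: "0 < ?W" using weight_ball_pos[OF mu m(1)] N by simp
  have "(\<Sum>y\<in>B n (4 * N). w y) \<le> ?V"
  proof (rule sum_mono2)
    show "finite (B m (16 * N))" using finite_ball m by blast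
    show "B n (4 * N) \<subseteq> B m (16 * N)"
    proof
      fix y assume y: "y \<in> B n (4 * N)"
      hence "\<rho> m y \<le> \<rho> m n + \<rho> n y" using m by (intro rho_triangle) (auto simp: mem_ball)
      thus "y \<in> B m (16 * N)" using y m N by (simp add: mem_ball)
    qed
    show "0 \<le> w y" if "y \<in> B m (16 * N) - B n (4 * N)" for y
      using that w[of y] by (simp add: mem_ball less_imp_le)
  qed
  moreover have "?V \<le> P * (D3\<^sup>2) powr p * ?W"
  proof -
    define f where "f y = (if \<rho> m y \<le> 4 * N then 1 else 0 :: real)" for y
    have sub: "B m (16 * N) \<inter> {y. \<rho> m y \<le> 4 * N} = B m (4 * N)" using N by (auto simp: mem_ball)
    have f0: "0 \<le> f y" for y by (simp add: f_def)
    have f1: "(\<Sum>y\<in>B m (16 * N). f y) = ?k"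
      unfolding f_def using finite_ball[OF m(1)] sub by (simp add: sum.If_cases)
    have "(\<Sum>y\<in>B m (16 * N). f y powr p * w y) = (\<Sum>y\<in>B m (16 * N). if \<rho> m y \<le> 4 * N then w y else 0)"
      by (rule sum.cong) (auto simp: f_def)
    hence f2: "(\<Sum>y\<in>B m (16 * N). f y powr p * w y) = ?W"
      using finite_ball[OF m(1)] sub by (simp add: sum.If_cases)
    have "real (card (B m (16 * N))) \<le> D3 * real (card (B m (8 * N)))"
      using ball_double[OF m(1), of "8 * N"] N by simp
    also have "\<dots> \<le> D3 * (D3 * ?k)"
      using ball_double[OF m(1), of "4 * N"] N const_bounds by (intro mult_left_mono) auto
    finally have card: "real (card (B m (16 * N))) \<le> D3\<^sup>2 * ?k" by (simp add: power2_eq_square)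
    have "?V * ?k powr p \<le> P * real (card (B m (16 * N))) powr p * ?W"
      using muckenhouptD[OF mu m(1), of "16 * N" f] f0 N by (simp add: f1 f2)
    also have "\<dots> \<le> P * (D3\<^sup>2 * ?k) powr p * ?W"
      using card p P W by (intro mult_right_mono mult_left_mono powr_mono2) auto
    also have "\<dots> = P * (D3\<^sup>2) powr p * ?W * ?k powr p" by (simp only: powr_mult mult_ac)
    finally show ?thesis using k by simp
  qed
  ultimately show ?thesis by linarith
qed

text \<open>
  Summing the local averages against the kernel yields a quantity that can absorb the error terms
  of the localisation.
\<close>
definition avg_potential ::
  "real \<Rightarrow> ('v \<Rightarrow> real) \<Rightarrow> real \<Rightarrow> real \<Rightarrow> 'v set \<Rightarrow> ('v \<Rightarrow> complex) \<Rightarrow> 'v \<Rightarrow> real" where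
  "avg_potential p w g N S c x = (\<Sum>\<^sub>\<infinity>m\<in>S. K N g x m * local_avg p w N c m)"

text \<open>
  The ball of radius \<open>8 N\<close> is covered by the balls of radius \<open>2 N\<close> around those points of \<open>S\<close> that lie within
  distance \<open>10 N\<close>, at which the kernel is bounded below.
\<close>
lemma near_energy_le:
  assumes mu: "muckenhoupt p w P" and N: "1 \<le> N" and S: "maximal_disjoint V E N S" and m: "m \<in> V"
    and g: "0 \<le> g" and sH: "(\<lambda>n. K N g m n * local_avg p w N c n) summable_on S"
  shows "(\<Sum>y\<in>B m (8 * N). cmod (c y) powr p * w y)
    \<le> (\<Sum>y\<in>B m (4 * N). w y) * (P powr (1 / p) * D3\<^sup>2 * 11 powr g * avg_potential p w g N S c m) powr p"
proof -
  note p = muckenhoupt_basic(1)[OF mu] and P = muckenhoupt_basic(2)[OF mu]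
    and w = muckenhoupt_basic(3)[OF mu]
  let ?W = "\<lambda>n. \<Sum>y\<in>B n (4 * N). w y"
  let ?a = "local_avg p w N c"
  have SV: "S \<subseteq> V" using S by (simp add: maximal_disjoint_def)
  define T where "T = S \<inter> B m (10 * N)"
  have T: "finite T" "T \<subseteq> S" "T \<subseteq> V" using finite_ball[OF m] SV by (auto simp: T_def)
  have cover: "\<exists>n\<in>T. \<rho> n y \<le> 2 * N" if y: "y \<in> B m (8 * N)" for y
  proof -
    have yV: "y \<in> V" using y by (simp add: mem_ball)
    obtain n where n: "n \<in> S" "n \<in> V" "\<rho> n y \<le> 2 * N" using maximal_disjoint_cover[OF S yV] .
    have "\<rho> m n \<le> \<rho> m y + \<rho> y n" using m yV n by (intro rho_triangle)
    hence "\<rho> m n \<le> 10 * N" using y n rho_commute[OF yV n(2)] by (simp add: mem_ball)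
    thus ?thesis using n by (auto simp: T_def mem_ball)
  qed
  have e0: "0 \<le> cmod (c y) powr p * w y" if "y \<in> V" for y using w[OF that] by simp
  let ?e = "\<lambda>y. cmod (c y) powr p * w y"
  have "(\<Sum>y\<in>B m (8 * N). ?e y) \<le> (\<Sum>y\<in>B m (8 * N). \<Sum>n\<in>T. if \<rho> n y \<le> 2 * N then ?e y else 0)"
  proof (rule sum_mono)
    fix y assume y: "y \<in> B m (8 * N)"
    hence yV: "y \<in> V" by (simp add: mem_ball)
    obtain n where n: "n \<in> T" "\<rho> n y \<le> 2 * N" using cover[OF y] by blast
    have "(if \<rho> n y \<le> 2 * N then ?e y else 0) \<le> (\<Sum>n\<in>T. if \<rho> n y \<le> 2 * N then ?e y else 0)"
      using n T e0[OF yV] by (intro member_le_sum) auto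
    thus "?e y \<le> (\<Sum>n\<in>T. if \<rho> n y \<le> 2 * N then ?e y else 0)" using n by simp
  qed
  also have "\<dots> = (\<Sum>n\<in>T. \<Sum>y\<in>{y \<in> B m (8 * N). \<rho> n y \<le> 2 * N}. ?e y)"
    by (subst sum.swap) (simp add: sum.inter_filter finite_ball[OF m])
  also have "\<dots> \<le> (\<Sum>n\<in>T. \<Sum>y\<in>B n (2 * N). ?e y)"
    using T finite_ball e0 by (intro sum_mono sum_mono2) (auto simp: mem_ball)
  also have "\<dots> = (\<Sum>n\<in>T. ?W n * ?a n powr p)"
    using T local_avg_powr[OF mu N] by (intro sum.cong) auto
  also have "\<dots> \<le> (\<Sum>n\<in>T. P * (D3\<^sup>2) powr p * ?W m * ?a n powr p)"
    using T by (intro sum_mono mult_right_mono near_ball_weight_le[OF mu N m]) (auto simp: T_def mem_ball)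
  also have "\<dots> = P * (D3\<^sup>2) powr p * ?W m * (\<Sum>n\<in>T. ?a n powr p)" by (simp add: sum_distrib_left)
  also have "\<dots> \<le> P * (D3\<^sup>2) powr p * ?W m * (11 powr g * avg_potential p w g N S c m) powr p"
  proof (rule mult_left_mono)
    have "(\<Sum>n\<in>T. ?a n powr p) \<le> (\<Sum>n\<in>T. ?a n) powr p"
      using T p by (intro sum_powr_le_powr_sum) auto
    also have "\<dots> \<le> (11 powr g * avg_potential p w g N S c m) powr p"
    proof (rule powr_mono2)
      have "(\<Sum>n\<in>T. ?a n) \<le> (\<Sum>n\<in>T. 11 powr g * (K N g m n * ?a n))"
      proof (rule sum_mono)
        fix n assume n: "n \<in> T"
        have "K N g n n \<le> 11 powr g * K N g m n"
          using n T N g by (intro K_compare) (auto simp: T_def mem_ball)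
        hence "1 * ?a n \<le> 11 powr g * K N g m n * ?a n"
          using n T by (intro mult_right_mono) auto
        thus "?a n \<le> 11 powr g * (K N g m n * ?a n)" by (simp add: mult.assoc)
      qed
      also have "\<dots> = 11 powr g * (\<Sum>n\<in>T. K N g m n * ?a n)" by (simp add: sum_distrib_left)
      also have "\<dots> \<le> 11 powr g * avg_potential p w g N S c m"
        unfolding avg_potential_def using T sH by (intro mult_left_mono finite_sum_le_infsum) auto
      finally show "(\<Sum>n\<in>T. ?a n) \<le> 11 powr g * avg_potential p w g N S c m" .
    qed (use p in \<open>auto intro: sum_nonneg\<close>)
    finally show "(\<Sum>n\<in>T. ?a n powr p) \<le> (11 powr g * avg_potential p w g N S c m) powr p" .
    show "0 \<le> P * (D3\<^sup>2) powr p * ?W m" using P weight_ball_pos[OF mu m, of "4 * N"] N by simp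
  qed
  also have "\<dots> = ?W m * (P powr (1 / p) * D3\<^sup>2 * 11 powr g * avg_potential p w g N S c m) powr p"
  proof -
    have "(P powr (1 / p)) powr p = P" using p P by (simp add: powr_powr)
    thus ?thesis by (simp only: powr_mult mult_ac)
  qed
  finally show ?thesis .
qed

text \<open>
  At distance more than \<open>8 N\<close> the kernels at scales \<open>1\<close> and \<open>N\<close> differ by the factor \<open>N\<^bsup>-g\<^esup>\<close>; the local
  sums of \<open>\<bar>c\<bar>\<close> cost \<open>N\<^sup>d\<close>, so that the factor \<open>N\<^bsup>d-g\<^esup>\<close> is gained altogether.
\<close>
lemma far_tail_le:
  assumes mu: "muckenhoupt p w P" and N: "1 \<le> N" and S: "maximal_disjoint V E N S" and m: "m \<in> V"
    and g: "0 \<le> g" and sH: "(\<lambda>n. K N g m n * local_avg p w N c n) summable_on S"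
    and sc: "(\<lambda>y. K 1 g m y * cmod (c y)) summable_on V"
  shows "(\<Sum>\<^sub>\<infinity>y\<in>V - B m (8 * N). K 1 g m y * cmod (c y))
    \<le> 2 powr g * D1 * 5 powr d * N powr (d - g) * P powr (1 / p) * avg_potential p w g N S c m"
proof (rule infsum_le_finite_sums)
  show "(\<lambda>y. K 1 g m y * cmod (c y)) summable_on V - B m (8 * N)"
    using sc by (rule summable_on_subset_banach) auto
  fix G assume G: "finite G" "G \<subseteq> V - B m (8 * N)"
  have SV: "S \<subseteq> V" using S by (simp add: maximal_disjoint_def)
  let ?a = "local_avg p w N c"
  let ?L = "D1 * 5 powr d * N powr d * P powr (1 / p)"
  have "\<forall>x\<in>V. \<exists>n. n \<in> S \<and> n \<in> V \<and> \<rho> n x \<le> 2 * N"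
    using maximal_disjoint_cover[OF S] by metis
  then obtain n where n: "\<And>x. x \<in> V \<Longrightarrow> n x \<in> S \<and> n x \<in> V \<and> \<rho> (n x) x \<le> 2 * N"
    by metis
  define T where "T = n ` G"
  have T: "finite T" "T \<subseteq> S" "T \<subseteq> V" using G n by (auto simp: T_def)
  have Kle: "K 1 g m y \<le> 2 powr g * N powr (- g) * K N g m (n y)" if y: "y \<in> G" for y
  proof -
    have yV: "y \<in> V" and far: "8 * N < \<rho> m y" using y G by (auto simp: mem_ball)
    have "\<rho> m (n y) \<le> \<rho> m y + \<rho> y (n y)" using m yV n by (intro rho_triangle) auto
    also have "\<rho> y (n y) \<le> 2 * N" using n[OF yV] rho_commute[OF yV] by simp
    finally have "N + \<rho> m (n y) \<le> 2 * (1 + \<rho> m y)" using far N by simp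
    hence le: "N * (1 + \<rho> m (n y) / N) \<le> 2 * (1 + \<rho> m y)" using N by (simp add: distrib_left)
    have "0 < N * (1 + \<rho> m (n y) / N)" using N by (intro mult_pos_pos add_pos_nonneg) auto
    hence "(2 * (1 + \<rho> m y)) powr (- g) \<le> (N * (1 + \<rho> m (n y) / N)) powr (- g)"
      using le g by (intro powr_mono2') auto
    hence "2 powr (- g) * K 1 g m y \<le> N powr (- g) * K N g m (n y)"
      by (simp only: powr_mult K_def div_by_1)
    hence "2 powr g * (2 powr (- g) * K 1 g m y) \<le> 2 powr g * (N powr (- g) * K N g m (n y))"
      by (rule mult_left_mono) simp
    thus ?thesis by (simp add: mult.assoc[symmetric] flip: powr_add)
  qed
  have "(\<Sum>y\<in>G. K 1 g m y * cmod (c y)) \<le> (\<Sum>y\<in>G. 2 powr g * N powr (- g) * K N g m (n y) * cmod (c y))"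
    using Kle by (intro sum_mono mult_right_mono) auto
  also have "\<dots> = (\<Sum>k\<in>T. \<Sum>y\<in>{y \<in> G. n y = k}. 2 powr g * N powr (- g) * K N g m (n y) * cmod (c y))"
    unfolding T_def by (rule sum.image_gen[OF G(1)])
  also have "\<dots> = (\<Sum>k\<in>T. 2 powr g * N powr (- g) * K N g m k * (\<Sum>y\<in>{y \<in> G. n y = k}. cmod (c y)))"
    by (simp add: sum_distrib_left)
  also have "\<dots> \<le> (\<Sum>k\<in>T. 2 powr g * N powr (- g) * K N g m k * (?L * ?a k))"
  proof (intro sum_mono mult_left_mono)
    fix k assume k: "k \<in> T"
    hence kV: "k \<in> V" using T by auto
    have "(\<Sum>y\<in>{y \<in> G. n y = k}. cmod (c y)) \<le> (\<Sum>y\<in>B k (2 * N). cmod (c y))"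
      using finite_ball[OF kV] n G by (intro sum_mono2) (auto simp: mem_ball)
    also have "\<dots> \<le> ?L * ?a k" by (rule local_sum_le_avg[OF mu N kV])
    finally show "(\<Sum>y\<in>{y \<in> G. n y = k}. cmod (c y)) \<le> ?L * ?a k" .
  qed auto
  also have "\<dots> = 2 powr g * N powr (- g) * ?L * (\<Sum>k\<in>T. K N g m k * ?a k)"
    by (simp add: sum_distrib_left mult_ac)
  also have "\<dots> \<le> 2 powr g * N powr (- g) * ?L * avg_potential p w g N S c m"
    unfolding avg_potential_def using T sH const_bounds by (intro mult_left_mono finite_sum_le_infsum) auto
  also have "\<dots> = 2 powr g * D1 * 5 powr d * (N powr d * N powr (- g)) * P powr (1 / p) * avg_potential p w
      g N S c m"
    by (simp only: mult_ac)
  also have "N powr d * N powr (- g) = N powr (d - g)" by (simp flip: powr_add)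
  finally show "(\<Sum>y\<in>G. K 1 g m y * cmod (c y))
    \<le> 2 powr g * D1 * 5 powr d * N powr (d - g) * P powr (1 / p) * avg_potential p w g N S c m" .
qed

section \<open>Localising the stability inequality\<close>

text \<open>
  A trapezoidal function of the distance to \<open>m\<close>, with plateau of radius \<open>2 N\<close>.
\<close>
definition cutoff :: "real \<Rightarrow> 'v \<Rightarrow> 'v \<Rightarrow> real" where
  "cutoff N m y = max 0 (min 1 (2 - \<rho> m y / (2 * N)))"

lemma cutoff_props:
  assumes "0 < N"
  shows "0 \<le> cutoff N m y" "cutoff N m y \<le> 1"
    and "\<rho> m y \<le> 2 * N \<Longrightarrow> cutoff N m y = 1"
    and "4 * N \<le> \<rho> m y \<Longrightarrow> cutoff N m y = 0"
  using assms by (auto simp: cutoff_def field_simps)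

lemma cutoff_lipschitz:
  assumes "0 < N" "m \<in> V" "x \<in> V" "y \<in> V"
  shows "\<bar>cutoff N m y - cutoff N m x\<bar> \<le> \<rho> x y / (2 * N)"
proof -
  have "\<bar>\<rho> m y - \<rho> m x\<bar> \<le> \<rho> x y"
    using rho_triangle[of m x y] rho_triangle[of m y x] rho_commute[of x y] assms by auto
  hence "\<bar>\<rho> m y / (2 * N) - \<rho> m x / (2 * N)\<bar> \<le> \<rho> x y / (2 * N)"
    using assms by (simp add: divide_right_mono flip: diff_divide_distrib)
  thus ?thesis by (auto simp: cutoff_def min_def max_def)
qed

text \<open>
  \<open>A (\<psi> c)\<close> is \<open>\<psi> (A c)\<close> plus the commutator of \<open>A\<close> and \<open>\<psi>\<close>. Columns within \<open>8 N\<close> of \<open>m\<close> contribute a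
  kernel with the factor \<open>\<bar>\<psi>(y) - \<psi>(x)\<bar> \<le> ((1 + \<rho>(x,y))/N)\<^sup>s\<close>, which trades decay of order \<open>s\<close> for the
  gain \<open>N\<^bsup>-s\<^esup>\<close>. Columns farther away act only on the support of \<open>\<psi>\<close>, where their distance to \<open>x\<close> and to \<open>m\<close>
  is comparable. The first sum on the right dominates the single value at \<open>x\<close>.
\<close>
lemma cutoff_matrix_split:
  assumes A: "\<And>x y. x \<in> V \<Longrightarrow> y \<in> V \<Longrightarrow> cmod (A x y) \<le> M * K 1 g x y" and M: "0 \<le> M"
    and N: "1 \<le> N" and s: "0 \<le> s" "s \<le> 1" and g: "0 \<le> g" and m: "m \<in> V" and x: "x \<in> V"
    and sc: "\<And>x. x \<in> V \<Longrightarrow> (\<lambda>y. K 1 g x y * cmod (c y)) summable_on V"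
  shows "cmod (mat_apply V A (\<lambda>y. of_real (cutoff N m y) * c y) x)
    \<le> (if x \<in> B m (4 * N) then \<Sum>y\<in>B m (4 * N). cmod (mat_apply V A c y) else 0)
      + M * N powr (- s) * (\<Sum>y\<in>B m (8 * N). K 1 (g - s) x y * cmod (c y))
      + (if x \<in> B m (4 * N)
         then M * (2 powr g * (\<Sum>\<^sub>\<infinity>y\<in>V - B m (8 * N). K 1 g m y * cmod (c y))) else 0)"
proof -
  let ?\<psi> = "cutoff N m"
  have N0: "0 < N" using N by simp
  note \<psi> = cutoff_props[OF N0, of m]
  define t where "t y = A x y * (of_real (?\<psi> y - ?\<psi> x) * c y)" for y
  have sA: "(\<lambda>y. cmod (A x y * c y)) summable_on V"
    by (rule matrix_row_summable(1)[OF A x sc[OF x]])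
  hence sA': "(\<lambda>y. A x y * c y) summable_on V" by (rule abs_summable_summable)
  have d1: "\<bar>?\<psi> y - ?\<psi> x\<bar> \<le> 1" for y using \<psi>(1,2)[of x] \<psi>(1,2)[of y] by linarith
  have t_le: "cmod (t y) = cmod (A x y * c y) * \<bar>?\<psi> y - ?\<psi> x\<bar>" for y
    by (simp add: t_def norm_mult mult_ac flip: of_real_diff)
  have "cmod (t y) \<le> cmod (A x y * c y)" for y
    unfolding t_le using mult_left_mono[OF d1[of y], of "cmod (A x y * c y)"] by simp
  hence st: "(\<lambda>y. cmod (t y)) summable_on V"
    by (intro summable_on_comparison_test[OF sA]) auto
  have "mat_apply V A (\<lambda>y. of_real (?\<psi> y) * c y) x
      = (\<Sum>\<^sub>\<infinity>y\<in>V. of_real (?\<psi> x) * (A x y * c y) + t y)"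
    unfolding mat_apply_def t_def by (intro infsum_cong) (simp add: algebra_simps)
  also have "\<dots> = (\<Sum>\<^sub>\<infinity>y\<in>V. of_real (?\<psi> x) * (A x y * c y)) + (\<Sum>\<^sub>\<infinity>y\<in>V. t y)"
    by (intro infsum_add summable_on_cmult_right sA' abs_summable_summable[OF st])
  also have "(\<Sum>\<^sub>\<infinity>y\<in>V. of_real (?\<psi> x) * (A x y * c y)) = of_real (?\<psi> x) * mat_apply V A c x"
    unfolding mat_apply_def by (rule infsum_cmult_right')
  finally have "cmod (mat_apply V A (\<lambda>y. of_real (?\<psi> y) * c y) x)
      \<le> cmod (of_real (?\<psi> x) * mat_apply V A c x) + cmod (\<Sum>\<^sub>\<infinity>y\<in>V. t y)"
    by (simp add: norm_triangle_ineq)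
  also have "cmod (\<Sum>\<^sub>\<infinity>y\<in>V. t y) \<le> (\<Sum>\<^sub>\<infinity>y\<in>V. cmod (t y))"
    by (rule norm_infsum_bound[OF st])
  also have "(\<Sum>\<^sub>\<infinity>y\<in>V. cmod (t y)) = (\<Sum>\<^sub>\<infinity>y\<in>B m (8 * N) \<union> (V - B m (8 * N)). cmod (t y))"
    by (rule infsum_cong_neutral) (auto simp: mem_ball)
  also have "\<dots> = (\<Sum>y\<in>B m (8 * N). cmod (t y)) + (\<Sum>\<^sub>\<infinity>y\<in>V - B m (8 * N). cmod (t y))"
    by (subst infsum_Un_disjoint)
      (auto intro: summable_on_subset_banach[OF st] simp: finite_ball[OF m])
  finally have split: "cmod (mat_apply V A (\<lambda>y. of_real (?\<psi> y) * c y) x)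
      \<le> cmod (of_real (?\<psi> x) * mat_apply V A c x)
        + ((\<Sum>y\<in>B m (8 * N). cmod (t y)) + (\<Sum>\<^sub>\<infinity>y\<in>V - B m (8 * N). cmod (t y)))"
    by simp
  have I: "cmod (of_real (?\<psi> x) * mat_apply V A c x)
    \<le> (if x \<in> B m (4 * N) then \<Sum>y\<in>B m (4 * N). cmod (mat_apply V A c y) else 0)"
  proof (cases "x \<in> B m (4 * N)")
    case True
    have "cmod (of_real (?\<psi> x) * mat_apply V A c x) \<le> 1 * cmod (mat_apply V A c x)"
      unfolding norm_mult using \<psi>(1,2)[of x] by (intro mult_right_mono) auto
    also have "\<dots> \<le> (\<Sum>y\<in>B m (4 * N). cmod (mat_apply V A c y))"
      using True finite_ball[OF m] member_le_sum[of x "B m (4 * N)" "\<lambda>y. cmod (mat_apply V A c y)"] by auto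
    finally show ?thesis using True by simp
  next
    case False
    hence "?\<psi> x = 0" using x by (intro \<psi>(4)) (auto simp: mem_ball)
    thus ?thesis using False by simp
  qed
  have II: "(\<Sum>y\<in>B m (8 * N). cmod (t y))
    \<le> M * N powr (- s) * (\<Sum>y\<in>B m (8 * N). K 1 (g - s) x y * cmod (c y))"
    unfolding sum_distrib_left
  proof (rule sum_mono)
    fix y assume "y \<in> B m (8 * N)"
    hence y: "y \<in> V" by (simp add: mem_ball)
    have "\<rho> x y / (2 * N) \<le> (1 + \<rho> x y) / N" using N0 by (simp add: field_simps)
    hence "\<bar>?\<psi> y - ?\<psi> x\<bar> \<le> ((1 + \<rho> x y) / N) powr s"
      using cutoff_lipschitz[OF N0 m x y] d1[of y] N0 s
      by (intro min_le_powr) (auto intro: add_pos_nonneg)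
    hence "cmod (A x y) * cmod (c y) * \<bar>?\<psi> y - ?\<psi> x\<bar>
        \<le> (M * K 1 g x y) * cmod (c y) * ((1 + \<rho> x y) / N) powr s"
      using A[OF x y] M by (intro mult_mono) auto
    also have "\<dots> = M * N powr (- s) * (K 1 (g - s) x y * cmod (c y))"
      by (simp add: K_def powr_divide powr_minus_divide powr_diff mult_ac)
    finally show "cmod (t y) \<le> M * N powr (- s) * (K 1 (g - s) x y * cmod (c y))"
      by (simp add: t_le norm_mult)
  qed
  have III: "(\<Sum>\<^sub>\<infinity>y\<in>V - B m (8 * N). cmod (t y)) \<le> (if x \<in> B m (4 * N)
         then M * (2 powr g * (\<Sum>\<^sub>\<infinity>y\<in>V - B m (8 * N). K 1 g m y * cmod (c y))) else 0)"
  proof (cases "x \<in> B m (4 * N)")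
    case True
    have sm: "(\<lambda>y. M * (2 powr g * (K 1 g m y * cmod (c y)))) summable_on (V - B m (8 * N))"
      by (intro summable_on_cmult_right summable_on_subset_banach[OF sc[OF m]]) auto
    have "(\<Sum>\<^sub>\<infinity>y\<in>V - B m (8 * N). cmod (t y))
        \<le> (\<Sum>\<^sub>\<infinity>y\<in>V - B m (8 * N). M * (2 powr g * (K 1 g m y * cmod (c y))))"
    proof (rule infsum_mono[OF _ sm])
      show "(\<lambda>y. cmod (t y)) summable_on (V - B m (8 * N))"
        by (rule summable_on_subset_banach[OF st]) auto
      fix y assume y: "y \<in> V - B m (8 * N)"
      hence yV: "y \<in> V" and far: "8 * N < \<rho> m y" by (auto simp: mem_ball)
      have "\<rho> m y \<le> \<rho> m x + \<rho> x y" by (rule rho_triangle[OF m x yV])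
      hence "1 + \<rho> m y \<le> 2 * (1 + \<rho> x y)" using True far by (simp add: mem_ball)
      hence "K 1 g x y \<le> 2 powr g * K 1 g m y" using g by (intro K_compare) auto
      hence le: "cmod (A x y) \<le> M * (2 powr g * K 1 g m y)"
        using A[OF x yV] M by (meson mult_left_mono order_trans)
      have "cmod (t y) \<le> cmod (A x y) * cmod (c y) * 1"
        unfolding t_le norm_mult using d1 by (intro mult_left_mono) auto
      also have "\<dots> \<le> M * (2 powr g * K 1 g m y) * cmod (c y) * 1"
        using le by (intro mult_right_mono) auto
      finally show "cmod (t y) \<le> M * (2 powr g * (K 1 g m y * cmod (c y)))" by (simp add: mult_ac)
    qed
    thus ?thesis using True by (simp add: infsum_cmult_right')
  next
    case False
    hence "?\<psi> x = 0" using x by (intro \<psi>(4)) (auto simp: mem_ball)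
    moreover have "?\<psi> y = 0" if "y \<in> V - B m (8 * N)" for y
      using that N0 by (intro \<psi>(4)) (auto simp: mem_ball)
    ultimately have "cmod (t y) = 0" if "y \<in> V - B m (8 * N)" for y using that by (simp add: t_def)
    hence "(\<Sum>\<^sub>\<infinity>y\<in>V - B m (8 * N). cmod (t y)) = 0" by (rule infsum_0)
    thus ?thesis using False by simp
  qed
  show ?thesis using split I II III by linarith
qed

lemma sum_ball_indicator_le:
  assumes m: "m \<in> V" and F: "finite F" "F \<subseteq> V" and w: "\<And>x. x \<in> V \<Longrightarrow> 0 < w x" and a: "0 \<le> (a :: real)"
  shows "(\<Sum>x\<in>F. (if x \<in> B m R then a else 0) * w x) \<le> a * (\<Sum>x\<in>B m R. w x)"
proof -
  have "(\<Sum>x\<in>F. (if x \<in> B m R then a else 0) * w x) = (\<Sum>x\<in>F. if x \<in> B m R then a * w x else 0)"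
    by (rule sum.cong) auto
  also have "\<dots> = (\<Sum>x\<in>F \<inter> B m R. a * w x)" using F by (simp add: sum.inter_restrict)
  also have "\<dots> \<le> (\<Sum>x\<in>B m R. a * w x)"
    using finite_ball[OF m] a w by (intro sum_mono2) (auto simp: mem_ball less_imp_le)
  finally show ?thesis by (simp add: sum_distrib_left)
qed

text \<open>
  The three terms of \<open>cutoff_matrix_split\<close> are measured in \<open>\<ell>\<^sup>p\<^sub>w\<close>. The commutator with near columns is
  bounded by \<open>kernel_weighted_bound\<close>, applied with decay \<open>g - s > d\<close>, and by \<open>near_energy_le\<close>, each of
  which costs \<open>A\<^sub>p(w)\<^bsup>1/p\<^esup>\<close>; the far columns are bounded by \<open>far_tail_le\<close>. Since \<open>\<psi> c\<close> has finite
  support, stability applies to it for every \<open>c\<close> for which the sums converge.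
\<close>
lemma local_stability:
  assumes s: "0 < s" "s \<le> 1" "s < g - d"
  obtains C where "1 \<le> C"
    and "\<And>p w P A M \<beta> N S c m. \<lbrakk>muckenhoupt p w P; 1 \<le> N; maximal_disjoint V E N S; m \<in> V; 0 \<le> M;
      \<And>x y. x \<in> V \<Longrightarrow> y \<in> V \<Longrightarrow> cmod (A x y) \<le> M * K 1 g x y; 0 < \<beta>;
      \<And>c. c \<in> lpw V p w \<Longrightarrow> \<beta> * lpw_norm V p w c \<le> lpw_norm V p w (mat_apply V A c);
      \<And>x. x \<in> V \<Longrightarrow> (\<lambda>y. K 1 g x y * cmod (c y)) summable_on V;
      (\<lambda>n. K N g m n * local_avg p w N c n) summable_on S\<rbrakk>
    \<Longrightarrow> \<beta> * local_avg p w N c m \<le> 3 * (\<Sum>y\<in>B m (4 * N). cmod (mat_apply V A c y))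
        + C * (P powr (2 / p) * M * N powr (- s)) * avg_potential p w g N S c m"
proof -
  have g: "d < g" "0 \<le> g" "d < g - s" using s const_bounds by auto
  obtain C0 where C0: "1 \<le> C0" and dom1: "\<And>p w P N v x. \<lbrakk>muckenhoupt p w P; 1 \<le> N; v \<in> lpw V p w; x \<in> V\<rbrakk>
      \<Longrightarrow> (\<lambda>y. K N g x y * cmod (v y)) summable_on V"
    and dom2: "\<And>p w P N v u L. \<lbrakk>muckenhoupt p w P; 1 \<le> N; v \<in> lpw V p w; 0 \<le> L;
        \<And>x. x \<in> V \<Longrightarrow> cmod (u x) \<le> L * (\<Sum>\<^sub>\<infinity>y\<in>V. K N g x y * cmod (v y))\<rbrakk>
      \<Longrightarrow> u \<in> lpw V p w \<and> lpw_norm V p w u \<le> L * (P powr (1 / p) * (C0 * N powr d)) * lpw_norm V p w v"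
  proof (rule kernel_dominated_lpw[OF g(1)], goal_cases)
    case (1 C)
    show ?case by (rule 1(1)[OF 1(2-)])
  qed
  obtain C1 where C1: "1 \<le> C1" and bound: "\<And>p w P N F G f. \<lbrakk>muckenhoupt p w P; 1 \<le> N; finite F; F \<subseteq> V;
      finite G; G \<subseteq> V; \<And>y. y \<in> V \<Longrightarrow> 0 \<le> f y\<rbrakk> \<Longrightarrow>
    (\<Sum>x\<in>F. w x * (\<Sum>y\<in>G. K N (g - s) x y * f y) powr p)
      \<le> P * (C1 * N powr d) powr p * (\<Sum>y\<in>G. f y powr p * w y)"
  proof (rule kernel_weighted_bound[OF g(3)], goal_cases)
    case (1 C)
    show ?case by (rule 1(1)[OF 1(2-)])
  qed
  define Ca where "Ca = C1 * D3\<^sup>2 * 11 powr g"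
  define Cb where "Cb = 2 powr g * 2 powr g * D1 * 5 powr d"
  have Ca: "1 \<le> Ca"
  proof -
    have "1 \<le> D3\<^sup>2" using const_bounds by simp
    moreover have "1 \<le> (11 :: real) powr g" using g by (simp add: ge_one_powr_ge_zero)
    ultimately have "1 * 1 * 1 \<le> C1 * D3\<^sup>2 * 11 powr g" using C1 by (intro mult_mono) auto
    thus ?thesis by (simp add: Ca_def)
  qed
  have Cb: "0 \<le> Cb" using const_bounds by (simp add: Cb_def)
  show thesis
  proof (rule that)
    show "1 \<le> 3 * (Ca + Cb)" using Ca Cb by simp
    fix p P M \<beta> N :: real and w A S and c :: "'v \<Rightarrow> complex" and m
    assume mu: "muckenhoupt p w P" and N: "1 \<le> N" and S: "maximal_disjoint V E N S" and m: "m \<in> V"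
      and M: "0 \<le> M" and A: "\<And>x y. x \<in> V \<Longrightarrow> y \<in> V \<Longrightarrow> cmod (A x y) \<le> M * K 1 g x y" and \<beta>: "0 < \<beta>"
      and stable: "\<And>c. c \<in> lpw V p w \<Longrightarrow> \<beta> * lpw_norm V p w c \<le> lpw_norm V p w (mat_apply V A c)"
      and sc: "\<And>x. x \<in> V \<Longrightarrow> (\<lambda>y. K 1 g x y * cmod (c y)) summable_on V"
      and sH: "(\<lambda>n. K N g m n * local_avg p w N c n) summable_on S"
    note p = muckenhoupt_basic(1)[OF mu] and P = muckenhoupt_basic(2)[OF mu]
      and w = muckenhoupt_basic(3)[OF mu]
    let ?W = "\<Sum>y\<in>B m (4 * N). w y"
    have W: "0 < ?W" using weight_ball_pos[OF mu m] N by simp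
    define a where "a = local_avg p w N c m"
    define b where "b = (\<Sum>y\<in>B m (4 * N). cmod (mat_apply V A c y))"
    define H where "H = avg_potential p w g N S c m"
    define T where "T = (\<Sum>\<^sub>\<infinity>y\<in>V - B m (8 * N). K 1 g m y * cmod (c y))"
    define U where "U x = (\<Sum>y\<in>B m (8 * N). K 1 (g - s) x y * cmod (c y))" for x
    define u where "u y = of_real (cutoff N m y) * c y" for y
    define X where "X = M * N powr (- s) * (P powr (1 / p) * C1) * (P powr (1 / p) * D3\<^sup>2 * 11 powr g * H)"
    define Z where "Z = M * (2 powr g * T)"
    have b0: "0 \<le> b" unfolding b_def by (intro sum_nonneg) auto
    have H0: "0 \<le> H" unfolding H_def avg_potential_def by (intro infsum_nonneg) auto
    have T0: "0 \<le> T" unfolding T_def by (intro infsum_nonneg) auto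
    have U0: "0 \<le> U x" for x unfolding U_def by (intro sum_nonneg) auto
    have X0: "0 \<le> X" using M C1 H0 by (simp add: X_def)
    have Z0: "0 \<le> Z" using M T0 by (simp add: Z_def)
    have N0: "0 < N" using N by simp
    have u_zero: "u y = 0" if "y \<in> V - B m (4 * N)" for y
      using that cutoff_props(4)[OF N0, of m y] by (auto simp: u_def mem_ball)
    have u_lpw: "u \<in> lpw V p w"
    proof -
      have "(\<lambda>x. cmod (u x) powr p * w x) summable_on B m (4 * N)"
        using finite_ball[OF m] by (rule summable_on_finite)
      moreover have "(\<lambda>x. cmod (u x) powr p * w x) summable_on B m (4 * N)
          \<longleftrightarrow> (\<lambda>x. cmod (u x) powr p * w x) summable_on V"
        by (rule summable_on_cong_neutral) (use u_zero in \<open>auto simp: mem_ball\<close>)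
      ultimately show ?thesis by (simp add: lpw_def)
    qed
    have Au_lpw: "mat_apply V A u \<in> lpw V p w"
      using dom2[OF mu order_refl u_lpw M] matrix_row_summable(2)[OF A]
        dom1[OF mu order_refl u_lpw] by blast
    have Au: "cmod (mat_apply V A u x) \<le> (if x \<in> B m (4 * N) then b else 0)
      + M * N powr (- s) * U x + (if x \<in> B m (4 * N) then Z else 0)" if x: "x \<in> V" for x
      using cutoff_matrix_split[OF A M N _ s(2) g(2) m x sc] s
      unfolding u_def[abs_def] b_def U_def Z_def T_def by simp
    have fin: "(\<Sum>x\<in>F. cmod (mat_apply V A u x) powr p * w x)
      \<le> ?W * (3 powr p * (b powr p + X powr p + Z powr p))" if F: "finite F" "F \<subseteq> V" for F
    proof -
      let ?b = "\<lambda>x. if x \<in> B m (4 * N) then b else 0"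
      let ?Z = "\<lambda>x. if x \<in> B m (4 * N) then Z else 0"
      let ?X = "M * N powr (- s)"
      have "(\<Sum>x\<in>F. cmod (mat_apply V A u x) powr p * w x)
          \<le> (\<Sum>x\<in>F. 3 powr p * (?b x powr p + (?X * U x) powr p + ?Z x powr p) * w x)"
      proof (intro sum_mono mult_right_mono)
        fix x assume "x \<in> F"
        hence x: "x \<in> V" using F by auto
        have "cmod (mat_apply V A u x) powr p \<le> (?b x + ?X * U x + ?Z x) powr p"
          using Au[OF x] p by (intro powr_mono2) auto
        also have "\<dots> \<le> 3 powr p * (?b x powr p + (?X * U x) powr p + ?Z x powr p)"
          using b0 U0 Z0 M p by (intro powr_sum3_le) auto
        finally show "cmod (mat_apply V A u x) powr p
          \<le> 3 powr p * (?b x powr p + (?X * U x) powr p + ?Z x powr p)" .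
        show "0 \<le> w x" using w[OF x] by simp
      qed
      also have "\<dots> = 3 powr p * ((\<Sum>x\<in>F. ?b x powr p * w x) + ?X powr p * (\<Sum>x\<in>F. w x * U x powr p)
          + (\<Sum>x\<in>F. ?Z x powr p * w x))"
        by (simp add: sum_distrib_left sum.distrib distrib_left distrib_right powr_mult mult_ac)
      also have "\<dots> \<le> 3 powr p * (b powr p * ?W + ?W * X powr p + Z powr p * ?W)"
      proof (intro mult_left_mono add_mono)
        have "(\<Sum>x\<in>F. ?b x powr p * w x) = (\<Sum>x\<in>F. (if x \<in> B m (4 * N) then b powr p else 0) * w x)"
          by (rule sum.cong) auto
        thus "(\<Sum>x\<in>F. ?b x powr p * w x) \<le> b powr p * ?W"
          using sum_ball_indicator_le[OF m F w, where a = "b powr p"] by simp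
        have "(\<Sum>x\<in>F. ?Z x powr p * w x) = (\<Sum>x\<in>F. (if x \<in> B m (4 * N) then Z powr p else 0) * w x)"
          by (rule sum.cong) auto
        thus "(\<Sum>x\<in>F. ?Z x powr p * w x) \<le> Z powr p * ?W"
          using sum_ball_indicator_le[OF m F w, where a = "Z powr p"] by simp
        have "(\<Sum>x\<in>F. w x * U x powr p)
            \<le> P * (C1 * 1 powr d) powr p * (\<Sum>y\<in>B m (8 * N). cmod (c y) powr p * w y)"
          unfolding U_def using F finite_ball[OF m] ball_subset_V by (intro bound[OF mu]) auto
        also have "\<dots> \<le> P * (C1 * 1 powr d) powr p * (?W * (P powr (1 / p) * D3\<^sup>2 * 11 powr g * H) powr p)"
          unfolding H_def using P by (intro mult_left_mono near_energy_le[OF mu N S m g(2) sH]) auto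
        finally have "?X powr p * (\<Sum>x\<in>F. w x * U x powr p)
            \<le> ?X powr p * (P * (C1 * 1 powr d) powr p * (?W * (P powr (1 / p) * D3\<^sup>2 * 11 powr g * H) powr p))"
          by (rule mult_left_mono) simp
        also have "\<dots> = ?W * X powr p"
        proof -
          have "(P powr (1 / p)) powr p = P" using p P by (simp add: powr_powr)
          thus ?thesis unfolding X_def by (simp only: powr_mult powr_one_eq_one mult_1_right mult_ac)
        qed
        finally show "?X powr p * (\<Sum>x\<in>F. w x * U x powr p) \<le> ?W * X powr p" .
      qed auto
      also have "\<dots> = ?W * (3 powr p * (b powr p + X powr p + Z powr p))" by (simp add: algebra_simps)
      finally show ?thesis .
    qed
    have "?W * (\<beta> * a) powr p = \<beta> powr p * (\<Sum>y\<in>B m (2 * N). cmod (c y) powr p * w y)"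
      using local_avg_powr[OF mu N m, of c] by (simp add: a_def powr_mult mult_ac)
    also have "(\<Sum>y\<in>B m (2 * N). cmod (c y) powr p * w y) = (\<Sum>y\<in>B m (2 * N). cmod (u y) powr p * w y)"
      using cutoff_props(3)[OF N0, of m] by (intro sum.cong) (auto simp: u_def mem_ball)
    also have "\<dots> \<le> (\<Sum>\<^sub>\<infinity>y\<in>V. cmod (u y) powr p * w y)"
      using u_lpw finite_ball[OF m] w ball_subset_V
      by (intro finite_sum_le_infsum) (auto simp: lpw_def less_imp_le)
    also have "\<beta> powr p * \<dots> \<le> (\<Sum>\<^sub>\<infinity>y\<in>V. cmod (mat_apply V A u y) powr p * w y)"
    proof -
      have inv: "(lpw_norm V p w v) powr p = (\<Sum>\<^sub>\<infinity>y\<in>V. cmod (v y) powr p * w y)" for v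
      proof -
        have "0 \<le> (\<Sum>\<^sub>\<infinity>y\<in>V. cmod (v y) powr p * w y)"
          using w by (intro infsum_nonneg) (auto simp: less_imp_le)
        thus ?thesis using p by (simp add: lpw_norm_def powr_powr)
      qed
      have "(\<beta> * lpw_norm V p w u) powr p \<le> (lpw_norm V p w (mat_apply V A u)) powr p"
        using stable[OF u_lpw] \<beta> p by (intro powr_mono2) (auto simp: lpw_norm_def)
      thus ?thesis by (simp add: powr_mult inv)
    qed
    also have "\<dots> \<le> ?W * (3 powr p * (b powr p + X powr p + Z powr p))"
      using Au_lpw fin by (intro infsum_le_finite_sums) (auto simp: lpw_def)
    finally have "(\<beta> * a) powr p \<le> 3 powr p * (b powr p + X powr p + Z powr p)"
      using W by (simp add: mult_left_mono)
    hence main: "\<beta> * a \<le> 3 * (b + X + Z)"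
      using \<beta> b0 X0 Z0 p by (intro powr_le_cancel_sum3) (auto simp: a_def)
    have PP: "P powr (1 / p) * P powr (1 / p) = P powr (2 / p)" by (simp flip: powr_add)
    have "X = Ca * (P powr (1 / p) * P powr (1 / p) * M * N powr (- s)) * H"
      by (simp only: X_def Ca_def mult_ac)
    hence X: "X = Ca * (P powr (2 / p) * M * N powr (- s)) * H" by (simp only: PP)
    have Z: "Z \<le> Cb * (P powr (2 / p) * M * N powr (- s)) * H"
    proof -
      have "T \<le> 2 powr g * D1 * 5 powr d * N powr (d - g) * P powr (1 / p) * H"
        unfolding T_def H_def by (rule far_tail_le[OF mu N S m g(2) sH sc[OF m]])
      also have "\<dots> \<le> 2 powr g * D1 * 5 powr d * N powr (- s) * P powr (2 / p) * H"
        using const_bounds N s P H0 p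
        by (intro mult_right_mono mult_mono powr_mono divide_right_mono) auto
      finally have "M * (2 powr g * T)
          \<le> M * (2 powr g * (2 powr g * D1 * 5 powr d * N powr (- s) * P powr (2 / p) * H))"
        using M by (intro mult_left_mono) auto
      also have "\<dots> = Cb * (P powr (2 / p) * M * N powr (- s)) * H" by (simp only: Cb_def mult_ac)
      finally show ?thesis by (simp add: Z_def)
    qed
    show "\<beta> * local_avg p w N c m \<le> 3 * (\<Sum>y\<in>B m (4 * N). cmod (mat_apply V A c y))
        + 3 * (Ca + Cb) * (P powr (2 / p) * M * N powr (- s)) * avg_potential p w g N S c m"
      using main X Z unfolding a_def b_def H_def by (simp add: algebra_simps)
  qed
qed

section \<open>A kernel bound for the left inverse\<close>

text \<open>
  Summing \<open>local_stability\<close> against the kernel gives \<open>\<beta> H \<le> 3 G + \<epsilon> C H\<close>, where \<open>G\<close> is the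
  potential of \<open>\<bar>Ac\<bar>\<close>. Choosing \<open>N\<close> such that \<open>2 \<epsilon> C \<le> \<beta>\<close> absorbs the last term, which is legitimate because
  the summability assumptions make \<open>H\<close> finite. The result covers sequences \<open>c\<close> outside \<open>\<ell>\<^sup>p\<^sub>w\<close>, which is what
  makes it usable in another weighted space.
\<close>
lemma stable_kernel_bound:
  assumes s: "0 < s" "s \<le> 1" "s < g - d" and g: "dt < g"
  obtains C where "1 \<le> C"
    and "\<And>p w P A M \<beta> N c y. \<lbrakk>muckenhoupt p w P; 1 \<le> N; 0 \<le> M;
      \<And>x y. x \<in> V \<Longrightarrow> y \<in> V \<Longrightarrow> cmod (A x y) \<le> M * K 1 g x y; 0 < \<beta>;
      \<And>c. c \<in> lpw V p w \<Longrightarrow> \<beta> * lpw_norm V p w c \<le> lpw_norm V p w (mat_apply V A c);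
      \<And>N x. 1 \<le> N \<Longrightarrow> x \<in> V \<Longrightarrow> (\<lambda>y. K N g x y * cmod (c y)) summable_on V;
      \<And>N x. 1 \<le> N \<Longrightarrow> x \<in> V \<Longrightarrow> (\<lambda>y. K N g x y * cmod (mat_apply V A c y)) summable_on V;
      C * (P powr (2 / p) * M * N powr (- s)) \<le> \<beta>; y \<in> V\<rbrakk>
    \<Longrightarrow> cmod (c y) \<le> C * N powr d * P powr (1 / p) / \<beta> * (\<Sum>\<^sub>\<infinity>z\<in>V. K N g y z * cmod (mat_apply V A c z))"
proof -
  have g0: "0 \<le> g" using g const_bounds by auto
  obtain C1 where C1: "1 \<le> C1" and loc: "\<And>p w P A M \<beta> N S c m. \<lbrakk>muckenhoupt p w P; 1 \<le> N; maximal_disjoint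
      V E N S; m \<in> V; 0 \<le> M;
      \<And>x y. x \<in> V \<Longrightarrow> y \<in> V \<Longrightarrow> cmod (A x y) \<le> M * K 1 g x y; 0 < \<beta>;
      \<And>c. c \<in> lpw V p w \<Longrightarrow> \<beta> * lpw_norm V p w c \<le> lpw_norm V p w (mat_apply V A c);
      \<And>x. x \<in> V \<Longrightarrow> (\<lambda>y. K 1 g x y * cmod (c y)) summable_on V;
      (\<lambda>n. K N g m n * local_avg p w N c n) summable_on S\<rbrakk>
    \<Longrightarrow> \<beta> * local_avg p w N c m \<le> 3 * (\<Sum>y\<in>B m (4 * N). cmod (mat_apply V A c y))
        + C1 * (P powr (2 / p) * M * N powr (- s)) * avg_potential p w g N S c m"
  proof (rule local_stability[OF s], goal_cases)
    case (1 C)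
    show ?case by (rule 1(1)[OF 1(2-)])
  qed
  obtain C2 where C2: "1 \<le> C2" and conv: "\<And>N S F x z. \<lbrakk>maximal_disjoint V E N S; 0 < N; finite F; F \<subseteq> S;
      x \<in> V; z \<in> V\<rbrakk> \<Longrightarrow> (\<Sum>m\<in>F. K N g x m * K N g m z) \<le> C2 * K N g x z"
  proof (rule separated_kernel_convolution[OF g], goal_cases)
    case (1 C)
    show ?case by (rule 1(1)[OF 1(2-)])
  qed
  define C3 where "C3 = 5 powr g * (D2 * 5 powr dt)"
  define C4 where "C4 = D1 * 5 powr d * 6 * C3 * 3 powr g"
  define C where "C = max (2 * C1 * C2) C4"
  have C3: "0 \<le> C3" using const_bounds by (simp add: C3_def)
  have C12: "1 \<le> C1 * C2" using C1 C2 mult_mono[of 1 C1 1 C2] by simp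
  show thesis
  proof (rule that)
    show "1 \<le> C" using C12 by (simp add: C_def)
    fix p P M \<beta> N :: real and w A and c :: "'v \<Rightarrow> complex" and y
    assume mu: "muckenhoupt p w P" and N: "1 \<le> N"
      and M: "0 \<le> M" and A: "\<And>x y. x \<in> V \<Longrightarrow> y \<in> V \<Longrightarrow> cmod (A x y) \<le> M * K 1 g x y" and \<beta>: "0 < \<beta>"
      and stable: "\<And>c. c \<in> lpw V p w \<Longrightarrow> \<beta> * lpw_norm V p w c \<le> lpw_norm V p w (mat_apply V A c)"
      and sc: "\<And>N x. 1 \<le> N \<Longrightarrow> x \<in> V \<Longrightarrow> (\<lambda>y. K N g x y * cmod (c y)) summable_on V"
      and sAc: "\<And>N x. 1 \<le> N \<Longrightarrow> x \<in> V \<Longrightarrow> (\<lambda>y. K N g x y * cmod (mat_apply V A c y)) summable_on V"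
      and small: "C * (P powr (2 / p) * M * N powr (- s)) \<le> \<beta>" and y: "y \<in> V"
    have N0: "0 < N" using N by simp
    obtain S where S: "maximal_disjoint V E N S" using maximal_disjoint_exists N by fastforce
    have SV: "S \<subseteq> V" using S by (simp add: maximal_disjoint_def)
    let ?a = "local_avg p w N c"
    let ?b = "\<lambda>m. \<Sum>y\<in>B m (4 * N). cmod (mat_apply V A c y)"
    let ?H = "avg_potential p w g N S c"
    define G where "G x = (\<Sum>\<^sub>\<infinity>m\<in>S. K N g x m * ?b m)" for x
    define \<epsilon> where "\<epsilon> = C1 * (P powr (2 / p) * M * N powr (- s))"
    have \<epsilon>0: "0 \<le> \<epsilon>" using M C1 by (simp add: \<epsilon>_def)
    have \<epsilon>: "2 * (\<epsilon> * C2) \<le> \<beta>"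
    proof -
      have "2 * (\<epsilon> * C2) = 2 * C1 * C2 * (P powr (2 / p) * M * N powr (- s))" by (simp add: \<epsilon>_def mult_ac)
      also have "\<dots> \<le> C * (P powr (2 / p) * M * N powr (- s))"
        using M by (intro mult_right_mono) (auto simp: C_def)
      finally show ?thesis using small by linarith
    qed
    have sums: "(\<Sum>m\<in>F. K N g x m * (\<Sum>y\<in>B m (4 * N). cmod (v y))) \<le> C3 * (\<Sum>\<^sub>\<infinity>y\<in>V. K N g x y * cmod (v y))"
      if "finite F" "F \<subseteq> S" "x \<in> V" "(\<lambda>y. K N g x y * cmod (v y)) summable_on V" for F x and v :: "'v \<Rightarrow> complex"
      unfolding C3_def using that by (intro separated_kernel_ball_sums[OF S N0 g0]) auto
    have sG: "(\<lambda>m. K N g x m * ?b m) summable_on S" if x: "x \<in> V" for x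
    proof (rule nonneg_bdd_above_summable_on)
      show "bdd_above (sum (\<lambda>m. K N g x m * ?b m) ` {F. F \<subseteq> S \<and> finite F})"
        by (rule bdd_aboveI2) (use sums[OF _ _ x sAc[OF N x]] in auto)
    qed (auto intro!: mult_nonneg_nonneg sum_nonneg)
    have sH: "(\<lambda>m. K N g x m * ?a m) summable_on S" if x: "x \<in> V" for x
    proof (rule nonneg_bdd_above_summable_on)
      show "bdd_above (sum (\<lambda>m. K N g x m * ?a m) ` {F. F \<subseteq> S \<and> finite F})"
      proof (rule bdd_aboveI2)
        fix F assume "F \<in> {F. F \<subseteq> S \<and> finite F}"
        hence F: "finite F" "F \<subseteq> S" by auto
        have "(\<Sum>m\<in>F. K N g x m * ?a m) \<le> (\<Sum>m\<in>F. K N g x m * (\<Sum>y\<in>B m (4 * N). cmod (c y)))"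
        proof (intro sum_mono mult_left_mono)
          fix m assume "m \<in> F"
          hence m: "m \<in> V" using F SV by auto
          have "?a m \<le> (\<Sum>y\<in>B m (2 * N). cmod (c y))" by (rule local_avg_le_sum[OF mu N m])
          also have "\<dots> \<le> (\<Sum>y\<in>B m (4 * N). cmod (c y))"
            using finite_ball[OF m] N by (intro sum_mono2) (auto simp: mem_ball)
          finally show "?a m \<le> (\<Sum>y\<in>B m (4 * N). cmod (c y))" .
        qed auto
        also have "\<dots> \<le> C3 * (\<Sum>\<^sub>\<infinity>y\<in>V. K N g x y * cmod (c y))"
          by (rule sums[OF F x sc[OF N x]])
        finally show "(\<Sum>m\<in>F. K N g x m * ?a m) \<le> C3 * (\<Sum>\<^sub>\<infinity>y\<in>V. K N g x y * cmod (c y))" .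
      qed
    qed auto
    have H0: "0 \<le> ?H x" for x unfolding avg_potential_def by (intro infsum_nonneg) auto
    have H_le: "?H x \<le> 6 / \<beta> * G x" if x: "x \<in> V" for x
    proof -
      have "\<beta> * ?H x \<le> 3 * G x + \<epsilon> * (C2 * ?H x)"
        unfolding avg_potential_def infsum_cmult_right'[where c = \<beta>, symmetric]
      proof (rule infsum_le_finite_sums)
        show "(\<lambda>m. \<beta> * (K N g x m * ?a m)) summable_on S"
          using sH[OF x] by (rule summable_on_cmult_right)
        fix F assume F: "finite F" "F \<subseteq> S"
        have "(\<Sum>m\<in>F. \<beta> * (K N g x m * ?a m)) = (\<Sum>m\<in>F. K N g x m * (\<beta> * ?a m))"
          by (simp only: mult_ac)
        also have "\<dots> \<le> (\<Sum>m\<in>F. K N g x m * (3 * ?b m + \<epsilon> * ?H m))"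
        proof (intro sum_mono mult_left_mono)
          fix m assume "m \<in> F"
          hence m: "m \<in> V" using F SV by auto
          show "\<beta> * ?a m \<le> 3 * ?b m + \<epsilon> * ?H m"
            unfolding \<epsilon>_def by (rule loc[OF mu N S m M A \<beta> stable sc sH[OF m]]) auto
        qed auto
        also have "\<dots> = 3 * (\<Sum>m\<in>F. K N g x m * ?b m) + \<epsilon> * (\<Sum>m\<in>F. K N g x m * ?H m)"
          by (simp add: sum_distrib_left sum.distrib distrib_left mult_ac)
        \<comment> \<open>The finite sum over \<open>m\<close> is moved inside the potential \<open>?H m\<close>, where the self-reproducing
          property of the kernel applies.\<close>
        also have "\<dots> \<le> 3 * G x + \<epsilon> * (C2 * ?H x)"
        proof (intro add_mono mult_left_mono)
          show "(\<Sum>m\<in>F. K N g x m * ?b m) \<le> G x"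
            unfolding G_def using F sG[OF x] by (intro finite_sum_le_infsum) (auto intro!:
                mult_nonneg_nonneg sum_nonneg)
          have FV: "m \<in> V" if "m \<in> F" for m using that F SV by auto
          have "(\<Sum>m\<in>F. K N g x m * ?H m) = (\<Sum>m\<in>F. \<Sum>\<^sub>\<infinity>n\<in>S. K N g x m * (K N g m n * ?a n))"
            by (simp add: avg_potential_def infsum_cmult_right')
          also have "\<dots> = (\<Sum>\<^sub>\<infinity>n\<in>S. \<Sum>m\<in>F. K N g x m * (K N g m n * ?a n))"
            by (intro infsum_finite_sum(2)[OF F(1), symmetric] summable_on_cmult_right sH FV)
          also have "\<dots> \<le> (\<Sum>\<^sub>\<infinity>n\<in>S. C2 * (K N g x n * ?a n))"
          proof (rule infsum_mono)
            show "(\<lambda>n. \<Sum>m\<in>F. K N g x m * (K N g m n * ?a n)) summable_on S"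
              by (intro infsum_finite_sum(1)[OF F(1)] summable_on_cmult_right sH FV)
            show "(\<lambda>n. C2 * (K N g x n * ?a n)) summable_on S"
              using sH[OF x] by (rule summable_on_cmult_right)
            fix n assume "n \<in> S"
            hence n: "n \<in> V" using SV by auto
            have "(\<Sum>m\<in>F. K N g x m * (K N g m n * ?a n)) = (\<Sum>m\<in>F. K N g x m * K N g m n) * ?a n"
              by (simp add: sum_distrib_right mult.assoc)
            also have "\<dots> \<le> C2 * K N g x n * ?a n"
              by (intro mult_right_mono conv[OF S N0 F x n]) auto
            finally show "(\<Sum>m\<in>F. K N g x m * (K N g m n * ?a n)) \<le> C2 * (K N g x n * ?a n)"
              by (simp add: mult.assoc)
          qed
          also have "\<dots> = C2 * ?H x" by (simp add: avg_potential_def infsum_cmult_right')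
          finally show "(\<Sum>m\<in>F. K N g x m * ?H m) \<le> C2 * ?H x" .
        qed (use \<epsilon>0 in auto)
        finally show "(\<Sum>m\<in>F. \<beta> * (K N g x m * ?a m)) \<le> 3 * G x + \<epsilon> * (C2 * (\<Sum>\<^sub>\<infinity>m\<in>S. K N g x m * ?a m))"
          by (simp add: avg_potential_def)
      qed
      moreover have "2 * (\<epsilon> * C2) * ?H x \<le> \<beta> * ?H x" using \<epsilon> H0 by (rule mult_right_mono)
      ultimately have "\<beta> * ?H x \<le> 6 * G x" by (simp add: algebra_simps)
      thus ?thesis using \<beta> by (simp add: field_simps)
    qed
    obtain m where m: "m \<in> S" "m \<in> V" "\<rho> m y \<le> 2 * N" using maximal_disjoint_cover[OF S y] .
    let ?I = "\<lambda>x. \<Sum>\<^sub>\<infinity>z\<in>V. K N g x z * cmod (mat_apply V A c z)"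
    have "G m \<le> C3 * ?I m"
      unfolding G_def using sG[OF m(2)] sums[OF _ _ m(2) sAc[OF N m(2)]]
      by (intro infsum_le_finite_sums) auto
    also have "\<dots> \<le> C3 * (3 powr g * ?I y)"
      unfolding infsum_cmult_right'[where c = "3 powr g", symmetric]
    proof (intro mult_left_mono infsum_mono sAc[OF N m(2)] summable_on_cmult_right sAc[OF N y])
      fix z assume z: "z \<in> V"
      have "\<rho> y z \<le> \<rho> y m + \<rho> m z" using y m z by (intro rho_triangle)
      hence "K N g m z \<le> 3 powr g * K N g y z"
        using N g0 m rho_commute[OF y m(2)] by (intro K_compare) auto
      thus "K N g m z * cmod (mat_apply V A c z) \<le> 3 powr g * (K N g y z * cmod (mat_apply V A c z))"
        by (simp add: mult.assoc[symmetric] mult_right_mono)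
    qed (use C3 in auto)
    finally have G_le: "G m \<le> C3 * (3 powr g * ?I y)" .
    have "K N g m m * ?a m \<le> ?H m"
      using finite_sum_le_infsum[OF sH[OF m(2)], of "{m}"] m(1) by (simp add: avg_potential_def)
    hence a_le: "?a m \<le> 6 / \<beta> * G m" using H_le[OF m(2)] m(2) by simp
    let ?Q = "D1 * 5 powr d * N powr d * P powr (1 / p)"
    have Q: "0 \<le> ?Q" using const_bounds by simp
    have "cmod (c y) \<le> (\<Sum>y\<in>B m (2 * N). cmod (c y))"
      using finite_ball[OF m(2)] m y by (intro member_le_sum) (auto simp: mem_ball)
    also have "\<dots> \<le> ?Q * ?a m" by (rule local_sum_le_avg[OF mu N m(2)])
    also have "\<dots> \<le> ?Q * (6 / \<beta> * (C3 * (3 powr g * ?I y)))"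
      using Q \<beta> a_le G_le by (meson mult_left_mono order_trans divide_nonneg_pos zero_le_numeral)
    also have "\<dots> = C4 * (N powr d * P powr (1 / p) / \<beta> * ?I y)"
      by (simp add: C4_def field_simps)
    also have "\<dots> \<le> C * (N powr d * P powr (1 / p) / \<beta> * ?I y)"
      using \<beta> by (intro mult_right_mono mult_nonneg_nonneg infsum_nonneg) (auto simp: C_def)
    finally show "cmod (c y) \<le> C * N powr d * P powr (1 / p) / \<beta> * ?I y" by (simp add: mult_ac)
  qed
qed

end

section \<open>The constants of a doubling graph\<close>

lemma emeasure_count_space_leD:
  assumes "X \<subseteq> V" "emeasure (count_space V) X \<le> ennreal a"
  shows "finite X" and "0 \<le> a \<Longrightarrow> real (card X) \<le> a"
proof -
  show fin: "finite X"
  proof (rule ccontr)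
    assume "infinite X"
    hence "emeasure (count_space V) X = \<infinity>" using assms(1) by (simp add: emeasure_count_space)
    thus False using assms(2) by (simp add: top_unique)
  qed
  show "real (card X) \<le> a" if "0 \<le> a"
    using assms fin that by (simp add: emeasure_count_space ennreal_of_nat_eq_real_of_nat)
qed

lemma gball_0:
  assumes "connected_simple_graph V E" "x \<in> V"
  shows "gball V E x 0 = {x}"
  using assms gdist_eq_0D[OF assms] by (auto simp: gball_def)

text \<open>
  Balls are nonempty, so their size does not tend to zero with growing radius.
\<close>
lemma beurling_dimension_nonneg:
  assumes V: "x \<in> V" and dim: "beurling_dimension V E d"
  shows "0 \<le> d"
proof (rule ccontr)
  assume d: "\<not> 0 \<le> d"
  obtain D where D: "\<And>x r. x \<in> V \<Longrightarrow> 0 \<le> r \<Longrightarrow>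
      emeasure (count_space V) (gball V E x r) \<le> ennreal (D * (r + 1) powr d)"
    using dim unfolding beurling_dimension_def is_minimal_real_def by blast
  define D' where "D' = max 1 D"
  define r where "r = (2 * D') powr (- 1 / d) - 1"
  have "1 \<le> (2 * D') powr (- 1 / d)" using d by (intro ge_one_powr_ge_zero) (auto simp: D'_def field_simps)
  hence r: "0 \<le> r" by (simp add: r_def)
  have rd: "(r + 1) powr d = 1 / (2 * D')"
  proof -
    have "(r + 1) powr d = (2 * D') powr (- 1 / d * d)"
      by (simp only: r_def diff_add_cancel powr_powr)
    also have "- 1 / d * d = - 1" using d by simp
    finally show ?thesis by (simp add: powr_minus_divide D'_def)
  qed
  have sub: "gball V E x r \<subseteq> V" by (auto simp: gball_def)
  have "emeasure (count_space V) (gball V E x r) \<le> ennreal (D' * (r + 1) powr d)"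
    by (rule order_trans[OF D[OF V r]]) (auto simp: D'_def intro!: ennreal_leI mult_right_mono)
  note le = emeasure_count_space_leD[OF sub this]
  have "x \<in> gball V E x r" using V r by (simp add: gball_def)
  hence "1 \<le> card (gball V E x r)" using le(1) by (auto simp: Suc_le_eq card_gt_0_iff)
  moreover have "D' * (r + 1) powr d = 1 / 2" using rd by (simp add: D'_def)
  ultimately show False using le(2) by simp
qed

lemma maximal_disjoint_0:
  assumes "connected_simple_graph V E"
  shows "maximal_disjoint V E 0 V"
  using gball_0[OF assms] by (auto simp: maximal_disjoint_def)

text \<open>
  For \<open>N = 0\<close> and \<open>S = V\<close> the packing estimate is a growth estimate for balls.
\<close>
lemma beurling_le_gen_beurling:
  assumes conn: "connected_simple_graph V E" and dim: "beurling_dimension V E d"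
    and gen: "gen_beurling_dimension V E dt"
  shows "d \<le> dt"
proof -
  obtain D where D: "\<And>R N S. 0 \<le> R \<Longrightarrow> 0 \<le> N \<Longrightarrow> maximal_disjoint V E N S \<Longrightarrow>
       (SUP x\<in>V. emeasure (count_space V) {y \<in> S. real (gdist V E y x) \<le> (N + 1) * R})
         \<le> ennreal (D * (R + 1) powr dt)"
    using gen unfolding gen_beurling_dimension_def is_minimal_real_def by blast
  have "emeasure (count_space V) (gball V E x R) \<le> ennreal (D * (R + 1) powr dt)"
    if x: "x \<in> V" and R: "0 \<le> R" for x R
  proof -
    have "gball V E x R = {y \<in> V. real (gdist V E y x) \<le> (0 + 1) * R}"
      using gdist_commute[OF conn x] by (auto simp: gball_def)
    hence "emeasure (count_space V) (gball V E x R)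
        \<le> (SUP x\<in>V. emeasure (count_space V) {y \<in> V. real (gdist V E y x) \<le> (0 + 1) * R})"
      using x by (auto intro!: SUP_upper2[of x])
    also have "\<dots> \<le> ennreal (D * (R + 1) powr dt)"
      by (rule D[OF R order_refl maximal_disjoint_0[OF conn]])
    finally show ?thesis .
  qed
  thus ?thesis using dim unfolding beurling_dimension_def is_minimal_real_def by blast
qed

lemma doubling_graph_exists:
  assumes conn: "connected_simple_graph V E" and dbl: "doubling V E"
    and dim: "beurling_dimension V E d" and gen: "gen_beurling_dimension V E dt"
  shows "\<exists>D1 D2 D3. doubling_graph V E d dt D1 D2 D3"
proof -
  obtain x0 where x0: "x0 \<in> V" using conn by (auto simp: connected_simple_graph_def)
  obtain D1 where D1: "\<And>x r. x \<in> V \<Longrightarrow> 0 \<le> r \<Longrightarrow>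
      emeasure (count_space V) (gball V E x r) \<le> ennreal (D1 * (r + 1) powr d)"
    using dim unfolding beurling_dimension_def is_minimal_real_def by blast
  obtain D2 where D2: "\<And>R N S. 0 \<le> R \<Longrightarrow> 0 \<le> N \<Longrightarrow> maximal_disjoint V E N S \<Longrightarrow>
       (SUP x\<in>V. emeasure (count_space V) {y \<in> S. real (gdist V E y x) \<le> (N + 1) * R})
         \<le> ennreal (D2 * (R + 1) powr dt)"
    using gen unfolding gen_beurling_dimension_def is_minimal_real_def by blast
  obtain D3 where D3: "0 < D3" "\<And>x r. x \<in> V \<Longrightarrow> 0 < r \<Longrightarrow>
     emeasure (count_space V) (gball V E x (2 * r))
       \<le> ennreal D3 * emeasure (count_space V) (gball V E x r)"
    using dbl unfolding doubling_def by blast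
  have sub: "gball V E x R \<subseteq> V" for x R by (auto simp: gball_def)
  have fin: "finite (gball V E x R)" if x: "x \<in> V" for x R
  proof (cases "0 \<le> R")
    case True thus ?thesis using emeasure_count_space_leD(1)[OF sub D1[OF x True]] by simp
  next
    case False
    hence "gball V E x R = {}" by (auto simp: gball_def)
    thus ?thesis by simp
  qed
  have "doubling_graph V E d dt (max 1 D1) (max 1 D2) (max 1 D3)"
  proof
    fix x R assume x: "x \<in> V" and R: "0 \<le> (R :: real)"
    have "emeasure (count_space V) (gball V E x R) \<le> ennreal (max 1 D1 * (R + 1) powr d)"
      by (rule order_trans[OF D1[OF x R]]) (auto intro!: ennreal_leI mult_right_mono)
    thus "real (card (gball V E x R)) \<le> max 1 D1 * (R + 1) powr d"
      by (rule emeasure_count_space_leD(2)[OF sub]) auto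
  next
    fix N R :: real and S x assume S: "maximal_disjoint V E N S" and N: "0 \<le> N" and R: "0 \<le> R" and x: "x \<in> V"
    let ?X = "\<lambda>x. {y \<in> S. real (gdist V E y x) \<le> (N + 1) * R}"
    have "emeasure (count_space V) (?X x) \<le> (SUP x\<in>V. emeasure (count_space V) (?X x))"
      using x by (rule SUP_upper)
    also have "\<dots> \<le> ennreal (max 1 D2 * (R + 1) powr dt)"
      by (rule order_trans[OF D2[OF R N S]]) (auto intro!: ennreal_leI mult_right_mono)
    finally show "real (card (?X x)) \<le> max 1 D2 * (R + 1) powr dt"
      using S by (intro emeasure_count_space_leD(2)) (auto simp: maximal_disjoint_def)
  next
    fix x R assume x: "x \<in> V" and R: "0 < (R :: real)"
    let ?k = "real (card (gball V E x R))"
    have "emeasure (count_space V) (gball V E x (2 * R)) \<le> ennreal D3 * ennreal ?k"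
      using D3(2)[OF x R] fin[OF x] sub[of x R]
      by (simp add: emeasure_count_space ennreal_of_nat_eq_real_of_nat)
    also have "\<dots> = ennreal (D3 * ?k)" using D3(1) by (simp add: ennreal_mult)
    finally have "real (card (gball V E x (2 * R))) \<le> D3 * ?k"
      using D3(1) by (intro emeasure_count_space_leD(2)[OF sub]) auto
    also have "\<dots> \<le> max 1 D3 * ?k" by (intro mult_right_mono) auto
    finally show "real (card (gball V E x (2 * R))) \<le> max 1 D3 * ?k" .
  qed (use conn fin beurling_dimension_nonneg[OF x0 dim] beurling_le_gen_beurling[OF conn dim gen] in auto)
  thus ?thesis by blast
qed

section \<open>Decay of matrices in the Beurling algebra\<close>

lemma decay_antimono:
  assumes "bdd_above {cmod (A x y) |x y. x \<in> V \<and> y \<in> V}" "m \<le> n"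
  shows "decay V E A n \<le> decay V E A m"
  unfolding decay_def
proof (rule cSup_subset_mono)
  have "bdd_above (insert 0 {cmod (A x y) |x y. x \<in> V \<and> y \<in> V})" using assms(1) by simp
  thus "bdd_above (insert 0 {cmod (A x y) |x y. x \<in> V \<and> y \<in> V \<and> m \<le> gdist V E x y})"
    by (rule bdd_above_mono) auto
  show "insert 0 {cmod (A x y) |x y. x \<in> V \<and> y \<in> V \<and> n \<le> gdist V E x y}
      \<subseteq> insert 0 {cmod (A x y) |x y. x \<in> V \<and> y \<in> V \<and> m \<le> gdist V E x y}"
    using order_trans[OF assms(2)] by blast
qed simp

lemma decay_nonneg:
  assumes "bdd_above {cmod (A x y) |x y. x \<in> V \<and> y \<in> V}"
  shows "0 \<le> decay V E A n"
  unfolding decay_def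
proof (rule cSup_upper)
  have "bdd_above (insert 0 {cmod (A x y) |x y. x \<in> V \<and> y \<in> V})" using assms(1) by simp
  thus "bdd_above (insert 0 {cmod (A x y) |x y. x \<in> V \<and> y \<in> V \<and> n \<le> gdist V E x y})"
    by (rule bdd_above_mono) auto
qed auto

lemma entry_le_decay:
  assumes "bdd_above {cmod (A x y) |x y. x \<in> V \<and> y \<in> V}" "x \<in> V" "y \<in> V"
  shows "cmod (A x y) \<le> decay V E A (gdist V E x y)"
  unfolding decay_def
proof (rule cSup_upper)
  have "bdd_above (insert 0 {cmod (A x y) |x y. x \<in> V \<and> y \<in> V})" using assms(1) by simp
  thus "bdd_above (insert 0 {cmod (A u v) |u v. u \<in> V \<and> v \<in> V \<and> gdist V E x y \<le> gdist V E u v})"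
    by (rule bdd_above_mono) auto
qed (use assms in auto)

text \<open>
  The terms with index between \<open>n/2\<close> and \<open>n\<close> alone contribute about \<open>h(n) n\<^bsup>e+1\<^esup>\<close>.
\<close>
lemma antimono_weighted_sum_bound:
  fixes h :: "nat \<Rightarrow> real"
  assumes anti: "\<And>m n. m \<le> n \<Longrightarrow> h n \<le> h m" and h: "\<And>n. 0 \<le> h n"
    and summ: "summable (\<lambda>n. h n * (real n + 1) powr e)"
  shows "h n * (real n + 1) powr (e + 1) \<le> 2 powr (1 + \<bar>e\<bar>) * (\<Sum>n. h n * (real n + 1) powr e)"
proof -
  let ?N = "real n + 1"
  let ?I = "{n div 2..n}"
  have low: "2 powr (- \<bar>e\<bar>) * ?N powr e \<le> (real k + 1) powr e" if k: "k \<in> ?I" for k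
  proof (cases "0 \<le> e")
    case True
    have "?N / 2 \<le> real k + 1" using k by auto
    hence "(?N / 2) powr e \<le> (real k + 1) powr e" using True by (intro powr_mono2) auto
    thus ?thesis using True by (simp add: powr_divide powr_minus_divide)
  next
    case False
    have "?N powr e \<le> (real k + 1) powr e" using k False by (intro powr_mono2') auto
    moreover have "2 powr (- \<bar>e\<bar>) * ?N powr e \<le> 1 * ?N powr e"
      using powr_mono[of "- \<bar>e\<bar>" 0 2] by (intro mult_right_mono) auto
    ultimately show ?thesis by linarith
  qed
  have card: "?N / 2 \<le> real (card ?I)" by auto
  have "?N / 2 * (h n * (2 powr (- \<bar>e\<bar>) * ?N powr e)) \<le> real (card ?I) * (h n * (2 powr (- \<bar>e\<bar>) * ?N powr e))"
    using h by (intro mult_right_mono card) auto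
  also have "\<dots> = (\<Sum>k\<in>?I. h n * (2 powr (- \<bar>e\<bar>) * ?N powr e))" by simp
  also have "\<dots> \<le> (\<Sum>k\<in>?I. h k * (real k + 1) powr e)"
    using anti h low by (intro sum_mono mult_mono) auto
  also have "\<dots> \<le> (\<Sum>n. h n * (real n + 1) powr e)"
    using h by (intro sum_le_suminf summ) auto
  finally have "?N / 2 * (h n * (2 powr (- \<bar>e\<bar>) * ?N powr e)) \<le> (\<Sum>n. h n * (real n + 1) powr e)" .
  hence "2 powr (1 + \<bar>e\<bar>) * (?N / 2 * (h n * (2 powr (- \<bar>e\<bar>) * ?N powr e)))
      \<le> 2 powr (1 + \<bar>e\<bar>) * (\<Sum>n. h n * (real n + 1) powr e)"
    by (rule mult_left_mono) simp
  moreover have "2 powr (1 + \<bar>e\<bar>) * (?N / 2 * (h n * (2 powr (- \<bar>e\<bar>) * ?N powr e))) = h n * ?N powr (e + 1)"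
    by (simp add: powr_add powr_minus field_simps)
  ultimately show ?thesis by (simp only:)
qed

text \<open>
  For finite \<open>r\<close> the weight in the norm has exponent \<open>\<alpha> r + d - 1\<close>, so \<open>antimono_weighted_sum_bound\<close> for the
  \<open>r\<close>-th powers of the decay profile gives the exponent \<open>(\<alpha> r + d)/r = \<alpha> + d/r\<close>.
\<close>
lemma beurling_decay_bound:
  assumes r: "1 \<le> r"
  obtains C where "1 \<le> C" and "\<And>A. A \<in> beurling_algebra V E d r \<alpha> \<Longrightarrow> 0 \<le> beurling_norm V E d r \<alpha> A"
    and "\<And>A x y. A \<in> beurling_algebra V E d r \<alpha> \<Longrightarrow> x \<in> V \<Longrightarrow> y \<in> V \<Longrightarrow>
      cmod (A x y) \<le> C * beurling_norm V E d r \<alpha> A * (1 + real (gdist V E x y)) powr (- (\<alpha> + d * inv_exp r))"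
proof (cases r)
  case PInf
  show thesis
  proof (rule that[of 1])
    fix A assume A: "A \<in> beurling_algebra V E d r \<alpha>"
    hence bdd: "bdd_above {cmod (A x y) |x y. x \<in> V \<and> y \<in> V}"
      and bdd2: "bdd_above (range (\<lambda>n. decay V E A n * (real n + 1) powr \<alpha>))"
      using PInf by (auto simp: beurling_algebra_def)
    have norm: "decay V E A n * (real n + 1) powr \<alpha> \<le> beurling_norm V E d r \<alpha> A" for n
      unfolding beurling_norm_def using PInf bdd2 by (auto intro: cSUP_upper)
    have "0 \<le> decay V E A 0 * (real 0 + 1) powr \<alpha>" using decay_nonneg[OF bdd] by simp
    thus "0 \<le> beurling_norm V E d r \<alpha> A" using norm[of 0] by linarith
    fix x y assume xy: "x \<in> V" "y \<in> V"
    have "cmod (A x y) \<le> decay V E A (gdist V E x y)" by (rule entry_le_decay[OF bdd xy])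
    also have "\<dots> \<le> beurling_norm V E d r \<alpha> A * (1 + real (gdist V E x y)) powr (- \<alpha>)"
      using norm[of "gdist V E x y"] by (simp add: powr_minus_divide pos_le_divide_eq add.commute)
    finally show "cmod (A x y) \<le> 1 * beurling_norm V E d r \<alpha> A
        * (1 + real (gdist V E x y)) powr (- (\<alpha> + d * inv_exp r))"
      using PInf by (simp add: inv_exp_def)
  qed auto
next
  case (real \<rho>)
  have \<rho>: "1 \<le> \<rho>" using r real by simp
  define e where "e = \<alpha> * \<rho> + d - 1"
  have inv: "inv_exp r = 1 / \<rho>" using real \<rho> by (simp add: inv_exp_def one_ereal_def)
  show thesis
  proof (rule that[of "(2 powr (1 + \<bar>e\<bar>)) powr (1 / \<rho>)"])
    show "1 \<le> (2 powr (1 + \<bar>e\<bar>)) powr (1 / \<rho>)"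
      using \<rho> by (intro ge_one_powr_ge_zero) (auto intro: ge_one_powr_ge_zero)
    fix A assume A: "A \<in> beurling_algebra V E d r \<alpha>"
    hence bdd: "bdd_above {cmod (A x y) |x y. x \<in> V \<and> y \<in> V}"
      and summ: "summable (\<lambda>n. decay V E A n powr \<rho> * (real n + 1) powr e)"
      using real by (auto simp: beurling_algebra_def e_def)
    define Z where "Z = (\<Sum>n. decay V E A n powr \<rho> * (real n + 1) powr e)"
    have norm: "beurling_norm V E d r \<alpha> A = Z powr (1 / \<rho>)"
      using real by (simp add: beurling_norm_def Z_def e_def)
    show "0 \<le> beurling_norm V E d r \<alpha> A" by (simp add: norm)
    fix x y assume xy: "x \<in> V" "y \<in> V"
    let ?n = "gdist V E x y"
    let ?h = "decay V E A ?n"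
    have h0: "0 \<le> ?h" by (rule decay_nonneg[OF bdd])
    have "?h powr \<rho> * (real ?n + 1) powr (e + 1) \<le> 2 powr (1 + \<bar>e\<bar>) * Z"
      unfolding Z_def using decay_antimono[OF bdd] decay_nonneg[OF bdd] \<rho>
      by (intro antimono_weighted_sum_bound[where h = "\<lambda>n. decay V E A n powr \<rho>"] summ powr_mono2) auto
    hence "(?h powr \<rho> * (real ?n + 1) powr (e + 1)) powr (1 / \<rho>) \<le> (2 powr (1 + \<bar>e\<bar>) * Z) powr (1 / \<rho>)"
      using \<rho> by (intro powr_mono2) auto
    moreover have "(?h powr \<rho> * (real ?n + 1) powr (e + 1)) powr (1 / \<rho>)
        = ?h * (1 + real ?n) powr (\<alpha> + d * inv_exp r)"
    proof -
      have "(e + 1) * (1 / \<rho>) = \<alpha> + d * inv_exp r" using \<rho> by (simp add: e_def inv field_simps)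
      thus ?thesis using h0 \<rho> by (simp add: powr_mult powr_powr add.commute)
    qed
    ultimately have "?h * (1 + real ?n) powr (\<alpha> + d * inv_exp r)
        \<le> (2 powr (1 + \<bar>e\<bar>)) powr (1 / \<rho>) * beurling_norm V E d r \<alpha> A"
      by (simp add: powr_mult norm)
    hence "?h \<le> (2 powr (1 + \<bar>e\<bar>)) powr (1 / \<rho>) * beurling_norm V E d r \<alpha> A
        * (1 + real ?n) powr (- (\<alpha> + d * inv_exp r))"
      unfolding powr_minus_divide by (subst times_divide_eq_right, subst pos_le_divide_eq) auto
    thus "cmod (A x y) \<le> (2 powr (1 + \<bar>e\<bar>)) powr (1 / \<rho>) * beurling_norm V E d r \<alpha> A
        * (1 + real ?n) powr (- (\<alpha> + d * inv_exp r))"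
      using entry_le_decay[OF bdd xy, of E] by linarith
  qed
qed (use r in auto)

section \<open>Muckenhoupt weights\<close>

context doubling_graph
begin

lemma measure_ball: "x \<in> V \<Longrightarrow> measure (count_space V) (B x R) = real (card (B x R))"
  using finite_ball[of x R] ball_subset_V[of x R] by (simp add: measure_count_space)

text \<open>
  For \<open>p > 1\<close> this is Hoelder's inequality for \<open>f = (f w\<^bsup>1/p\<^esup>) w\<^bsup>-1/p\<^esup>\<close>, obtained here from Jensen's
  inequality for the probability weights \<open>\<sigma>/Z\<close> with \<open>\<sigma> = w\<^bsup>-1/(p-1)\<^esup>\<close>. For \<open>p = 1\<close> the average of \<open>w\<close> is
  bounded by \<open>C w(y)\<close> at every point \<open>y\<close> of the ball.
\<close>
lemma Ap_condition_inequality: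
  assumes p: "1 \<le> p" and w: "\<And>x. x \<in> V \<Longrightarrow> 0 < w x" and C: "Ap_condition V E p w C"
    and x: "x \<in> V" and R: "0 \<le> R" and f: "\<And>y. y \<in> V \<Longrightarrow> 0 \<le> f y"
  shows "(\<Sum>y\<in>B x R. w y) * (\<Sum>y\<in>B x R. f y) powr p
    \<le> C * real (card (B x R)) powr p * (\<Sum>y\<in>B x R. f y powr p * w y)"
proof -
  define X where "X = B x R"
  have X: "finite X" "x \<in> X" "X \<subseteq> V" using finite_ball[OF x] center_in_ball[OF x R] ball_subset_V by (auto
      simp: X_def)
  define k where "k = real (card X)"
  have k: "0 < k" using X by (auto simp: k_def card_gt_0_iff)
  have C0: "0 < C" using C by (simp add: Ap_condition_def)
  have avg: "ball_avg V E u x R = sum u X / k" for u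
    by (simp add: ball_avg_def measure_ball[OF x] X_def k_def)
  have wX: "0 < w y" "0 \<le> f y" if "y \<in> X" for y using that X w f by auto
  show ?thesis
  proof (cases "p = 1")
    case True
    have "ball_avg V E w x R \<le> C * (INF y\<in>X. w y)"
      using C x R True by (simp add: Ap_condition_def X_def)
    hence W: "sum w X \<le> k * C * w y" if "y \<in> X" for y
    proof -
      have "(INF y\<in>X. w y) \<le> w y" using X that by (intro cINF_lower bdd_below_finite) auto
      hence "sum w X / k \<le> C * w y"
        using \<open>ball_avg V E w x R \<le> C * (INF y\<in>X. w y)\<close> C0 unfolding avg
        by (meson less_imp_le mult_left_mono order_trans)
      thus ?thesis using k by (simp add: field_simps)
    qed
    have "sum w X * sum f X = (\<Sum>y\<in>X. sum w X * f y)" by (simp add: sum_distrib_left)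
    also have "\<dots> \<le> (\<Sum>y\<in>X. k * C * w y * f y)"
      using W wX by (intro sum_mono mult_right_mono) auto
    also have "\<dots> = C * k * (\<Sum>y\<in>X. f y * w y)" by (simp add: sum_distrib_left mult_ac)
    also have "(\<Sum>y\<in>X. f y * w y) = (\<Sum>y\<in>X. f y powr p * w y)"
      using wX True by (intro sum.cong) auto
    finally show ?thesis using True k wX by (simp add: X_def[symmetric] k_def[symmetric] sum_nonneg)
  next
    case False
    hence p1: "1 < p" using p by simp
    define \<sigma> where "\<sigma> y = w y powr (- 1 / (p - 1))" for y
    define Z where "Z = sum \<sigma> X"
    have \<sigma>: "0 < \<sigma> y" if "y \<in> X" for y using wX(1)[OF that] by (simp add: \<sigma>_def)
    have Z: "0 < Z" unfolding Z_def using X \<sigma> by (intro sum_pos) auto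
    have cond: "sum w X / k * (Z / k) powr (p - 1) \<le> C"
    proof -
      have "ball_avg V E w x R * ball_avg V E \<sigma> x R powr (p - 1) \<le> C"
        using C x R False by (simp add: Ap_condition_def \<sigma>_def[abs_def])
      thus ?thesis by (simp only: avg Z_def)
    qed
    have "(\<Sum>y\<in>X. \<sigma> y / Z * (f y * Z / \<sigma> y)) powr p \<le> (\<Sum>y\<in>X. \<sigma> y / Z * (f y * Z / \<sigma> y) powr p)"
      using p X \<sigma> Z wX by (intro sum_powr_jensen)
        (auto simp: less_imp_le Z_def[symmetric] sum_divide_distrib[symmetric])
    also have "(\<Sum>y\<in>X. \<sigma> y / Z * (f y * Z / \<sigma> y)) = sum f X"
      using \<sigma> Z by (intro sum.cong) (auto simp: less_imp_neq[symmetric] field_simps)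
    also have "(\<Sum>y\<in>X. \<sigma> y / Z * (f y * Z / \<sigma> y) powr p) = (\<Sum>y\<in>X. Z powr (p - 1) * (f y powr p * w y))"
    proof (rule sum.cong)
      fix y assume y: "y \<in> X"
      have "\<sigma> y / Z * (f y * Z / \<sigma> y) powr p
          = (\<sigma> y powr 1 / \<sigma> y powr p) * (Z powr p / Z powr 1) * f y powr p"
        using \<sigma>[OF y] Z by (simp add: powr_mult powr_divide mult_ac)
      also have "\<sigma> y powr 1 / \<sigma> y powr p = \<sigma> y powr (1 - p)" by (simp only: powr_diff)
      also have "\<dots> = w y"
      proof -
        have "- 1 / (p - 1) * (1 - p) = 1" using p1 by (simp add: field_simps)
        thus ?thesis using wX(1)[OF y] by (simp add: \<sigma>_def powr_powr)
      qed
      also have "Z powr p / Z powr 1 = Z powr (p - 1)" by (simp only: powr_diff)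
      finally show "\<sigma> y / Z * (f y * Z / \<sigma> y) powr p = Z powr (p - 1) * (f y powr p * w y)"
        by (simp add: mult_ac)
    qed auto
    finally have "sum f X powr p \<le> Z powr (p - 1) * (\<Sum>y\<in>X. f y powr p * w y)"
      by (simp add: sum_distrib_left)
    moreover have W0: "0 \<le> sum w X" using wX by (intro sum_nonneg) (auto simp: less_imp_le)
    ultimately have "sum w X * sum f X powr p
        \<le> sum w X * (Z powr (p - 1) * (\<Sum>y\<in>X. f y powr p * w y))"
      by (intro mult_left_mono)
    also have "\<dots> = (sum w X * Z powr (p - 1)) * (\<Sum>y\<in>X. f y powr p * w y)" by (simp add: mult_ac)
    also have "\<dots> \<le> (C * k powr p) * (\<Sum>y\<in>X. f y powr p * w y)"
    proof (rule mult_right_mono)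
      have "sum w X * Z powr (p - 1) = sum w X / k * (Z / k) powr (p - 1) * (k powr 1 * k powr (p - 1))"
        using k by (simp add: powr_divide)
      also have "k powr 1 * k powr (p - 1) = k powr p" by (simp only: powr_add[symmetric]) simp
      also have "sum w X / k * (Z / k) powr (p - 1) * k powr p \<le> C * k powr p"
        by (rule mult_right_mono[OF cond]) simp
      finally show "sum w X * Z powr (p - 1) \<le> C * k powr p" .
      show "0 \<le> (\<Sum>y\<in>X. f y powr p * w y)" using wX by (intro sum_nonneg) (auto simp: less_imp_le)
    qed
    finally show ?thesis by (simp add: X_def k_def)
  qed
qed

lemma Ap_condition_ge_1:
  assumes p: "1 \<le> p" and w: "\<And>x. x \<in> V \<Longrightarrow> 0 < w x" and C: "Ap_condition V E p w C"
  shows "1 \<le> C"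
proof -
  obtain x where x: "x \<in> V" using conn by (auto simp: connected_simple_graph_def)
  have "w x \<le> C * w x"
    using Ap_condition_inequality[OF p w C x order_refl, of "\<lambda>_. 1"] by (simp add: gball_0[OF conn x])
  thus ?thesis using w[OF x] by simp
qed

text \<open>
  The inequality is linear in the constant, so it holds with the infimum of all admissible constants.
\<close>
lemma Ap_weight_muckenhoupt:
  assumes p: "1 \<le> p" and w: "Ap_weight V E p w"
  shows "muckenhoupt p w (Ap_bound V E p w)"
proof -
  have w0: "\<And>x. x \<in> V \<Longrightarrow> 0 < w x" using w by (simp add: Ap_weight_def)
  let ?S = "{C. Ap_condition V E p w C}"
  have ne: "?S \<noteq> {}" using w by (auto simp: Ap_weight_def)
  have "1 \<le> Ap_bound V E p w"
    unfolding Ap_bound_def using ne Ap_condition_ge_1[OF p w0] by (intro cInf_greatest) auto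
  moreover have "(\<Sum>y\<in>B x R. w y) * (\<Sum>y\<in>B x R. f y) powr p
      \<le> Ap_bound V E p w * real (card (B x R)) powr p * (\<Sum>y\<in>B x R. f y powr p * w y)"
    if x: "x \<in> V" and R: "0 \<le> R" and f: "\<forall>y\<in>V. 0 \<le> f y" for x R f
  proof -
    define L where "L = (\<Sum>y\<in>B x R. w y) * (\<Sum>y\<in>B x R. f y) powr p"
    define Y where "Y = real (card (B x R)) powr p * (\<Sum>y\<in>B x R. f y powr p * w y)"
    have le: "L \<le> C * Y" if "C \<in> ?S" for C
      using Ap_condition_inequality[where C = C and f = f, OF p w0 _ x R] that f by (simp add: L_def Y_def
          mult.assoc)
    have "0 \<le> (\<Sum>y\<in>B x R. f y powr p * w y)"
      using w0 by (intro sum_nonneg) (auto simp: mem_ball less_imp_le)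
    hence Y: "0 \<le> Y" by (simp add: Y_def)
    have "L \<le> Ap_bound V E p w * Y"
    proof (cases "Y = 0")
      case True
      thus ?thesis using le ne by auto
    next
      case False
      hence Y: "0 < Y" using Y by simp
      have "L / Y \<le> Ap_bound V E p w"
        unfolding Ap_bound_def using ne le Y by (intro cInf_greatest) (auto simp: field_simps)
      thus ?thesis using Y by (simp add: field_simps)
    qed
    thus ?thesis by (simp add: L_def Y_def mult.assoc)
  qed
  ultimately show ?thesis unfolding muckenhoupt_def using p w0 by blast
qed

end

section \<open>Optimal lower stability bounds\<close>

lemma lpw_norm_nonneg [simp]: "0 \<le> lpw_norm V p w c"
  by (simp add: lpw_norm_def)

lemma lpw_unit_vector:
  assumes x: "x \<in> V" and w: "0 < w x" and p: "1 \<le> p"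
  shows "(\<lambda>y. if y = x then 1 else 0) \<in> lpw V p w"
    and "0 < lpw_norm V p w (\<lambda>y. if y = x then 1 else 0)"
proof -
  let ?f = "\<lambda>y. cmod (if y = x then 1 else 0) powr p * w y"
  have z: "?f y = 0" if "y \<in> V - {x}" for y using that by simp
  have "?f summable_on {x}" by simp
  also have "?f summable_on {x} \<longleftrightarrow> ?f summable_on V"
    by (rule summable_on_cong_neutral) (use z x in auto)
  finally show "(\<lambda>y. if y = x then 1 else 0) \<in> lpw V p w" by (simp add: lpw_def)
  have "infsum ?f V = infsum ?f {x}" by (rule infsum_cong_neutral) (use z x in auto)
  thus "0 < lpw_norm V p w (\<lambda>y. if y = x then 1 else 0)" using w by (simp add: lpw_norm_def)
qed

text \<open>
  The supremum that defines the optimal bound is attained. It is finite because the unit vector at a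
  vertex has positive norm.
\<close>
lemma stability_bound_props:
  assumes x: "x \<in> V" and w: "0 < w x" and p: "1 \<le> p" and st: "lpw_stable V p w A"
  shows "0 < stability_bound V p w A"
    and "c \<in> lpw V p w \<Longrightarrow> stability_bound V p w A * lpw_norm V p w c \<le> lpw_norm V p w (mat_apply V A c)"
    and "0 < b \<Longrightarrow> (\<And>c. c \<in> lpw V p w \<Longrightarrow> b * lpw_norm V p w c \<le> lpw_norm V p w (mat_apply V A c))
      \<Longrightarrow> b \<le> stability_bound V p w A"
proof -
  define S where "S = {b. b > 0 \<and> (\<forall>c\<in>lpw V p w. b * lpw_norm V p w c \<le> lpw_norm V p w (mat_apply V A c))}"
  have sb: "stability_bound V p w A = Sup S" by (simp add: stability_bound_def S_def)
  obtain b0 where b0: "b0 \<in> S" using st by (auto simp: lpw_stable_def S_def)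
  have quot: "b \<le> lpw_norm V p w (mat_apply V A c) / lpw_norm V p w c"
    if "b \<in> S" "c \<in> lpw V p w" "0 < lpw_norm V p w c" for b c
    using that by (simp add: S_def field_simps)
  note e = lpw_unit_vector[where w = w, OF x w p]
  have bdd: "bdd_above S" by (rule bdd_aboveI) (rule quot[OF _ e])
  show upper: "b \<le> stability_bound V p w A"
    if "0 < b" "\<And>c. c \<in> lpw V p w \<Longrightarrow> b * lpw_norm V p w c \<le> lpw_norm V p w (mat_apply V A c)" for b
    unfolding sb by (rule cSup_upper[OF _ bdd]) (use that in \<open>auto simp: S_def\<close>)
  show "0 < stability_bound V p w A"
    unfolding sb using cSup_upper[OF b0 bdd] b0 by (auto simp: S_def)
  show "stability_bound V p w A * lpw_norm V p w c \<le> lpw_norm V p w (mat_apply V A c)"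
    if c: "c \<in> lpw V p w"
  proof (cases "lpw_norm V p w c = 0")
    case False
    hence n: "0 < lpw_norm V p w c" using lpw_norm_nonneg[of V p w c] by linarith
    have "Sup S \<le> lpw_norm V p w (mat_apply V A c) / lpw_norm V p w c"
      using b0 quot[OF _ c n] by (intro cSup_least) auto
    thus ?thesis using n by (simp add: sb field_simps)
  qed simp
qed

section \<open>Comparison of stability bounds\<close>

context doubling_graph
begin

text \<open>
  The quantity \<open>x = P\<^bsup>2/p\<^esup> M / \<beta>\<close> is bounded below because the boundedness of \<open>A\<close> on \<open>\<ell>\<^sup>p\<^sub>w\<close> bounds \<open>\<beta>\<close>
  above. The scale \<open>N\<close> is the smallest, up to a constant, for which \<open>stable_kernel_bound\<close> applies; then
  \<open>kernel_dominated_lpw\<close> in \<open>\<ell>\<^sup>q\<^bsub>w'\<^esub>\<close> contributes the second factor \<open>N\<^sup>d\<close>.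
\<close>
lemma stability_transfer:
  assumes s: "0 < s" "s \<le> 1" "s < g - d" and g: "dt < g"
  obtains C where "1 \<le> C" and "\<And>p q w w' P Q A M.
    \<lbrakk>muckenhoupt p w P; muckenhoupt q w' Q; 0 \<le> M;
     \<And>x y. x \<in> V \<Longrightarrow> y \<in> V \<Longrightarrow> cmod (A x y) \<le> M * K 1 g x y; lpw_stable V p w A\<rbrakk>
    \<Longrightarrow> 0 < stability_bound V p w A
      \<and> 1 \<le> C * (P powr (2 / p) * M / stability_bound V p w A)
      \<and> lpw_stable V q w' A
      \<and> stability_bound V p w A / stability_bound V q w' A
        \<le> C * Q powr (1 / q) * P powr (1 / p) * (C * (P powr (2 / p) * M / stability_bound V p w A)) powr
            (2 * d / s)"
proof -
  have gd: "d < g" using s by simp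
  obtain C0 where C0: "1 \<le> C0" and dom1: "\<And>p w P N v x. \<lbrakk>muckenhoupt p w P; 1 \<le> N; v \<in> lpw V p w; x \<in> V\<rbrakk>
      \<Longrightarrow> (\<lambda>y. K N g x y * cmod (v y)) summable_on V"
    and dom2: "\<And>p w P N v u L. \<lbrakk>muckenhoupt p w P; 1 \<le> N; v \<in> lpw V p w; 0 \<le> L;
        \<And>x. x \<in> V \<Longrightarrow> cmod (u x) \<le> L * (\<Sum>\<^sub>\<infinity>y\<in>V. K N g x y * cmod (v y))\<rbrakk>
      \<Longrightarrow> u \<in> lpw V p w \<and> lpw_norm V p w u \<le> L * (P powr (1 / p) * (C0 * N powr d)) * lpw_norm V p w v"
  proof (rule kernel_dominated_lpw[OF gd], goal_cases)
    case (1 C)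
    show ?case by (rule 1(1)[OF 1(2-)])
  qed
  obtain C1 where C1: "1 \<le> C1" and ker: "\<And>p w P A M \<beta> N c y. \<lbrakk>muckenhoupt p w P; 1 \<le> N; 0 \<le> M;
      \<And>x y. x \<in> V \<Longrightarrow> y \<in> V \<Longrightarrow> cmod (A x y) \<le> M * K 1 g x y; 0 < \<beta>;
      \<And>c. c \<in> lpw V p w \<Longrightarrow> \<beta> * lpw_norm V p w c \<le> lpw_norm V p w (mat_apply V A c);
      \<And>N x. 1 \<le> N \<Longrightarrow> x \<in> V \<Longrightarrow> (\<lambda>y. K N g x y * cmod (c y)) summable_on V;
      \<And>N x. 1 \<le> N \<Longrightarrow> x \<in> V \<Longrightarrow> (\<lambda>y. K N g x y * cmod (mat_apply V A c y)) summable_on V;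
      C1 * (P powr (2 / p) * M * N powr (- s)) \<le> \<beta>; y \<in> V\<rbrakk>
    \<Longrightarrow> cmod (c y) \<le> C1 * N powr d * P powr (1 / p) / \<beta> * (\<Sum>\<^sub>\<infinity>z\<in>V. K N g y z * cmod (mat_apply V A c z))"
  proof (rule stable_kernel_bound[OF s g], goal_cases)
    case (1 C)
    show ?case by (rule 1(1)[OF 1(2-)])
  qed
  define C where "C = C0 * C1"
  have C: "1 \<le> C" using C0 C1 mult_mono[of 1 C0 1 C1] by (simp add: C_def)
  obtain x0 where x0: "x0 \<in> V" using conn by (auto simp: connected_simple_graph_def)
  show thesis
  proof (rule that[OF C])
    fix p q P Q M :: real and w w' A
    assume mu: "muckenhoupt p w P" and mu': "muckenhoupt q w' Q" and M: "0 \<le> M"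
      and A: "\<And>x y. x \<in> V \<Longrightarrow> y \<in> V \<Longrightarrow> cmod (A x y) \<le> M * K 1 g x y" and st: "lpw_stable V p w A"
    note p = muckenhoupt_basic(1)[OF mu] and P = muckenhoupt_basic(2)[OF mu]
      and w = muckenhoupt_basic(3)[OF mu]
    note q = muckenhoupt_basic(1)[OF mu'] and Q = muckenhoupt_basic(2)[OF mu']
      and w' = muckenhoupt_basic(3)[OF mu']
    define \<beta> where "\<beta> = stability_bound V p w A"
    note sb = stability_bound_props[where w = w, OF x0 w[OF x0] p st, folded \<beta>_def]
    have \<beta>: "0 < \<beta>" by (rule sb(1))
    have upper: "mat_apply V A c \<in> lpw V p w
        \<and> lpw_norm V p w (mat_apply V A c) \<le> M * (P powr (1 / p) * C0) * lpw_norm V p w c"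
      if mu: "muckenhoupt p w P" and c: "c \<in> lpw V p w" for p w P c
      using dom2[OF mu order_refl c M, of "mat_apply V A c"] matrix_row_summable(2)[OF A _ dom1[OF mu
          order_refl c]]
      by simp
    define x where "x = P powr (2 / p) * M / \<beta>"
    have C0x: "1 \<le> C0 * x"
    proof -
      note e = lpw_unit_vector[where w = w, OF x0 w[OF x0] p]
      let ?e = "\<lambda>y. if y = x0 then 1 else 0 :: complex"
      have "\<beta> * lpw_norm V p w ?e \<le> M * (P powr (1 / p) * C0) * lpw_norm V p w ?e"
        using sb(2)[OF e(1)] upper[OF mu e(1)] by linarith
      hence "\<beta> \<le> M * (P powr (1 / p) * C0)" using e(2) by (simp add: mult_le_cancel_right)
      also have "\<dots> \<le> M * (P powr (2 / p) * C0)"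
        using M P p C0 by (intro mult_left_mono mult_right_mono powr_mono divide_right_mono) auto
      finally show ?thesis using \<beta> by (simp add: x_def field_simps)
    qed
    have x: "0 < x"
    proof -
      have "0 < C0 * x" using C0x by linarith
      thus ?thesis using C0 by (simp add: zero_less_mult_iff)
    qed
    have Cx: "1 \<le> C * x" "C1 * x \<le> C * x"
    proof -
      show "1 \<le> C * x" using mult_mono[OF C0x C1] C0x by (simp add: C_def mult_ac)
      show "C1 * x \<le> C * x" using C0 C1 x mult_right_mono[of 1 C0 "C1 * x"] by (simp add: C_def mult_ac)
    qed
    define N where "N = (C * x) powr (1 / s)"
    have N: "1 \<le> N" unfolding N_def using Cx s by (intro ge_one_powr_ge_zero) auto
    have Ns: "N powr (- s) = 1 / (C * x)"
      using s Cx by (simp add: N_def powr_powr powr_minus_divide)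
    have small: "C1 * (P powr (2 / p) * M * N powr (- s)) \<le> \<beta>"
    proof -
      have "C1 * (P powr (2 / p) * M * N powr (- s)) = C1 * x * N powr (- s) * \<beta>"
        using \<beta> by (simp add: x_def)
      also have "\<dots> = C1 * x / (C * x) * \<beta>" by (simp add: Ns)
      also have "\<dots> \<le> 1 * \<beta>"
      proof (rule mult_right_mono)
        show "C1 * x / (C * x) \<le> 1" using Cx by (subst divide_le_eq_1_pos) linarith+
      qed (use \<beta> in simp)
      finally show ?thesis by simp
    qed
    define L where "L = C1 * N powr d * P powr (1 / p) / \<beta>"
    define T where "T = L * (Q powr (1 / q) * (C0 * N powr d))"
    have L: "0 < L" using C1 N P \<beta> by (auto simp: L_def intro!: divide_pos_pos mult_pos_pos)
    have T: "0 < T" unfolding T_def using L Q C0 N by (auto intro!: mult_pos_pos)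
    have lower: "lpw_norm V q w' c \<le> T * lpw_norm V q w' (mat_apply V A c)" if c: "c \<in> lpw V q w'" for c
    proof -
      have Ac: "mat_apply V A c \<in> lpw V q w'" using upper[OF mu' c] by blast
      have "cmod (c y) \<le> L * (\<Sum>\<^sub>\<infinity>z\<in>V. K N g y z * cmod (mat_apply V A c z))" if "y \<in> V" for y
        unfolding L_def
        by (rule ker[OF mu N M A \<beta> sb(2) dom1[OF mu' _ c] dom1[OF mu' _ Ac] small that])
      thus ?thesis using dom2[OF mu' N Ac less_imp_le[OF L]] by (simp add: T_def)
    qed
    have lower': "1 / T * lpw_norm V q w' c \<le> lpw_norm V q w' (mat_apply V A c)" if "c \<in> lpw V q w'" for c
      using lower[OF that] T by (simp add: field_simps)
    let ?U = "M * (Q powr (1 / q) * C0) + 1"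
    have U: "0 < ?U" using M C0 by (intro add_nonneg_pos mult_nonneg_nonneg) auto
    have st': "lpw_stable V q w' A"
      unfolding lpw_stable_def
    proof (rule exI[of _ "1 / T"], intro conjI, goal_cases)
      case 2
      show ?case
      proof (rule exI[of _ ?U], intro conjI ballI U)
        fix c assume c: "c \<in> lpw V q w'"
        show "(\<lambda>y. A x y * c y) summable_on V" if "x \<in> V" for x
          by (rule abs_summable_summable[OF matrix_row_summable(1)[OF A that dom1[OF mu' order_refl c that]]])
        show "mat_apply V A c \<in> lpw V q w'" using upper[OF mu' c] by blast
        show "1 / T * lpw_norm V q w' c \<le> lpw_norm V q w' (mat_apply V A c)" by (rule lower'[OF c])
        have "M * (Q powr (1 / q) * C0) * lpw_norm V q w' c \<le> ?U * lpw_norm V q w' c"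
          by (intro mult_right_mono) auto
        thus "lpw_norm V q w' (mat_apply V A c) \<le> ?U * lpw_norm V q w' c"
          using upper[OF mu' c] by linarith
      qed
    qed (use T in auto)
    note sb' = stability_bound_props[where w = w', OF x0 w'[OF x0] q st']
    have "1 / T \<le> stability_bound V q w' A" using T lower' by (intro sb'(3)) auto
    hence "\<beta> / stability_bound V q w' A \<le> \<beta> / (1 / T)"
      using T \<beta> sb'(1) by (intro divide_left_mono) (auto intro!: divide_pos_pos)
    also have "\<dots> = C * Q powr (1 / q) * P powr (1 / p) * (N powr d * N powr d)"
      using \<beta> by (simp add: T_def L_def C_def)
    also have "N powr d * N powr d = (C * x) powr (2 * d / s)"
      by (simp add: N_def powr_powr flip: powr_add)
    finally show "0 < stability_bound V p w A
      \<and> 1 \<le> C * (P powr (2 / p) * M / stability_bound V p w A)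
      \<and> lpw_stable V q w' A
      \<and> stability_bound V p w A / stability_bound V q w' A
        \<le> C * Q powr (1 / q) * P powr (1 / p) * (C * (P powr (2 / p) * M / stability_bound V p w A)) powr
            (2 * d / s)"
      using \<beta> Cx(1) st' unfolding \<beta>_def[symmetric] x_def by blast
  qed
qed

end

theorem theorem3p1:
  fixes V :: "'v set" and E :: "'v set set"
    and r :: ereal and p q \<alpha> d dt :: real
  assumes "1 \<le> r" and "1 \<le> p" and "1 \<le> q"
    and "connected_simple_graph V E" and "doubling V E"
    and "beurling_dimension V E d" and "gen_beurling_dimension V E dt"
    and "\<alpha> > dt - d * inv_exp r"
  shows
    "(\<forall>w w' A. Ap_weight V E p w \<and> Ap_weight V E q w' \<and> A \<in> beurling_algebra V E d r \<alpha> \<and>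
        lpw_stable V p w A \<longrightarrow>
        lpw_stable V q w' A \<and>
        (\<forall>c\<in>lpw V q w'. stability_bound V q w' A * lpw_norm V q w' c
                            \<le> lpw_norm V q w' (mat_apply V A c))) \<and>
     (\<exists>C>0. \<forall>w w' A. Ap_weight V E p w \<and> Ap_weight V E q w' \<and> A \<in> beurling_algebra V E d r \<alpha> \<and>
        lpw_stable V p w A \<longrightarrow>
        (let x = Ap_bound V E p w powr (2 / p) * beurling_norm V E d r \<alpha> A
                   / stability_bound V p w A
         in stability_bound V p w A / stability_bound V q w' A
            \<le> C * Ap_bound V E q w' powr (1 / q) * Ap_bound V E p w powr (1 / p)
               * x powr ((dt + d + 1) / min 1 (\<alpha> - d * inv_conj_exp r))
               * (if \<alpha> \<noteq> 1 + d * inv_conj_exp r then 1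
                  else ln (1 + x) powr ((2 * d + 1) * inv_conj_exp r))))"
proof -
  note r = assms(1) and p = assms(2) and q = assms(3) and conn = assms(4)
  obtain D1 D2 D3 where "doubling_graph V E d dt D1 D2 D3"
    using doubling_graph_exists[OF assms(4-7)] by blast
  then interpret doubling_graph V E d dt D1 D2 D3 .
  obtain x0 where x0: "x0 \<in> V" using conn by (auto simp: connected_simple_graph_def)
  define g where "g = \<alpha> + d * inv_exp r"
  have g: "dt < g" using assms(8) by (simp add: g_def)
  define \<kappa> where "\<kappa> = min 1 (\<alpha> - d * inv_conj_exp r)"
  have gd: "\<alpha> - d * inv_conj_exp r = g - d" by (simp add: g_def inv_conj_exp_def algebra_simps)
  have \<kappa>: "0 < \<kappa>" "\<kappa> \<le> 1" "\<kappa> \<le> g - d" using g const_bounds by (auto simp: \<kappa>_def gd)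
  \<comment> \<open>Any \<open>s\<close> with \<open>2 d \<kappa> / (2 d + 1) \<le> s < \<kappa>\<close> and \<open>s > 0\<close> serves: the upper bound is what
    \<open>local_stability\<close> asks for, the lower one keeps \<open>2 d / s\<close> below the required exponent. The summand
    \<open>1 / 2\<close> makes both strict and covers \<open>d = 0\<close>.\<close>
  define s where "s = \<kappa> * ((2 * d + 1 / 2) / (2 * d + 1))"
  have "(2 * d + 1 / 2) / (2 * d + 1) < 1" using const_bounds by (simp add: divide_less_eq)
  hence "s < \<kappa> * 1" unfolding s_def using \<kappa> by (intro mult_strict_left_mono)
  moreover have "0 < s"
    unfolding s_def using \<kappa> const_bounds by (intro mult_pos_pos divide_pos_pos add_nonneg_pos) auto
  ultimately have s: "0 < s" "s \<le> 1" "s < g - d" using \<kappa> by auto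
  define e where "e = (dt + d + 1) / \<kappa>"
  have e: "2 * d / s \<le> e"
  proof -
    have "2 * d / s = 2 * d * (2 * d + 1) / (2 * d + 1 / 2) / \<kappa>"
      using const_bounds \<kappa> by (simp add: s_def)
    also have "2 * d * (2 * d + 1) / (2 * d + 1 / 2) \<le> 2 * d + 1"
      using const_bounds by (simp add: divide_le_eq algebra_simps)
    also have "(2 * d + 1) / \<kappa> \<le> e"
      unfolding e_def using const_bounds \<kappa> by (intro divide_right_mono) auto
    finally show ?thesis using \<kappa> by (simp add: divide_right_mono)
  qed
  obtain C1 where C1: "1 \<le> C1"
    and norm0: "\<And>A. A \<in> beurling_algebra V E d r \<alpha> \<Longrightarrow> 0 \<le> beurling_norm V E d r \<alpha> A"
    and entry: "\<And>A x y. A \<in> beurling_algebra V E d r \<alpha> \<Longrightarrow> x \<in> V \<Longrightarrow> y \<in> V \<Longrightarrow>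
      cmod (A x y) \<le> C1 * beurling_norm V E d r \<alpha> A * (1 + real (gdist V E x y)) powr (- (\<alpha> + d * inv_exp r))"
  proof (rule beurling_decay_bound[OF r, where V = V and E = E and d = d and \<alpha> = \<alpha>], goal_cases)
    case (1 C)
    show ?case by (rule 1(1)[OF 1(2-)])
  qed
  obtain C2 where C2: "1 \<le> C2" and transfer: "\<And>p q w w' P Q A M.
    \<lbrakk>muckenhoupt p w P; muckenhoupt q w' Q; 0 \<le> M;
     \<And>x y. x \<in> V \<Longrightarrow> y \<in> V \<Longrightarrow> cmod (A x y) \<le> M * K 1 g x y; lpw_stable V p w A\<rbrakk>
    \<Longrightarrow> 0 < stability_bound V p w A
      \<and> 1 \<le> C2 * (P powr (2 / p) * M / stability_bound V p w A)
      \<and> lpw_stable V q w' A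
      \<and> stability_bound V p w A / stability_bound V q w' A
        \<le> C2 * Q powr (1 / q) * P powr (1 / p) * (C2 * (P powr (2 / p) * M / stability_bound V p w A)) powr (2 * d / s)"
  proof (rule stability_transfer[OF s g], goal_cases)
    case (1 C)
    show ?case by (rule 1(1)[OF 1(2-)])
  qed
  define B0 where "B0 = C2 * C1"
  have B0: "1 \<le> B0" using C1 C2 mult_mono[of 1 C2 1 C1] by (simp add: B0_def)
  define \<theta> where "\<theta> = (2 * d + 1) * inv_conj_exp r"
  have \<theta>: "0 \<le> \<theta>"
  proof -
    have "inv_exp r \<le> 1" using r by (cases r) (auto simp: inv_exp_def one_ereal_def divide_le_eq)
    thus ?thesis using const_bounds by (simp add: \<theta>_def inv_conj_exp_def)
  qed
  \<comment> \<open>A positive lower bound of the logarithmic factor, valid because \<open>x \<ge> 1 / B0\<close>.\<close>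
  define l where "l = ln (1 + 1 / B0) powr \<theta>"
  have l: "0 < l"
  proof -
    have "0 < 1 / B0" using B0 by simp
    hence "0 < ln (1 + 1 / B0)" by (intro ln_gt_zero) linarith
    thus ?thesis by (simp add: l_def)
  qed
  define C where "C = C2 * B0 powr e * max 1 (1 / l)"
  have C: "0 < C" unfolding C_def using B0 C2 by (auto intro!: mult_pos_pos)
  have main: "0 < stability_bound V p w A \<and> lpw_stable V q w' A \<and>
      (let x = Ap_bound V E p w powr (2 / p) * beurling_norm V E d r \<alpha> A / stability_bound V p w A
         in stability_bound V p w A / stability_bound V q w' A
            \<le> C * Ap_bound V E q w' powr (1 / q) * Ap_bound V E p w powr (1 / p) * x powr e
               * (if \<alpha> \<noteq> 1 + d * inv_conj_exp r then 1 else ln (1 + x) powr \<theta>))"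
    if w: "Ap_weight V E p w" and w': "Ap_weight V E q w'" and A: "A \<in> beurling_algebra V E d r \<alpha>"
      and st: "lpw_stable V p w A" for w w' A
  proof -
    let ?P = "Ap_bound V E p w" and ?Q = "Ap_bound V E q w'" and ?n = "beurling_norm V E d r \<alpha> A"
    let ?\<beta> = "stability_bound V p w A"
    define x where "x = ?P powr (2 / p) * ?n / ?\<beta>"
    have entry': "cmod (A u v) \<le> C1 * ?n * K 1 g u v" if "u \<in> V" "v \<in> V" for u v
      using entry[OF A that] by (simp add: K_def g_def)
    have M: "0 \<le> C1 * ?n" using C1 norm0[OF A] by simp
    have x': "C2 * (?P powr (2 / p) * (C1 * ?n) / ?\<beta>) = B0 * x" by (simp add: x_def B0_def)
    have T: "0 < ?\<beta>" "1 \<le> B0 * x" "lpw_stable V q w' A"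
      "?\<beta> / stability_bound V q w' A \<le> C2 * ?Q powr (1 / q) * ?P powr (1 / p) * (B0 * x) powr (2 * d / s)"
      using transfer[OF Ap_weight_muckenhoupt[OF p w] Ap_weight_muckenhoupt[OF q w'] M entry' st]
      unfolding x' by blast+
    let ?lg = "if \<alpha> \<noteq> 1 + d * inv_conj_exp r then 1 else ln (1 + x) powr \<theta>"
    have xB: "1 / B0 \<le> x" using T(2) B0 by (simp add: field_simps)
    have "ln (1 + 1 / B0) powr \<theta> \<le> ln (1 + x) powr \<theta>"
    proof (rule powr_mono2[OF \<theta>])
      show "0 \<le> ln (1 + 1 / B0)" using B0 by simp
      have "0 < 1 + 1 / B0" using B0 by (simp add: add_pos_pos)
      thus "ln (1 + 1 / B0) \<le> ln (1 + x)" using xB by (intro ln_mono) auto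
    qed
    hence "1 \<le> 1 / l * ln (1 + x) powr \<theta>" using l by (simp add: l_def[symmetric] field_simps)
    also have "\<dots> \<le> max 1 (1 / l) * ln (1 + x) powr \<theta>" by (intro mult_right_mono) auto
    finally have lg: "1 \<le> max 1 (1 / l) * ?lg" by auto
    have "(B0 * x) powr (2 * d / s) \<le> (B0 * x) powr e" using T(2) e by (intro powr_mono) auto
    also have "\<dots> = B0 powr e * x powr e" by (simp add: powr_mult)
    also have "\<dots> \<le> B0 powr e * x powr e * (max 1 (1 / l) * ?lg)"
      using mult_left_mono[OF lg, of "B0 powr e * x powr e"] by simp
    finally have "C2 * ?Q powr (1 / q) * ?P powr (1 / p) * (B0 * x) powr (2 * d / s)
        \<le> C2 * ?Q powr (1 / q) * ?P powr (1 / p) * (B0 powr e * x powr e * (max 1 (1 / l) * ?lg))"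
      using C2 by (intro mult_left_mono) auto
    also have "\<dots> = C * ?Q powr (1 / q) * ?P powr (1 / p) * x powr e * ?lg"
      by (simp only: C_def mult_ac)
    finally have "?\<beta> / stability_bound V q w' A \<le> C * ?Q powr (1 / q) * ?P powr (1 / p) * x powr e * ?lg"
      using T(4) by linarith
    thus ?thesis using T(1,3) unfolding Let_def x_def by blast
  qed
  show ?thesis
  proof (intro conjI allI impI)
    fix w w' A
    assume H: "Ap_weight V E p w \<and> Ap_weight V E q w' \<and> A \<in> beurling_algebra V E d r \<alpha> \<and> lpw_stable V p w A"
    thus st: "lpw_stable V q w' A" using main by blast
    have "0 < w' x0" using H x0 by (simp add: Ap_weight_def)
    thus "\<forall>c\<in>lpw V q w'. stability_bound V q w' A * lpw_norm V q w' c \<le> lpw_norm V q w' (mat_apply V A c)"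
      using stability_bound_props(2)[where w = w', OF x0 _ q st] by blast
  next
    show "\<exists>C>0. \<forall>w w' A. Ap_weight V E p w \<and> Ap_weight V E q w' \<and> A \<in> beurling_algebra V E d r \<alpha> \<and>
        lpw_stable V p w A \<longrightarrow>
        (let x = Ap_bound V E p w powr (2 / p) * beurling_norm V E d r \<alpha> A
                   / stability_bound V p w A
         in stability_bound V p w A / stability_bound V q w' A
            \<le> C * Ap_bound V E q w' powr (1 / q) * Ap_bound V E p w powr (1 / p)
               * x powr ((dt + d + 1) / min 1 (\<alpha> - d * inv_conj_exp r))
               * (if \<alpha> \<noteq> 1 + d * inv_conj_exp r then 1
                  else ln (1 + x) powr ((2 * d + 1) * inv_conj_exp r)))"
      using C main unfolding e_def \<kappa>_def \<theta>_def by (intro exI[of _ C]) blast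
  qed
qed

end
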